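(* Let $q\ge4$ be a fixed even integer and $\beta>0$ a constant. Let $\rho_\beta$ and $\rho_\beta'$ be the Gibbs states at inverse temperature $\beta$ of two independent SYK instances $H$ and $H'$. Then, with probability $1-o(1)$ as $n\to\infty$, \[ \max_{I \in \binom{[n]}{q}} \left|\mathrm{Tr}(\psi_I \rho_\beta) - \mathrm{Tr}(\psi_I \rho_\beta')\right| = \Omega\left(n^{-(q-1)/2}\right). \]
   Context: Majorana operators $\psi_1,\dots,\psi_n$ ($n$ even) are Hermitian operators on a Hilbert space of dimension $2^{n/2}$ with $\{\psi_i,\psi_j\}=\delta_{ij}$; for $I=\{i_1<\dots<i_q\}$, $\psi_I=i^{q/2}\psi_{i_1}\cdots\psi_{i_q}$. An SYK instance is $H=\sum_{I\in\binom{[n]}{q}}J_I\psi_I$ with $J_I$ i.i.d. $\mathcal{N}(0,\sigma^2)$, $\sigma^2=(q-1)!/n^{q-1}$, and its Gibbs state is $\rho_\beta=e^{-\beta H}/\mathrm{Tr}\,e^{-\beta H}$. *)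

theory Defs
  imports "HOL-Probability.Probability" "Jordan_Normal_Form.Matrix"
begin

definition mtrace :: "complex mat \<Rightarrow> complex" where
  "mtrace A = (\<Sum>i<dim_row A. A $$ (i, i))"

definition hermitian_mat :: "nat \<Rightarrow> complex mat \<Rightarrow> bool" where
  "hermitian_mat d A \<longleftrightarrow> A \<in> carrier_mat d d \<and>
     (\<forall>i<d. \<forall>j<d. A $$ (j, i) = cnj (A $$ (i, j)))"

definition mexp :: "complex mat \<Rightarrow> complex mat" where
  "mexp A = mat (dim_row A) (dim_col A)
     (\<lambda>(i, j). (\<Sum>k. (A ^\<^sub>m k) $$ (i, j) / of_nat (fact k)))"

definition majorana :: "nat \<Rightarrow> (nat \<Rightarrow> complex mat) \<Rightarrow> bool" where
  "majorana n \<psi> \<longleftrightarrow>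
     (\<forall>i\<in>{1..n}. hermitian_mat (2 ^ (n div 2)) (\<psi> i)) \<and>
     (\<forall>i\<in>{1..n}. \<forall>j\<in>{1..n}.
        \<psi> i * \<psi> j + \<psi> j * \<psi> i = (if i = j then 1\<^sub>m (2 ^ (n div 2)) else 0\<^sub>m (2 ^ (n div 2)) (2 ^ (n div 2))))"

definition qsubsets :: "nat \<Rightarrow> nat \<Rightarrow> nat set set" where
  "qsubsets n q = {I. I \<subseteq> {1..n} \<and> card I = q}"

definition psi_set :: "nat \<Rightarrow> (nat \<Rightarrow> complex mat) \<Rightarrow> nat set \<Rightarrow> complex mat" where
  "psi_set n \<psi> I = (\<i> ^ (card I div 2)) \<cdot>\<^sub>m
     foldr (\<lambda>i M. \<psi> i * M) (sorted_list_of_set I) (1\<^sub>m (2 ^ (n div 2)))"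

definition syk_ham :: "nat \<Rightarrow> nat \<Rightarrow> (nat \<Rightarrow> complex mat) \<Rightarrow> (nat set \<Rightarrow> real) \<Rightarrow> complex mat" where
  "syk_ham n q \<psi> J = mat (2 ^ (n div 2)) (2 ^ (n div 2))
     (\<lambda>(a, b). \<Sum>I\<in>qsubsets n q. complex_of_real (J I) * psi_set n \<psi> I $$ (a, b))"

definition gibbs :: "real \<Rightarrow> complex mat \<Rightarrow> complex mat" where
  "gibbs \<beta> H = (1 / mtrace (mexp ((- complex_of_real \<beta>) \<cdot>\<^sub>m H))) \<cdot>\<^sub>m mexp ((- complex_of_real \<beta>) \<cdot>\<^sub>m H)"

definition syk_var :: "nat \<Rightarrow> nat \<Rightarrow> real" where
  "syk_var n q = fact (q - 1) / real n ^ (q - 1)"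

text \<open>Probability space of two independent SYK instances: coupling J_I = w (I, False),
  J'_I = w (I, True), all i.i.d. N(0, sigma^2) (normal_density takes the std deviation).\<close>
definition two_syk_space :: "nat \<Rightarrow> nat \<Rightarrow> ((nat set \<times> bool) \<Rightarrow> real) measure" where
  "two_syk_space n q = (\<Pi>\<^sub>M x \<in> qsubsets n q \<times> (UNIV :: bool set).
      density lborel (normal_density 0 (sqrt (syk_var n q))))"

end

theory Submission
  imports Defs "Jordan_Normal_Form.Spectral_Radius" "Jordan_Normal_Form.Schur_Decomposition"
    "HOL-Real_Asymp.Real_Asymp"
begin

text \<open>
  Write \<open>a\<^sub>I = Tr (\<psi>\<^sub>I \<rho>)\<close>. The gap \<open>max |a\<^sub>I - a'\<^sub>I|\<close> times \<open>\<Sum>I. |J\<^sub>I| + |J'\<^sub>I|\<close>, which is of order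
  \<open>n\<^bsup>(q+1)/2\<^esup>\<close>, dominates \<open>- \<Sum>I. (J\<^sub>I - J'\<^sub>I) (a\<^sub>I - a'\<^sub>I)\<close>, that is
  \<open>- Tr (H \<rho>) - Tr (H' \<rho>')\<close> plus two cross terms that are \<open>O(\<surd>n)\<close> by independence. So it suffices
  that the energy \<open>- Tr (H \<rho>)\<close> is at least a multiple of \<open>n\<close> with high probability. By convexity
  \<open>- \<beta> Tr (H \<rho>) \<ge> log (Z / d)\<close>; the right-hand side is Lipschitz in every coupling, hence concentrated,
  and convexity again bounds its mean below by the mean energy at inverse temperature \<open>\<beta> / 2\<close>.
  Gaussian integration by parts turns the mean energy into \<open>\<beta> \<sigma>\<^sup>2 \<Sum>I. D\<^sub>I - a\<^sub>I\<^sup>2\<close>, with \<open>D\<^sub>I\<close> the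
  Duhamel two-point function. Anticommuting pairs give \<open>a\<^sub>I\<^sup>2 + a\<^sub>L\<^sup>2 \<le> 2\<^bsup>-q\<^esup>\<close>, and
  \<open>D\<^sub>I \<ge> \<langle>\<psi>\<^sub>I\<^sup>2\<rangle> - \<langle>[\<psi>\<^sub>I, [\<beta> H, \<psi>\<^sub>I]]\<rangle> / 12\<close>; summed over \<open>I\<close> the double commutators reproduce
  a multiple of the energy itself, so the resulting inequality can be solved for the energy.
\<close>

section \<open>Spectral theorem for Hermitian matrices\<close>

unbundle no vec_syntax

text \<open>Concentration is applied to log Z and not to the energy: the derivative of the energy in
  a coupling contains a sum weighted by the couplings, with no uniform bound at hand, while the
  derivative of log Z is -b times a single Gibbs expectation and so at most b sqrt s in absolute
  value. The resulting variance is O(n) against a mean of order n, so Chebyshev's inequality is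
  enough.

  The inequality for the energy can be solved without loss of order because of two different
  scalings. With Q the set of monomials and K the number of them that anticommute with a given one,
  sigma^2 |Q| grows like n while sigma^2 K stays bounded; the double commutators therefore cost only
  a constant factor. The anticommuting pairs are needed because the single bound a_I^2 <= s would
  allow a_I^2 to cancel the leading term s of D_I; pairing saves half of it.

  The constant 12 comes from u coth u <= 1 + u^2 / 3 with u half the difference of two eigenvalues
  of the exponent.\<close>

definition adj :: "complex mat \<Rightarrow> complex mat" where
  "adj A = mat (dim_col A) (dim_row A) (\<lambda>(i, j). cnj (A $$ (j, i)))"

definition rdiag :: "nat \<Rightarrow> (nat \<Rightarrow> real) \<Rightarrow> complex mat" where
  "rdiag n x = mat n n (\<lambda>(i, j). if i = j then complex_of_real (x i) else 0)"

lemma adj_carrier [simp, intro]: "A \<in> carrier_mat n m \<Longrightarrow> adj A \<in> carrier_mat m n"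
  by (auto simp: adj_def)

lemma rdiag_carrier [simp, intro]: "rdiag n x \<in> carrier_mat n n"
  by (simp add: rdiag_def)

lemma adj_adj [simp]: "adj (adj A) = A"
  by (rule eq_matI) (auto simp: adj_def)

lemma mult_mat_index:
  assumes "A \<in> carrier_mat n k" "B \<in> carrier_mat k m" "i < n" "j < m"
  shows "(A * B) $$ (i, j) = (\<Sum>l<k. A $$ (i, l) * B $$ (l, j))"
  using assms by (auto simp: scalar_prod_def lessThan_atLeast0)

lemma adj_mult:
  assumes "A \<in> carrier_mat n k" "B \<in> carrier_mat k m"
  shows "adj (A * B) = adj B * adj A"
proof (rule eq_matI)
  fix i j assume ij: "i < dim_row (adj B * adj A)" "j < dim_col (adj B * adj A)"
  with assms have ij': "i < m" "j < n" by (auto simp: adj_def)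
  show "adj (A * B) $$ (i, j) = (adj B * adj A) $$ (i, j)"
    using assms ij' mult_mat_index[OF assms ij'(2,1)] mult_mat_index[OF adj_carrier[OF assms(2)] adj_carrier[OF assms(1)] ij']
    by (auto simp: adj_def mult.commute)
qed (use assms in \<open>auto simp: adj_def\<close>)

lemma hermitian_mat_carrier: "hermitian_mat n A \<Longrightarrow> A \<in> carrier_mat n n"
  unfolding hermitian_mat_def by blast

lemma hermitian_mat_entry: "hermitian_mat n A \<Longrightarrow> i < n \<Longrightarrow> j < n \<Longrightarrow> cnj (A $$ (j, i)) = A $$ (i, j)"
  unfolding hermitian_mat_def by (metis complex_cnj_cnj)

lemma hermitian_matI:
  "A \<in> carrier_mat n n \<Longrightarrow> (\<And>i j. i < n \<Longrightarrow> j < n \<Longrightarrow> cnj (A $$ (j, i)) = A $$ (i, j)) \<Longrightarrow> hermitian_mat n A"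
  unfolding hermitian_mat_def by metis

lemma adj_index: "A \<in> carrier_mat n m \<Longrightarrow> i < m \<Longrightarrow> j < n \<Longrightarrow> adj A $$ (i, j) = cnj (A $$ (j, i))"
  by (auto simp: adj_def)

lemma hermitian_mat_iff_adj: "hermitian_mat n A \<longleftrightarrow> A \<in> carrier_mat n n \<and> adj A = A"
proof
  assume h: "hermitian_mat n A"
  note A = hermitian_mat_carrier[OF h]
  have "adj A = A"
  proof (rule eq_matI)
    fix i j assume "i < dim_row A" "j < dim_col A"
    with A have ij: "i < n" "j < n" by auto
    show "adj A $$ (i, j) = A $$ (i, j)"
      unfolding adj_index[OF A ij] by (rule hermitian_mat_entry[OF h ij])
  qed (use A in \<open>auto simp: adj_def\<close>)
  with A show "A \<in> carrier_mat n n \<and> adj A = A" by blast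
next
  assume h: "A \<in> carrier_mat n n \<and> adj A = A"
  show "hermitian_mat n A"
  proof (rule hermitian_matI)
    fix i j assume ij: "i < n" "j < n"
    have "adj A $$ (i, j) = cnj (A $$ (j, i))" by (rule adj_index) (use h ij in blast)+
    then show "cnj (A $$ (j, i)) = A $$ (i, j)" using h by (simp only:)
  qed (use h in blast)
qed

text \<open>Complete \<open>v\<close> to a basis and orthogonalise it by Gram-Schmidt, which leaves
  the first vector unchanged; normalising the columns yields a unitary matrix.\<close>

lemma unitary_with_first_column:
  assumes v: "v \<in> carrier_vec n" and v0: "v \<noteq> 0\<^sub>v n"
  obtains W c where "W \<in> carrier_mat n n" "adj W * W = 1\<^sub>m n" "W * adj W = 1\<^sub>m n"
    "\<And>i. i < n \<Longrightarrow> W $$ (i, 0) = c * v $ i"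
proof -
  interpret cof_vec_space n "TYPE(complex)" .
  define b where "b = basis_completion v"
  define ws where "ws = gram_schmidt n b"
  have n: "n \<noteq> 0" using v v0 by (cases n) auto
  from basis_completion[OF v v0, folded b_def]
  have dist_b: "distinct b" and indep: "\<not> lin_dep (set b)" and b: "set b \<subseteq> carrier_vec n"
    and hdb: "hd b = v" and len_b: "length b = n" by auto
  from hdb len_b n obtain vs where bv: "b = v # vs" by (cases b) auto
  from gram_schmidt_result[OF b dist_b indep refl, folded ws_def]
  have ws: "set ws \<subseteq> carrier_vec n" "corthogonal ws" "length ws = n"
    by (auto simp: len_b)
  have "hd ws = v" using gram_schmidt_hd[OF v, of vs, folded bv] unfolding ws_def .
  then have ws0: "ws ! 0 = v" using ws n by (cases ws) auto
  \<comment> \<open>Gram-Schmidt returns orthogonal vectors that are not normalised;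
    \<open>r j\<close> is the squared norm of the j-th one.\<close>
  define r where "r j = Re (ws ! j \<bullet>c ws ! j)" for j
  have wsj: "ws ! j \<in> carrier_vec n" if "j < n" for j using ws that by auto
  have ip: "ws ! j \<bullet>c ws ! i = (\<Sum>k<n. (ws ! j) $ k * cnj ((ws ! i) $ k))" if "i < n" "j < n" for i j
    using wsj[OF that(1)] wsj[OF that(2)] by (auto simp: scalar_prod_def lessThan_atLeast0)
  have rpos: "r j > 0" and rj: "ws ! j \<bullet>c ws ! j = complex_of_real (r j)" if "j < n" for j
  proof -
    have e: "ws ! j \<bullet>c ws ! j = complex_of_real (\<Sum>k<n. (cmod ((ws ! j) $ k))\<^sup>2)"
      unfolding ip[OF that that] of_real_sum by (intro sum.cong refl) (simp add: complex_norm_square[symmetric])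
    then show rj: "ws ! j \<bullet>c ws ! j = complex_of_real (r j)" by (simp add: r_def)
    have "ws ! j \<bullet>c ws ! j \<noteq> 0" using corthogonalD[OF ws(2), of j j] ws(3) that by simp
    then have "r j \<noteq> 0" using rj by auto
    moreover have "r j \<ge> 0" unfolding r_def e by (simp add: sum_nonneg)
    ultimately show "r j > 0" by simp
  qed
  define W where "W = mat n n (\<lambda>(i, j). (ws ! j) $ i / complex_of_real (sqrt (r j)))"
  have W: "W \<in> carrier_mat n n" by (simp add: W_def)
  have 1: "adj W * W = 1\<^sub>m n"
  proof (rule eq_matI)
    fix i j assume "i < dim_row (1\<^sub>m n :: complex mat)" "j < dim_col (1\<^sub>m n :: complex mat)"
    then have i: "i < n" and j: "j < n" by auto
    have "(adj W * W) $$ (i, j) = (\<Sum>k<n. adj W $$ (i, k) * W $$ (k, j))"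
      by (rule mult_mat_index[OF adj_carrier[OF W] W i j])
    also have "\<dots> = (\<Sum>k<n. (ws ! j) $ k * cnj ((ws ! i) $ k)) / (complex_of_real (sqrt (r i)) * complex_of_real (sqrt (r j)))"
      unfolding sum_divide_distrib using i j by (intro sum.cong refl) (auto simp: adj_def W_def)
    also have "\<dots> = (1\<^sub>m n) $$ (i, j)"
    proof (cases "i = j")
      case True
      have "complex_of_real (sqrt (r j)) * complex_of_real (sqrt (r j)) = complex_of_real (r j)"
        using rpos[OF j] by (simp flip: of_real_mult)
      then show ?thesis using True i j rj[OF j] rpos[OF j] unfolding ip[OF i j, symmetric] by simp
    next
      case False
      then have "ws ! j \<bullet>c ws ! i = 0" using corthogonalD[OF ws(2), of j i] ws(3) i j by simp
      then show ?thesis using False i j unfolding ip[OF i j, symmetric] by simp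
    qed
    finally show "(adj W * W) $$ (i, j) = (1\<^sub>m n) $$ (i, j)" .
  qed (use W in \<open>auto simp: adj_def\<close>)
  have 2: "W * adj W = 1\<^sub>m n"
    using mat_mult_left_right_inverse[OF adj_carrier[OF W] W 1] .
  have 3: "W $$ (i, 0) = (1 / complex_of_real (sqrt (r 0))) * v $ i" if "i < n" for i
    using that n by (simp add: W_def ws0)
  show ?thesis using that[OF W 1 2 3] .
qed

lemma hermitian_conj:
  assumes "hermitian_mat n A" "W \<in> carrier_mat n n"
  shows "hermitian_mat n (adj W * A * W)"
proof -
  have A: "A \<in> carrier_mat n n" "adj A = A" using assms by (auto simp: hermitian_mat_iff_adj)
  have "adj (adj W * A * W) = adj W * (adj A * adj (adj W))"
    using A assms by (simp add: adj_mult[of _ n n _ n] mult_carrier_mat[of _ n n _ n])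
  also have "\<dots> = adj W * A * W" using A assms by (simp add: assoc_mult_mat[of _ n n _ n _ n])
  finally show ?thesis using A assms by (simp add: hermitian_mat_iff_adj mult_carrier_mat[of _ n n _ n])
qed

lemma unitary_conj_cancel:
  assumes "W \<in> carrier_mat n n" "A \<in> carrier_mat n n" "W * adj W = 1\<^sub>m n"
  shows "W * (adj W * A * W) * adj W = A"
proof -
  have c: "adj W \<in> carrier_mat n n" using assms by auto
  have "W * (adj W * A * W) = (W * adj W) * (A * W)"
    using assms(1,2) c by (simp add: assoc_mult_mat[of _ n n _ n _ n] mult_carrier_mat[of _ n n _ n])
  also have "\<dots> = A * W" using assms by (simp add: mult_carrier_mat[of _ n n _ n])
  finally have "W * (adj W * A * W) * adj W = A * (W * adj W)"
    using assms(1,2) c by (simp add: assoc_mult_mat[of _ n n _ n _ n])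
  then show ?thesis using assms by simp
qed

definition sblock :: "nat \<Rightarrow> complex \<Rightarrow> complex mat \<Rightarrow> complex mat" where
  "sblock n a M = four_block_mat (mat 1 1 (\<lambda>_. a)) (0\<^sub>m 1 n) (0\<^sub>m n 1) M"

lemma sblock_carrier: "M \<in> carrier_mat n n \<Longrightarrow> sblock n a M \<in> carrier_mat (Suc n) (Suc n)"
  by (auto simp: sblock_def)

lemma sblock_mult:
  assumes "M \<in> carrier_mat n n" "N \<in> carrier_mat n n"
  shows "sblock n a M * sblock n b N = sblock n (a * b) (M * N)"
proof -
  have 1: "mat 1 1 (\<lambda>_. a) * mat 1 1 (\<lambda>_. b) = mat 1 1 (\<lambda>_. a * b)"
    by (rule eq_matI) (auto simp: scalar_prod_def)
  have "sblock n a M * sblock n b N =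
    four_block_mat (mat 1 1 (\<lambda>_. a) * mat 1 1 (\<lambda>_. b) + 0\<^sub>m 1 n * 0\<^sub>m n 1) (mat 1 1 (\<lambda>_. a) * 0\<^sub>m 1 n + 0\<^sub>m 1 n * N)
      (0\<^sub>m n 1 * mat 1 1 (\<lambda>_. b) + M * 0\<^sub>m n 1) (0\<^sub>m n 1 * 0\<^sub>m 1 n + M * N)"
    unfolding sblock_def by (rule mult_four_block_mat) (use assms in auto)
  also have "\<dots> = sblock n (a * b) (M * N)"
    unfolding sblock_def 1 by (rule cong_four_block_mat) (use assms in auto)
  finally show ?thesis .
qed

lemma sblock_one: "sblock n 1 (1\<^sub>m n) = 1\<^sub>m (Suc n)"
  by (rule eq_matI) (auto simp: sblock_def)

lemma adj_sblock: "M \<in> carrier_mat n n \<Longrightarrow> adj (sblock n a M) = sblock n (cnj a) (adj M)"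
  by (rule eq_matI) (auto simp: sblock_def adj_def)

text \<open>Deflation: conjugating by a unitary whose first column is an eigenvector makes the first
  column of \<open>B\<close> a multiple of the first unit vector. As \<open>B\<close> is Hermitian,
  its first row has the same form and the eigenvalue is real, so the induction hypothesis applies to
  the remaining block.\<close>

theorem hermitian_diagonalizable:
  "hermitian_mat n A \<Longrightarrow> \<exists>U x. U \<in> carrier_mat n n \<and> adj U * U = 1\<^sub>m n \<and> U * adj U = 1\<^sub>m n \<and>
     A = U * rdiag n x * adj U"
proof (induction n arbitrary: A)
  case 0
  then have A: "A \<in> carrier_mat 0 0" by (rule hermitian_mat_carrier)
  have z: "B = C" if "B \<in> carrier_mat 0 0" "C \<in> carrier_mat 0 0" for B C :: "complex mat"
    by (rule eq_matI) (use that in auto)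
  show ?case
    by (intro exI[of _ "1\<^sub>m 0"] exI[of _ "\<lambda>_. 0"] conjI z) (use A in \<open>auto intro!: mult_carrier_mat[of _ 0 0 _ 0]\<close>)
next
  case (Suc n A)
  define m where "m = Suc n"
  have m0: "0 < m" by (simp add: m_def)
  have hA: "hermitian_mat m A" using Suc.prems unfolding m_def .
  have A: "A \<in> carrier_mat m m" by (rule hermitian_mat_carrier[OF hA])
  obtain e where "e \<in> spectrum A" using spectrum_non_empty[OF A] m0 by auto
  then obtain v where v: "v \<in> carrier_vec m" "v \<noteq> 0\<^sub>v m" "A *\<^sub>v v = e \<cdot>\<^sub>v v"
    using A by (auto simp: spectrum_def eigenvalue_def eigenvector_def)
  obtain W c where W: "W \<in> carrier_mat m m" "adj W * W = 1\<^sub>m m" "W * adj W = 1\<^sub>m m"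
    and W0: "\<And>i. i < m \<Longrightarrow> W $$ (i, 0) = c * v $ i"
    using unitary_with_first_column[OF v(1,2)] by blast
  note aW = adj_carrier[OF W(1)]
  define B where "B = adj W * A * W"
  have hB: "hermitian_mat m B" unfolding B_def by (rule hermitian_conj[OF hA W(1)])
  then have B: "B \<in> carrier_mat m m" by (rule hermitian_mat_carrier)
  have AW0: "(A * W) $$ (k, 0) = e * W $$ (k, 0)" if "k < m" for k
  proof -
    have "(A * W) $$ (k, 0) = (\<Sum>l<m. A $$ (k, l) * (c * v $ l))"
      using mult_mat_index[OF A W(1) that m0] W0 by simp
    also have "\<dots> = c * (\<Sum>l<m. A $$ (k, l) * v $ l)"
      unfolding sum_distrib_left by (intro sum.cong refl) (simp add: mult.left_commute)
    also have "\<dots> = c * (A *\<^sub>v v) $ k"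
      using A v(1) that by (simp add: scalar_prod_def lessThan_atLeast0)
    also have "\<dots> = e * W $$ (k, 0)" using v that W0 by simp
    finally show ?thesis .
  qed
  have B0: "B $$ (i, 0) = (if i = 0 then e else 0)" if "i < m" for i
  proof -
    have "B $$ (i, 0) = (adj W * (A * W)) $$ (i, 0)"
      using A W(1) aW by (simp only: B_def assoc_mult_mat[of _ m m _ m _ m])
    also have "\<dots> = (\<Sum>k<m. adj W $$ (i, k) * (A * W) $$ (k, 0))"
      by (rule mult_mat_index[OF aW mult_carrier_mat[OF A W(1)] that m0])
    also have "\<dots> = e * (\<Sum>k<m. adj W $$ (i, k) * W $$ (k, 0))"
      unfolding sum_distrib_left by (intro sum.cong refl) (simp add: AW0)
    also have "(\<Sum>k<m. adj W $$ (i, k) * W $$ (k, 0)) = (adj W * W) $$ (i, 0)"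
      by (rule mult_mat_index[OF aW W(1) that m0, symmetric])
    finally show ?thesis using W(2) that m0 by simp
  qed
  have B0': "B $$ (0, i) = (if i = 0 then e else 0)" if "i < m" for i
  proof -
    have "cnj (B $$ (i, 0)) = B $$ (0, i)" by (rule hermitian_mat_entry[OF hB m0 that])
    moreover have "cnj (B $$ (0, 0)) = B $$ (0, 0)" by (rule hermitian_mat_entry[OF hB m0 m0])
    ultimately show ?thesis using B0[OF that] B0[OF m0] by auto
  qed
  have "cnj (B $$ (0, 0)) = B $$ (0, 0)" by (rule hermitian_mat_entry[OF hB m0 m0])
  then have "cnj e = e" unfolding B0[OF m0] by simp
  then have er: "e = complex_of_real (Re e)" by (metis Re_complex_of_real Reals_cases Reals_cnj_iff)
  define C where "C = mat n n (\<lambda>(i, j). B $$ (Suc i, Suc j))"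
  have "hermitian_mat n C"
    by (rule hermitian_matI) (auto simp: C_def m_def intro: hermitian_mat_entry[OF hB, unfolded m_def])
  from Suc.IH[OF this] obtain U x where U: "U \<in> carrier_mat n n" "adj U * U = 1\<^sub>m n" "U * adj U = 1\<^sub>m n"
    and C: "C = U * rdiag n x * adj U" by blast
  note aU = adj_carrier[OF U(1)]
  define V where "V = sblock n 1 U"
  define y where "y = (\<lambda>i. case i of 0 \<Rightarrow> Re e | Suc k \<Rightarrow> x k)"
  have V: "V \<in> carrier_mat m m" using sblock_carrier[OF U(1)] by (simp add: V_def m_def)
  have aV: "adj V = sblock n 1 (adj U)" using adj_sblock[OF U(1)] by (simp add: V_def)
  have VV: "adj V * V = 1\<^sub>m m" "V * adj V = 1\<^sub>m m"
    unfolding aV unfolding V_def sblock_mult[OF U(1) aU] sblock_mult[OF aU U(1)] U(2,3) m_def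
    by (simp_all add: sblock_one)
  have D: "rdiag m y = sblock n e (rdiag n x)"
    by (rule eq_matI) (use er[symmetric] in \<open>auto simp: m_def rdiag_def y_def sblock_def split: nat.splits\<close>)
  have "V * rdiag m y * adj V = sblock n e C"
    unfolding aV D unfolding V_def sblock_mult[OF U(1) rdiag_carrier] sblock_mult[OF mult_carrier_mat[OF U(1) rdiag_carrier] aU] C
    by simp
  also have "\<dots> = B"
  proof (rule eq_matI)
    fix i j assume "i < dim_row B" "j < dim_col B"
    then have ij: "i < m" "j < m" using B by auto
    show "sblock n e C $$ (i, j) = B $$ (i, j)"
      using ij B0[OF ij(1)] B0'[OF ij(2)] by (cases i; cases j) (simp_all add: sblock_def C_def m_def)
  qed (use B in \<open>auto simp: sblock_def C_def m_def\<close>)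
  finally have BV: "B = V * rdiag m y * adj V" by simp
  note aV' = adj_carrier[OF V]
  have c: "W * V \<in> carrier_mat m m" by (rule mult_carrier_mat[OF W(1) V])
  have a: "adj (W * V) = adj V * adj W" by (rule adj_mult[OF W(1) V])
  have "adj (W * V) * (W * V) = adj V * (adj W * (W * V))"
    unfolding a by (rule assoc_mult_mat[OF aV' aW c])
  also have "adj W * (W * V) = V"
    using assoc_mult_mat[OF aW W(1) V, symmetric] W(2) V by simp
  finally have u1: "adj (W * V) * (W * V) = 1\<^sub>m m" using VV by simp
  have u2: "(W * V) * adj (W * V) = 1\<^sub>m m"
    by (rule mat_mult_left_right_inverse[OF adj_carrier[OF c] c u1])
  have "A = W * B * adj W" unfolding B_def by (rule unitary_conj_cancel[OF W(1) A W(3), symmetric])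
  also have "\<dots> = (W * V) * rdiag m y * adj (W * V)"
    unfolding BV a using W(1) V aV' aW rdiag_carrier[of m y]
    by (simp add: assoc_mult_mat[of _ m m _ m _ m] mult_carrier_mat[of _ m m _ m])
  finally have "A = (W * V) * rdiag m y * adj (W * V)" .
  with c u1 u2 show ?case unfolding m_def[symmetric] by (intro exI[of _ "W * V"] exI[of _ y] conjI)
qed

section \<open>Matrix exponentials and their directional derivatives\<close>

lemma mtrace_mult:
  assumes "A \<in> carrier_mat n m" "B \<in> carrier_mat m n"
  shows "mtrace (A * B) = (\<Sum>i<n. \<Sum>j<m. A $$ (i, j) * B $$ (j, i))"
  unfolding mtrace_def using assms mult_mat_index[OF assms] by auto

lemma mtrace_mult_commute:
  assumes "A \<in> carrier_mat n m" "B \<in> carrier_mat m n"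
  shows "mtrace (A * B) = mtrace (B * A)"
  unfolding mtrace_mult[OF assms] mtrace_mult[OF assms(2,1)]
  by (subst sum.swap) (simp add: mult.commute)

lemma rdiag_mult: "rdiag n x * rdiag n y = rdiag n (\<lambda>i. x i * y i)"
proof (rule eq_matI)
  fix i j assume "i < dim_row (rdiag n (\<lambda>i. x i * y i))" "j < dim_col (rdiag n (\<lambda>i. x i * y i))"
  then have ij: "i < n" "j < n" by (auto simp: rdiag_def)
  have "(rdiag n x * rdiag n y) $$ (i, j) = (\<Sum>l<n. rdiag n x $$ (i, l) * rdiag n y $$ (l, j))"
    by (rule mult_mat_index[OF rdiag_carrier rdiag_carrier ij])
  also have "\<dots> = (\<Sum>l<n. if l = i then (if i = j then complex_of_real (x i * y i) else 0) else 0)"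
    using ij by (intro sum.cong refl) (auto simp: rdiag_def)
  also have "\<dots> = rdiag n (\<lambda>i. x i * y i) $$ (i, j)"
    using ij by (simp add: rdiag_def)
  finally show "(rdiag n x * rdiag n y) $$ (i, j) = rdiag n (\<lambda>i. x i * y i) $$ (i, j)" .
qed (auto simp: rdiag_def)

lemma mult_rdiag_index:
  assumes "A \<in> carrier_mat m n" "i < m" "j < n"
  shows "(A * rdiag n f) $$ (i, j) = A $$ (i, j) * complex_of_real (f j)"
proof -
  have "(A * rdiag n f) $$ (i, j) = (\<Sum>l<n. A $$ (i, l) * rdiag n f $$ (l, j))"
    by (rule mult_mat_index[OF assms(1) rdiag_carrier assms(2,3)])
  also have "\<dots> = (\<Sum>l<n. if l = j then A $$ (i, j) * complex_of_real (f j) else 0)"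
    using assms by (intro sum.cong refl) (auto simp: rdiag_def)
  finally show ?thesis using assms by simp
qed

lemma rdiag_mult_index:
  assumes "A \<in> carrier_mat n m" "i < n" "j < m"
  shows "(rdiag n f * A) $$ (i, j) = complex_of_real (f i) * A $$ (i, j)"
proof -
  have "(rdiag n f * A) $$ (i, j) = (\<Sum>l<n. rdiag n f $$ (i, l) * A $$ (l, j))"
    by (rule mult_mat_index[OF rdiag_carrier assms(1,2,3)])
  also have "\<dots> = (\<Sum>l<n. if l = i then complex_of_real (f i) * A $$ (i, j) else 0)"
    using assms by (intro sum.cong refl) (auto simp: rdiag_def)
  finally show ?thesis using assms by simp
qed

lemma rdiag_one: "rdiag n (\<lambda>_. 1) = 1\<^sub>m n"
  by (rule eq_matI) (auto simp: rdiag_def)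

text \<open>\<^term>\<open>dpow d M Y k\<close> is the derivative of \<open>M ^ k\<close> in direction \<open>Y\<close>, and
  \<^term>\<open>dquot k a b\<close> is the divided difference \<open>(a ^ k - b ^ k) / (a - b)\<close>, which
  represents it in an eigenbasis of \<open>M\<close>.\<close>

primrec dpow :: "nat \<Rightarrow> complex mat \<Rightarrow> complex mat \<Rightarrow> nat \<Rightarrow> complex mat" where
  "dpow d M Y 0 = 0\<^sub>m d d"
| "dpow d M Y (Suc k) = dpow d M Y k * M + M ^\<^sub>m k * Y"

primrec dquot :: "nat \<Rightarrow> real \<Rightarrow> real \<Rightarrow> real" where
  "dquot 0 a b = 0"
| "dquot (Suc k) a b = dquot k a b * b + a ^ k"

text \<open>The divided difference of \<open>exp\<close>, equal to the integral of exp (u a + (1 -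
  u) b) over u in [0, 1]. It is the kernel by which the derivative of the matrix exponential acts in
  an eigenbasis (Daleckii-Krein formula).\<close>

definition expquot :: "real \<Rightarrow> real \<Rightarrow> real" where
  "expquot a b = (if a = b then exp a else (exp a - exp b) / (a - b))"

lemma dquot_diff: "(a - b) * dquot k a b = a ^ k - b ^ k"
proof (induction k)
  case (Suc k)
  have "(a - b) * dquot (Suc k) a b = ((a - b) * dquot k a b) * b + (a - b) * a ^ k"
    by (simp add: algebra_simps)
  then show ?case unfolding Suc.IH by (simp add: algebra_simps)
qed simp

lemma dquot_same: "dquot (Suc k) a a = real (Suc k) * a ^ k"
  by (induction k) (auto simp: algebra_simps)

lemma exp_sums: "(\<lambda>k. a ^ k / fact k) sums exp (a::real)"
  using exp_converges[of a] by (simp add: field_simps)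

lemma dquot_sums: "(\<lambda>k. dquot k a b / fact k) sums expquot a b"
proof (cases "a = b")
  case True
  \<comment> \<open>On the diagonal \<open>dquot k a a\<close> is the derivative of the k-th power;
    its term at k = 0 vanishes, so shifting the index by one recovers the exponential
    series.\<close>
  have "(\<lambda>k. dquot (Suc k) a a / fact (Suc k)) = (\<lambda>k. a ^ k / fact k)"
    unfolding dquot_same by (simp add: fun_eq_iff field_simps del: of_nat_Suc)
  then have "(\<lambda>k. dquot (Suc k) a a / fact (Suc k)) sums exp a" using exp_sums[of a] by simp
  then have "(\<lambda>k. dquot k a a / fact k) sums exp a"
    by (subst (asm) sums_Suc_iff) simp
  then show ?thesis using True by (simp add: expquot_def)
next
  case False
  have "(\<lambda>k. (a ^ k / fact k - b ^ k / fact k) / (a - b)) sums ((exp a - exp b) / (a - b))"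
    by (intro sums_divide sums_diff exp_sums)
  moreover have "(a ^ k / fact k - b ^ k / fact k) / (a - b) = dquot k a b / fact k" for k
  proof -
    have "dquot k a b = (a ^ k - b ^ k) / (a - b)"
      using dquot_diff[of a b k] False by (simp add: eq_divide_eq mult.commute)
    then show ?thesis by (simp add: diff_divide_distrib mult.commute)
  qed
  ultimately show ?thesis using False by (simp add: expquot_def)
qed

section \<open>Functional calculus and matrix elements in a fixed eigenbasis\<close>

locale spectral =
  fixes d :: nat and X U :: "complex mat" and x :: "nat \<Rightarrow> real"
  assumes U: "U \<in> carrier_mat d d" and UU: "adj U * U = 1\<^sub>m d" "U * adj U = 1\<^sub>m d"
    and X: "X = U * rdiag d x * adj U"
begin

text \<open>The coordinates of an operator in the eigenbasis of \<open>X\<close>.\<close>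

definition cf :: "complex mat \<Rightarrow> complex mat" where "cf A = adj U * A * U"

text \<open>Functional calculus of \<open>X\<close>, with the function given on the indices of the
  eigenvalues: g(X) is the case \<open>f i = g (x i)\<close>.\<close>

definition fcal :: "(nat \<Rightarrow> real) \<Rightarrow> complex mat" where "fcal f = U * rdiag d f * adj U"

lemma aU: "adj U \<in> carrier_mat d d" using U by simp

lemma cf_carrier [simp, intro]: "A \<in> carrier_mat d d \<Longrightarrow> cf A \<in> carrier_mat d d"
  unfolding cf_def using U aU by (auto intro!: mult_carrier_mat[of _ d d _ d])

lemma fcal_carrier [simp, intro]: "fcal f \<in> carrier_mat d d"
  unfolding fcal_def using U aU by (auto intro!: mult_carrier_mat[of _ d d _ d])

lemma UU_cancel: "A \<in> carrier_mat d d \<Longrightarrow> U * (adj U * A) = A"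
  using assoc_mult_mat[OF U aU, of A d] UU by simp

lemma UU_cancel': "A \<in> carrier_mat d d \<Longrightarrow> adj U * (U * A) = A"
  using assoc_mult_mat[OF aU U, of A d] UU by simp

lemmas assoc_simps = assoc_mult_mat[of _ d d _ d _ d] mult_carrier_mat[of _ d d _ d]

lemma cf_mult:
  assumes "A \<in> carrier_mat d d" "B \<in> carrier_mat d d"
  shows "cf (A * B) = cf A * cf B"
  unfolding cf_def using assms U aU by (simp add: assoc_simps UU_cancel)

lemma cf_add:
  assumes "A \<in> carrier_mat d d" "B \<in> carrier_mat d d"
  shows "cf (A + B) = cf A + cf B"
  unfolding cf_def using assms U aU
  by (simp add: mult_add_distrib_mat[of _ d d _ d] add_mult_distrib_mat[of _ d d _ _ d] assoc_simps)

lemma cf_fcal: "cf (fcal f) = rdiag d f"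
proof -
  have "cf (fcal f) = adj U * (U * (rdiag d f * (adj U * U)))"
    unfolding cf_def fcal_def using U aU rdiag_carrier[of d f] by (simp add: assoc_simps)
  then show ?thesis using UU UU_cancel'[OF rdiag_carrier] by (simp add: right_mult_one_mat[OF rdiag_carrier])
qed

lemma mtrace_cf: "A \<in> carrier_mat d d \<Longrightarrow> mtrace (cf A) = mtrace A"
proof -
  assume A: "A \<in> carrier_mat d d"
  have "cf A = adj U * (A * U)" unfolding cf_def using A U aU by (simp add: assoc_simps)
  then have "mtrace (cf A) = mtrace ((A * U) * adj U)"
    using mtrace_mult_commute[OF aU mult_carrier_mat[OF A U]] by simp
  also have "(A * U) * adj U = A" using A U aU UU by (simp add: assoc_simps)
  finally show ?thesis .
qed

lemma fcal_index:
  assumes "i < d" "j < d"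
  shows "fcal f $$ (i, j) = (\<Sum>l<d. U $$ (i, l) * complex_of_real (f l) * adj U $$ (l, j))"
proof -
  have "fcal f $$ (i, j) = (\<Sum>l<d. (U * rdiag d f) $$ (i, l) * adj U $$ (l, j))"
    unfolding fcal_def by (rule mult_mat_index[OF mult_carrier_mat[OF U rdiag_carrier] aU assms])
  then show ?thesis using assms by (simp add: mult_rdiag_index[OF U])
qed

lemma fcal_mult: "fcal f * fcal g = fcal (\<lambda>i. f i * g i)"
proof -
  have "fcal f * fcal g = U * (rdiag d f * (adj U * (U * (rdiag d g * adj U))))"
    unfolding fcal_def using U aU rdiag_carrier[of d f] rdiag_carrier[of d g] by (simp add: assoc_simps)
  also have "\<dots> = U * (rdiag d f * (rdiag d g * adj U))"
    using UU_cancel'[OF mult_carrier_mat[OF rdiag_carrier aU]] by simp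
  also have "\<dots> = U * ((rdiag d f * rdiag d g) * adj U)"
    using assoc_mult_mat[OF rdiag_carrier rdiag_carrier aU] by simp
  also have "\<dots> = fcal (\<lambda>i. f i * g i)"
    unfolding rdiag_mult fcal_def using assoc_mult_mat[OF U rdiag_carrier aU] by simp
  finally show ?thesis .
qed

lemma X_fcal: "X = fcal x" by (simp add: X fcal_def)

lemma X_carrier: "X \<in> carrier_mat d d" unfolding X_fcal by simp

lemma fcal_one: "fcal (\<lambda>_. 1) = 1\<^sub>m d"
  unfolding fcal_def rdiag_one using U UU by simp

lemma X_pow: "X ^\<^sub>m k = fcal (\<lambda>i. x i ^ k)"
proof (induction k)
  case 0
  show ?case using X_carrier fcal_one by simp
next
  case (Suc k)
  then show ?case by (simp add: X_fcal fcal_mult mult.commute)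
qed

lemma mexp_X: "mexp X = fcal (\<lambda>i. exp (x i))"
proof (rule eq_matI)
  show "dim_row (mexp X) = dim_row (fcal (\<lambda>i. exp (x i)))" "dim_col (mexp X) = dim_col (fcal (\<lambda>i. exp (x i)))"
    using carrier_matD[OF X_carrier] carrier_matD[OF fcal_carrier[of "\<lambda>i. exp (x i)"]] by (simp_all add: mexp_def)
  fix i j assume "i < dim_row (fcal (\<lambda>i. exp (x i)))" "j < dim_col (fcal (\<lambda>i. exp (x i)))"
  then have ij: "i < d" "j < d" using fcal_carrier[of "\<lambda>i. exp (x i)"] by auto
  have e: "(X ^\<^sub>m k) $$ (i, j) / of_nat (fact k) = (\<Sum>l<d. U $$ (i, l) * complex_of_real (x l ^ k / fact k) * adj U $$ (l, j))" for k
    unfolding X_pow fcal_index[OF ij] by (simp add: sum_divide_distrib)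
  have "(\<lambda>k. (X ^\<^sub>m k) $$ (i, j) / of_nat (fact k)) sums fcal (\<lambda>i. exp (x i)) $$ (i, j)"
    unfolding e fcal_index[OF ij]
    by (intro sums_sum sums_mult sums_mult2 sums_of_real exp_sums)
  then show "mexp X $$ (i, j) = fcal (\<lambda>i. exp (x i)) $$ (i, j)"
    using ij X_carrier by (simp add: mexp_def sums_unique[symmetric])
qed

lemma mtrace_mult_fcal:
  assumes A: "A \<in> carrier_mat d d"
  shows "mtrace (A * fcal f) = (\<Sum>i<d. cf A $$ (i, i) * complex_of_real (f i))"
proof -
  have "mtrace (A * fcal f) = mtrace (cf A * rdiag d f)"
    unfolding cf_fcal[symmetric] using A by (simp add: mtrace_cf mult_carrier_mat[of _ d d _ d] flip: cf_mult)
  also have "\<dots> = (\<Sum>i<d. (cf A * rdiag d f) $$ (i, i))"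
    using cf_carrier[OF A] by (auto simp: mtrace_def)
  also have "\<dots> = (\<Sum>i<d. cf A $$ (i, i) * complex_of_real (f i))"
    by (intro sum.cong refl) (simp add: mult_rdiag_index[OF cf_carrier[OF A]])
  finally show ?thesis .
qed

lemma mtrace_fcal: "mtrace (fcal f) = complex_of_real (\<Sum>i<d. f i)"
proof -
  have "mtrace (fcal f) = mtrace (rdiag d f)" using mtrace_cf[OF fcal_carrier] by (simp add: cf_fcal)
  then show ?thesis by (simp add: mtrace_def rdiag_def)
qed

lemma dpow_carrier: "Y \<in> carrier_mat d d \<Longrightarrow> dpow d X Y k \<in> carrier_mat d d"
  by (induction k) (use X_carrier in \<open>auto intro!: mult_carrier_mat[of _ d d _ d] add_carrier_mat pow_carrier_mat\<close>)

text \<open>In the eigenbasis, multiplication by \<open>X\<close> on the right scales column j by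
  \<open>x j\<close>, and multiplication by a power of \<open>X\<close> on the left scales row i by
  that power of \<open>x i\<close>. Entry by entry, the recursion of \<open>dpow\<close> becomes
  that of \<open>dquot\<close>.\<close>

lemma cf_dpow_index:
  assumes Y: "Y \<in> carrier_mat d d" and ij: "i < d" "j < d"
  shows "cf (dpow d X Y k) $$ (i, j) = cf Y $$ (i, j) * complex_of_real (dquot k (x i) (x j))"
proof (induction k)
  case 0
  have "cf (0\<^sub>m d d) = 0\<^sub>m d d"
    unfolding cf_def right_mult_zero_mat[OF aU] by (rule left_mult_zero_mat[OF U])
  then show ?case using ij by simp
next
  case (Suc k)
  note D = dpow_carrier[OF Y, of k]
  have c: "dpow d X Y k * X \<in> carrier_mat d d" "X ^\<^sub>m k * Y \<in> carrier_mat d d"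
    using D X_carrier Y by (auto intro!: mult_carrier_mat[of _ d d _ d] pow_carrier_mat)
  have "cf (dpow d X Y (Suc k)) = cf (dpow d X Y k) * rdiag d x + rdiag d (\<lambda>i. x i ^ k) * cf Y"
    using D Y c by (simp add: cf_add cf_mult X_carrier X_pow) (simp add: X_fcal cf_fcal)
  moreover have "\<dots> $$ (i, j) = (cf (dpow d X Y k) * rdiag d x) $$ (i, j) + (rdiag d (\<lambda>i. x i ^ k) * cf Y) $$ (i, j)"
    using ij cf_carrier[OF Y] by (simp add: rdiag_def)
  ultimately show ?case
    unfolding mult_rdiag_index[OF cf_carrier[OF D] ij] rdiag_mult_index[OF cf_carrier[OF Y] ij] Suc.IH
    by (simp add: algebra_simps)
qed

text \<open>Evaluates the termwise derivative of Re Tr (A exp (X + tY)) at t = 0 as a double sum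
  over the spectrum of \<open>X\<close>. The sums over the spectrum are finite, so the series in k
  can be summed inside them.\<close>

lemma dpow_trace_sums:
  assumes A: "A \<in> carrier_mat d d" and Y: "Y \<in> carrier_mat d d"
  shows "(\<lambda>k. Re (mtrace (A * dpow d X Y k)) / fact k) sums
    (\<Sum>i<d. \<Sum>j<d. Re (cf A $$ (i, j) * cf Y $$ (j, i)) * expquot (x j) (x i))"
proof -
  have e: "Re (mtrace (A * dpow d X Y k)) / fact k =
      (\<Sum>i<d. \<Sum>j<d. Re (cf A $$ (i, j) * cf Y $$ (j, i)) * (dquot k (x j) (x i) / fact k))" for k
  proof -
    note D = dpow_carrier[OF Y, of k]
    have "mtrace (A * dpow d X Y k) = mtrace (cf A * cf (dpow d X Y k))"
      using A D by (simp add: mtrace_cf mult_carrier_mat[of _ d d _ d] flip: cf_mult)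
    also have "\<dots> = (\<Sum>i<d. \<Sum>j<d. cf A $$ (i, j) * cf Y $$ (j, i) * complex_of_real (dquot k (x j) (x i)))"
      unfolding mtrace_mult[OF cf_carrier[OF A] cf_carrier[OF D]]
      by (intro sum.cong refl) (simp add: cf_dpow_index[OF Y])
    finally show ?thesis by (simp add: sum_divide_distrib)
  qed
  show ?thesis unfolding e by (intro sums_sum sums_mult dquot_sums)
qed

lemma cf_hermitian: "hermitian_mat d A \<Longrightarrow> hermitian_mat d (cf A)"
  unfolding cf_def by (rule hermitian_conj[OF _ U])

end

lemma hermitian_spectral:
  assumes "hermitian_mat d X"
  obtains U x where "spectral d X U x"
  using hermitian_diagonalizable[OF assms] unfolding spectral_def by blast

section \<open>Differentiating the exponential series along a line of matrices\<close>

lemma mat_line_index: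
  assumes "X \<in> carrier_mat d d" "Y \<in> carrier_mat d d" "i < d" "j < d"
  shows "(X + complex_of_real t \<cdot>\<^sub>m Y) $$ (i, j) = X $$ (i, j) + complex_of_real t * Y $$ (i, j)"
  using assms by auto

context
  fixes d :: nat and X Y :: "complex mat"
  assumes X: "X \<in> carrier_mat d d" and Y: "Y \<in> carrier_mat d d"
begin

abbreviation (input) line :: "real \<Rightarrow> complex mat" where "line t \<equiv> X + complex_of_real t \<cdot>\<^sub>m Y"

lemma line_carrier: "line t \<in> carrier_mat d d" using X Y by auto

lemma line_pow_carrier: "line t ^\<^sub>m k \<in> carrier_mat d d" by (rule pow_carrier_mat[OF line_carrier])

lemma line_dpow_carrier: "dpow d (line t) Y k \<in> carrier_mat d d"
  by (induction k) (use line_carrier line_pow_carrier Y in \<open>auto intro!: mult_carrier_mat[of _ d d _ d] add_carrier_mat\<close>)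

lemma line_pow_Suc_index:
  assumes "i < d" "j < d"
  shows "(line t ^\<^sub>m Suc k) $$ (i, j) = (\<Sum>l<d. (line t ^\<^sub>m k) $$ (i, l) * (X $$ (l, j) + complex_of_real t * Y $$ (l, j)))"
proof -
  have "(line t ^\<^sub>m Suc k) $$ (i, j) = (\<Sum>l<d. (line t ^\<^sub>m k) $$ (i, l) * line t $$ (l, j))"
    unfolding pow_mat.simps by (rule mult_mat_index[OF line_pow_carrier line_carrier assms])
  then show ?thesis using assms by (simp add: mat_line_index[OF X Y])
qed

lemma line_dpow_Suc_index:
  assumes ij: "i < d" "j < d"
  shows "dpow d (line t) Y (Suc k) $$ (i, j) = (\<Sum>l<d. (line t ^\<^sub>m k) $$ (i, l) * Y $$ (l, j) +
    dpow d (line t) Y k $$ (i, l) * (X $$ (l, j) + complex_of_real t * Y $$ (l, j)))"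
proof -
  have c: "dpow d (line t) Y k * line t \<in> carrier_mat d d" "line t ^\<^sub>m k * Y \<in> carrier_mat d d"
    using line_dpow_carrier line_carrier line_pow_carrier Y by (auto intro!: mult_carrier_mat[of _ d d _ d])
  have "dpow d (line t) Y (Suc k) $$ (i, j) = (dpow d (line t) Y k * line t) $$ (i, j) + (line t ^\<^sub>m k * Y) $$ (i, j)"
    using c ij by (simp del: index_mult_mat)
  also have "\<dots> = (\<Sum>l<d. dpow d (line t) Y k $$ (i, l) * line t $$ (l, j)) + (\<Sum>l<d. (line t ^\<^sub>m k) $$ (i, l) * Y $$ (l, j))"
    unfolding mult_mat_index[OF line_dpow_carrier line_carrier ij] mult_mat_index[OF line_pow_carrier Y ij] ..
  finally show ?thesis using ij by (simp add: mat_line_index[OF X Y] sum.distrib)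
qed

lemma line_pow_deriv:
  "i < d \<Longrightarrow> j < d \<Longrightarrow>
    ((\<lambda>t. (line t ^\<^sub>m k) $$ (i, j)) has_vector_derivative dpow d (line t) Y k $$ (i, j)) (at t)"
proof (induction k arbitrary: i j)
  case 0
  then show ?case using X Y by simp
next
  case (Suc k)
  have l: "((\<lambda>t. X $$ (l, j) + complex_of_real t * Y $$ (l, j)) has_vector_derivative Y $$ (l, j)) (at t)" for l
    by (auto intro!: derivative_eq_intros has_vector_derivative_real_field simp: has_vector_derivative_def
        algebra_simps scaleR_conv_of_real)
  show ?case
    unfolding line_pow_Suc_index[OF Suc.prems] line_dpow_Suc_index[OF Suc.prems]
    by (intro has_vector_derivative_sum has_vector_derivative_mult l Suc.IH) (use Suc.prems in auto)
qed

lemma line_pow_continuous: "i < d \<Longrightarrow> j < d \<Longrightarrow> continuous_on UNIV (\<lambda>t. (line t ^\<^sub>m k) $$ (i, j))"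
  using line_pow_deriv by (metis continuous_at_imp_continuous_on has_vector_derivative_continuous)

lemma line_dpow_continuous: "i < d \<Longrightarrow> j < d \<Longrightarrow> continuous_on UNIV (\<lambda>t. dpow d (line t) Y k $$ (i, j))"
proof (induction k arbitrary: i j)
  case 0
  then show ?case by simp
next
  case (Suc k)
  show ?case unfolding line_dpow_Suc_index[OF Suc.prems]
    by (intro continuous_intros Suc.IH line_pow_continuous) (use Suc.prems in auto)
qed

text \<open>Geometric bounds that are uniform in t on bounded intervals; divided by k! they are
  summable and serve as majorants in the M-test.\<close>

lemma line_bounds:
  obtains B where "B \<ge> 1"
    "\<And>t k i j. \<bar>t\<bar> \<le> R \<Longrightarrow> i < d \<Longrightarrow> j < d \<Longrightarrow> cmod ((line t ^\<^sub>m k) $$ (i, j)) \<le> B ^ k"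
    "\<And>t k i j. \<bar>t\<bar> \<le> R \<Longrightarrow> i < d \<Longrightarrow> j < d \<Longrightarrow> cmod (dpow d (line t) Y k $$ (i, j)) \<le> B ^ k"
proof -
  define SX SY where "SX = (\<Sum>i<d. \<Sum>j<d. cmod (X $$ (i, j)))" and "SY = (\<Sum>i<d. \<Sum>j<d. cmod (Y $$ (i, j)))"
  have eb: "cmod (Z $$ (i, j)) \<le> (\<Sum>i<d. \<Sum>j<d. cmod (Z $$ (i, j)))" if "i < d" "j < d" for Z :: "complex mat" and i j
  proof -
    have "cmod (Z $$ (i, j)) \<le> (\<Sum>j<d. cmod (Z $$ (i, j)))" using that by (intro member_le_sum) auto
    also have "\<dots> \<le> (\<Sum>i<d. \<Sum>j<d. cmod (Z $$ (i, j)))"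
      using that by (intro member_le_sum[of i _ "\<lambda>i. \<Sum>j<d. cmod (Z $$ (i, j))"]) (auto intro: sum_nonneg)
    finally show ?thesis .
  qed
  \<comment> \<open>The summand 1 makes \<open>C\<close> dominate the entries of \<open>Y\<close> as
    well as those of the line, even when R = 0.\<close>
  define C where "C = SX + (\<bar>R\<bar> + 1) * SY"
  have S0: "SX \<ge> 0" "SY \<ge> 0" by (auto simp: SX_def SY_def intro!: sum_nonneg)
  \<comment> \<open>One step of either recursion multiplies an entrywise bound by at most 2 d C: a
    matrix product costs d C, and the recursion of \<open>dpow\<close> adds two products. The same
    \<open>B\<close> thus bounds the derivatives without an extra factor k.\<close>
  define B where "B = 1 + 2 * real d * C"
  have C0: "C \<ge> 0" using S0 by (simp add: C_def)
  have B1: "B \<ge> 1" using C0 by (simp add: B_def)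
  have bY: "cmod (Y $$ (l, j)) \<le> C" if "l < d" "j < d" for l j
  proof -
    have "1 * SY \<le> (\<bar>R\<bar> + 1) * SY" using S0 by (intro mult_right_mono) auto
    then show ?thesis using eb[OF that, of Y] S0 unfolding C_def SY_def[symmetric] by linarith
  qed
  have bM: "cmod (X $$ (l, j) + complex_of_real t * Y $$ (l, j)) \<le> C" if "l < d" "j < d" "\<bar>t\<bar> \<le> R" for l j t
  proof -
    have "cmod (X $$ (l, j) + complex_of_real t * Y $$ (l, j)) \<le> cmod (X $$ (l, j)) + \<bar>t\<bar> * cmod (Y $$ (l, j))"
      by (rule order_trans[OF norm_triangle_ineq]) (simp add: norm_mult)
    also have "\<dots> \<le> SX + (\<bar>R\<bar> + 1) * SY"
      using eb[OF that(1,2), of X] eb[OF that(1,2), of Y] that(3) S0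
      unfolding SX_def[symmetric] SY_def[symmetric] by (intro add_mono mult_mono) auto
    finally show ?thesis by (simp add: C_def)
  qed
  have p: "cmod ((line t ^\<^sub>m k) $$ (i, j)) \<le> B ^ k" if t: "\<bar>t\<bar> \<le> R" and "i < d" "j < d" for t k i j
    using that(2,3)
  proof (induction k arbitrary: i j)
    case 0
    then show ?case using X Y by simp
  next
    case (Suc k)
    have "cmod ((line t ^\<^sub>m Suc k) $$ (i, j)) \<le> (\<Sum>l<d. B ^ k * C)"
      unfolding line_pow_Suc_index[OF Suc.prems]
      by (intro order_trans[OF norm_sum] sum_mono)
        (use Suc C0 B1 bM t in \<open>auto simp: norm_mult intro!: mult_mono\<close>)
    also have "\<dots> = B ^ k * (real d * C)" by simp
    also have "\<dots> \<le> B ^ k * B" using B1 C0 by (intro mult_left_mono) (auto simp: B_def)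
    finally show ?case by (simp add: mult.commute)
  qed
  have q: "cmod (dpow d (line t) Y k $$ (i, j)) \<le> B ^ k" if t: "\<bar>t\<bar> \<le> R" and "i < d" "j < d" for t k i j
    using that(2,3)
  proof (induction k arbitrary: i j)
    case 0
    then show ?case by simp
  next
    case (Suc k)
    have "cmod (dpow d (line t) Y (Suc k) $$ (i, j)) \<le> (\<Sum>l<d. B ^ k * C + B ^ k * C)"
      unfolding line_dpow_Suc_index[OF Suc.prems]
      by (intro order_trans[OF norm_sum] sum_mono order_trans[OF norm_triangle_ineq] add_mono)
        (use Suc C0 B1 bM bY p t in \<open>auto simp: norm_mult intro!: mult_mono\<close>)
    also have "\<dots> = B ^ k * (2 * real d * C)" by simp
    also have "\<dots> \<le> B ^ k * B" using B1 C0 by (intro mult_left_mono) (auto simp: B_def)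
    finally show ?case by (simp add: mult.commute)
  qed
  show ?thesis using that[OF B1] p q by blast
qed

lemma line_mexp_carrier: "mexp (line t) \<in> carrier_mat d d"
  using carrier_matD[OF line_carrier[of t]] by (intro carrier_matI) (simp_all add: mexp_def)

lemma line_mexp_sums:
  assumes ij: "i < d" "j < d"
  shows "(\<lambda>k. (line t ^\<^sub>m k) $$ (i, j) / of_nat (fact k)) sums mexp (line t) $$ (i, j)"
proof -
  obtain B where B: "B \<ge> 1"
    "\<And>s k i j. \<bar>s\<bar> \<le> \<bar>t\<bar> \<Longrightarrow> i < d \<Longrightarrow> j < d \<Longrightarrow> cmod ((line s ^\<^sub>m k) $$ (i, j)) \<le> B ^ k"
    using line_bounds[of "\<bar>t\<bar>"] by metis
  have "summable (\<lambda>k. (line t ^\<^sub>m k) $$ (i, j) / of_nat (fact k))"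
  proof (rule summable_comparison_test')
    show "summable (\<lambda>k. B ^ k / fact k)" by (rule sums_summable[OF exp_sums])
    show "norm ((line t ^\<^sub>m k) $$ (i, j) / of_nat (fact k)) \<le> B ^ k / fact k" for k
      using B(2)[of t, OF order.refl ij, of k] by (simp add: norm_divide divide_right_mono)
  qed
  then show ?thesis using ij Y by (simp add: mexp_def summable_sums)
qed

text \<open>Termwise differentiation, justified by uniform convergence on bounded intervals. The
  derivative is kept as a series because this form shows that it is continuous in t; the double sum
  over the spectrum would not, since the eigenbases are chosen separately for each t.\<close>

lemma mtrace_line_deriv_aux:
  assumes A: "A \<in> carrier_mat d d"
  defines "G \<equiv> \<lambda>t. \<Sum>k. Re (mtrace (A * dpow d (line t) Y k)) / fact k"
  shows "((\<lambda>t. Re (mtrace (A * mexp (line t)))) has_real_derivative G t) (at t)"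
    and "continuous_on UNIV G"
proof -
  define f where "f k t = Re (mtrace (A * line t ^\<^sub>m k)) / fact k" for k t
  define f' where "f' k t = Re (mtrace (A * dpow d (line t) Y k)) / fact k" for k t
  have f_eq: "f k t = (\<Sum>i<d. \<Sum>j<d. Re (A $$ (i, j) * (line t ^\<^sub>m k) $$ (j, i))) / fact k" for k t
    unfolding f_def mtrace_mult[OF A line_pow_carrier] by simp
  have f'_eq: "f' k t = (\<Sum>i<d. \<Sum>j<d. Re (A $$ (i, j) * dpow d (line t) Y k $$ (j, i))) / fact k" for k t
    unfolding f'_def mtrace_mult[OF A line_dpow_carrier] by simp
  have fd: "(f k has_real_derivative f' k t) (at t)" for k t
  proof -
    have "((\<lambda>t. Re (A $$ (i, j) * (line t ^\<^sub>m k) $$ (j, i))) has_vector_derivative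
        Re (A $$ (i, j) * dpow d (line t) Y k $$ (j, i))) (at t)" if "i < d" "j < d" for i j
      by (intro bounded_linear.has_vector_derivative[OF bounded_linear_Re] has_vector_derivative_mult_right
          line_pow_deriv that)
    then show ?thesis
      unfolding f_eq f'_eq
      by (intro DERIV_cdivide DERIV_sum) (auto simp: has_real_derivative_iff_has_vector_derivative)
  qed
  have fc: "continuous_on UNIV (f' k)" for k
    unfolding f'_eq by (intro continuous_intros line_dpow_continuous) auto
  have fs: "(\<lambda>k. f k t) sums Re (mtrace (A * mexp (line t)))" for t
  proof -
    have "(\<lambda>k. \<Sum>i<d. \<Sum>j<d. Re (A $$ (i, j) * ((line t ^\<^sub>m k) $$ (j, i) / of_nat (fact k)))) sums
       (\<Sum>i<d. \<Sum>j<d. Re (A $$ (i, j) * mexp (line t) $$ (j, i)))"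
      by (intro sums_sum sums_Re sums_mult line_mexp_sums) auto
    moreover have "Re (mtrace (A * mexp (line t))) = (\<Sum>i<d. \<Sum>j<d. Re (A $$ (i, j) * mexp (line t) $$ (j, i)))"
      unfolding mtrace_mult[OF A line_mexp_carrier] by simp
    moreover have "(\<Sum>i<d. \<Sum>j<d. Re (A $$ (i, j) * ((line t ^\<^sub>m k) $$ (j, i) / of_nat (fact k)))) = f k t" for k
    proof -
      have "A $$ (i, j) * ((line t ^\<^sub>m k) $$ (j, i) / of_nat (fact k)) =
          (A $$ (i, j) * (line t ^\<^sub>m k) $$ (j, i)) / complex_of_real (fact k)" for i j by simp
      then have "Re (A $$ (i, j) * ((line t ^\<^sub>m k) $$ (j, i) / of_nat (fact k))) =
          Re (A $$ (i, j) * (line t ^\<^sub>m k) $$ (j, i)) / fact k" for i j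
        by (simp only: Re_divide_of_real)
      then show ?thesis unfolding f_eq sum_divide_distrib by (intro sum.cong refl)
    qed
    ultimately show ?thesis by simp
  qed
  have unif: "uniform_limit {-R..R} (\<lambda>n t. \<Sum>k<n. f' k t) G sequentially" for R
  proof -
    obtain B where B: "B \<ge> 1"
      "\<And>t k i j. \<bar>t\<bar> \<le> R \<Longrightarrow> i < d \<Longrightarrow> j < d \<Longrightarrow> cmod (dpow d (line t) Y k $$ (i, j)) \<le> B ^ k"
      using line_bounds[of R] by metis
    define K where "K = (\<Sum>i<d. \<Sum>j<d. cmod (A $$ (i, j)))"
    have "norm (f' k t) \<le> K * (B ^ k / fact k)" if "t \<in> {-R..R}" for k t
    proof -
      have "\<bar>\<Sum>i<d. \<Sum>j<d. Re (A $$ (i, j) * dpow d (line t) Y k $$ (j, i))\<bar> \<le> (\<Sum>i<d. \<Sum>j<d. cmod (A $$ (i, j)) * B ^ k)"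
      proof (intro order_trans[OF sum_abs] sum_mono)
        fix i j assume "i \<in> {..<d}" "j \<in> {..<d}"
        then have "cmod (A $$ (i, j)) * cmod (dpow d (line t) Y k $$ (j, i)) \<le> cmod (A $$ (i, j)) * B ^ k"
          using that by (intro mult_left_mono B) auto
        then show "\<bar>Re (A $$ (i, j) * dpow d (line t) Y k $$ (j, i))\<bar> \<le> cmod (A $$ (i, j)) * B ^ k"
          using abs_Re_le_cmod[of "A $$ (i, j) * dpow d (line t) Y k $$ (j, i)"] by (simp add: norm_mult)
      qed
      then show ?thesis unfolding f'_eq K_def by (simp add: sum_distrib_right divide_right_mono)
    qed
    moreover have "summable (\<lambda>k. K * (B ^ k / fact k))"
      by (intro summable_mult sums_summable[OF exp_sums])
    ultimately show ?thesis unfolding G_def f'_def[symmetric] by (intro Weierstrass_m_test)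
  qed
  have "((\<lambda>x. \<Sum>k. f k x) has_real_derivative (\<Sum>k. f' k t)) (at t)"
  proof (rule has_field_derivative_series'(2))
    show "convex {-(\<bar>t\<bar> + 1)..\<bar>t\<bar> + 1}" by (rule convex_real_interval)
    show "(f n has_real_derivative f' n x) (at x within {-(\<bar>t\<bar> + 1)..\<bar>t\<bar> + 1})" for n x
      by (rule has_field_derivative_at_within[OF fd])
    show "uniformly_convergent_on {-(\<bar>t\<bar> + 1)..\<bar>t\<bar> + 1} (\<lambda>n x. \<Sum>i<n. f' i x)"
      using unif[of "\<bar>t\<bar> + 1"] unfolding uniformly_convergent_on_def by blast
    show "0 \<in> {-(\<bar>t\<bar> + 1)..\<bar>t\<bar> + 1}" by auto
    show "summable (\<lambda>n. f n 0)" by (rule sums_summable[OF fs])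
    show "t \<in> interior {-(\<bar>t\<bar> + 1)..\<bar>t\<bar> + 1}" by auto
  qed
  then show "((\<lambda>t. Re (mtrace (A * mexp (line t)))) has_real_derivative G t) (at t)"
    unfolding G_def f'_def[symmetric] sums_unique[OF fs] .
  have "isCont G t" for t
  proof -
    have "continuous_on {-(\<bar>t\<bar> + 1)..\<bar>t\<bar> + 1} G"
      by (rule uniform_limit_theorem[OF _ unif])
        (auto intro!: always_eventually continuous_intros continuous_on_subset[OF fc])
    then show ?thesis by (rule continuous_on_interior) auto
  qed
  then show "continuous_on UNIV G" by (simp add: continuous_at_imp_continuous_on)
qed

end

section \<open>Gibbs expectations and the Duhamel two-point function\<close>

lemma sinh_le_mult_cosh:
  fixes u :: real assumes "0 \<le> u" shows "sinh u \<le> u * cosh u"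
proof -
  have "0 * cosh 0 - sinh (0::real) \<le> u * cosh u - sinh u"
  proof (rule DERIV_nonneg_imp_nondecreasing[OF assms])
    fix x :: real assume "0 \<le> x" "x \<le> u"
    then show "\<exists>y. ((\<lambda>u. u * cosh u - sinh u) has_real_derivative y) (at x) \<and> 0 \<le> y"
      by (intro exI[of _ "x * sinh x"]) (auto intro!: derivative_eq_intros)
  qed
  then show ?thesis by simp
qed

text \<open>For u > 0 this is u coth u <= 1 + u^2 / 3. The difference of the two sides vanishes at 0
  and has derivative u (u cosh u - sinh u) / 3, which is nonnegative by the previous lemma.\<close>

lemma cosh_sinh_bound:
  fixes u :: real assumes "0 \<le> u" shows "u * cosh u - u\<^sup>2 * sinh u / 3 \<le> sinh u"
proof -
  have "sinh 0 - 0 * cosh 0 + 0\<^sup>2 * sinh (0::real) / 3 \<le> sinh u - u * cosh u + u\<^sup>2 * sinh u / 3"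
  proof (rule DERIV_nonneg_imp_nondecreasing[OF assms])
    fix x :: real assume x: "0 \<le> x" "x \<le> u"
    have "((\<lambda>u. sinh u - u * cosh u + u\<^sup>2 * sinh u / 3) has_real_derivative x / 3 * (x * cosh x - sinh x)) (at x)"
      by (auto intro!: derivative_eq_intros simp: field_simps power2_eq_square)
    moreover have "0 \<le> x / 3 * (x * cosh x - sinh x)" using x sinh_le_mult_cosh[OF x(1)] by simp
    ultimately show "\<exists>y. ((\<lambda>u. sinh u - u * cosh u + u\<^sup>2 * sinh u / 3) has_real_derivative y) (at x) \<and> 0 \<le> y" by blast
  qed
  then show ?thesis by simp
qed

lemma exp_sum_sinh_cosh:
  fixes a b :: real
  shows "exp a + exp b = 2 * exp ((a + b) / 2) * cosh ((a - b) / 2)"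
    and "exp a - exp b = 2 * exp ((a + b) / 2) * sinh ((a - b) / 2)"
proof -
  have "exp ((a + b) / 2) * exp ((a - b) / 2) = exp a" "exp ((a + b) / 2) * exp (- ((a - b) / 2)) = exp b"
    by (simp_all flip: exp_add add: field_simps)
  then show "exp a + exp b = 2 * exp ((a + b) / 2) * cosh ((a - b) / 2)"
    "exp a - exp b = 2 * exp ((a + b) / 2) * sinh ((a - b) / 2)"
    by (simp_all add: cosh_def sinh_def algebra_simps)
qed

lemma expquot_commute: "expquot a b = expquot b a"
  unfolding expquot_def using minus_divide_divide[of "exp a - exp b" "a - b"] by auto

text \<open>Factor out exp of the midpoint and put u = (a - b) / 2. The divided difference becomes
  sinh u / u, the average cosh u, and the correction u sinh u / 3, because (2 u)(2 sinh u) / 12 = u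
  sinh u / 3.\<close>

lemma expquot_bounds_aux:
  assumes "a \<ge> b"
  shows "(exp a + exp b) / 2 - (a - b) * (exp a - exp b) / 12 \<le> expquot a b"
    and "expquot a b \<le> (exp a + exp b) / 2"
    and "0 \<le> expquot a b"
proof -
  have "((exp a + exp b) / 2 - (a - b) * (exp a - exp b) / 12 \<le> expquot a b \<and>
    expquot a b \<le> (exp a + exp b) / 2) \<and> 0 \<le> expquot a b"
  proof (cases "a = b")
    case False
    define u m where "u = (a - b) / 2" and "m = exp ((a + b) / 2)"
    have u: "u > 0" and m: "m > 0" and ab: "a - b = 2 * u" using assms False by (auto simp: u_def m_def)
    have e: "exp a + exp b = 2 * m * cosh u" "exp a - exp b = 2 * m * sinh u"
      using exp_sum_sinh_cosh[of a b] by (simp_all add: u_def m_def)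
    have q: "expquot a b = m * (sinh u / u)" using False u unfolding expquot_def ab e by (simp add: field_simps)
    have "cosh u - u * sinh u / 3 \<le> sinh u / u"
      using cosh_sinh_bound[of u] u by (simp add: field_simps power2_eq_square)
    then have "m * (cosh u - u * sinh u / 3) \<le> m * (sinh u / u)" using m by (intro mult_left_mono) auto
    moreover have "sinh u / u \<le> cosh u"
      using sinh_le_mult_cosh[of u] u by (simp add: field_simps)
    then have "m * (sinh u / u) \<le> m * cosh u" using m by (intro mult_left_mono) auto
    moreover have "0 \<le> m * (sinh u / u)" using m u by simp
    ultimately show ?thesis unfolding q ab e by (simp add: algebra_simps)
  qed (simp add: expquot_def)
  then show "(exp a + exp b) / 2 - (a - b) * (exp a - exp b) / 12 \<le> expquot a b"
    "expquot a b \<le> (exp a + exp b) / 2" "0 \<le> expquot a b" by auto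
qed

lemma expquot_bounds:
  shows "(exp a + exp b) / 2 - (a - b) * (exp a - exp b) / 12 \<le> expquot a b"
    and "expquot a b \<le> (exp a + exp b) / 2"
    and "0 \<le> expquot a b"
  using expquot_bounds_aux[of a b] expquot_bounds_aux[of b a] expquot_commute[of a b]
  by (cases "a \<ge> b"; simp add: algebra_simps)+

text \<open>Here and in \<open>gexp\<close> the matrix is the whole exponent: for a Hamiltonian H at
  inverse temperature b it is -b H.\<close>

definition partf :: "complex mat \<Rightarrow> real" where "partf M = Re (mtrace (mexp M))"

definition gexp :: "complex mat \<Rightarrow> complex mat \<Rightarrow> real" where
  "gexp M A = Re (mtrace (A * mexp M)) / partf M"

context spectral
begin

lemma mtrace_mexp: "mtrace (mexp X) = complex_of_real (\<Sum>i<d. exp (x i))"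
  unfolding mexp_X by (rule mtrace_fcal)

lemma partf_X: "partf X = (\<Sum>i<d. exp (x i))"
  by (simp add: partf_def mtrace_mexp)

lemma mexp_carrier: "mexp X \<in> carrier_mat d d"
  unfolding mexp_X by simp

lemma partf_pos: "0 < d \<Longrightarrow> 0 < partf X"
  unfolding partf_X by (intro sum_pos) auto

lemma Re_mtrace_mult_mexp: "A \<in> carrier_mat d d \<Longrightarrow> Re (mtrace (A * mexp X)) = (\<Sum>i<d. Re (cf A $$ (i, i)) * exp (x i))"
  unfolding mexp_X by (simp add: mtrace_mult_fcal)

lemma cf_herm_prod:
  assumes "hermitian_mat d B" "i < d" "j < d"
  shows "cf B $$ (i, j) * cf B $$ (j, i) = complex_of_real ((cmod (cf B $$ (i, j)))\<^sup>2)"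
  using hermitian_mat_entry[OF cf_hermitian[OF assms(1)] assms(3,2)] complex_norm_square[of "cf B $$ (i, j)"] by simp

lemma cf_square_diag:
  assumes "hermitian_mat d B" "i < d"
  shows "cf (B * B) $$ (i, i) = complex_of_real (\<Sum>j<d. (cmod (cf B $$ (i, j)))\<^sup>2)"
proof -
  note B = hermitian_mat_carrier[OF assms(1)]
  show ?thesis
    unfolding cf_mult[OF B B] mult_mat_index[OF cf_carrier[OF B] cf_carrier[OF B] assms(2,2)] of_real_sum
    by (intro sum.cong refl cf_herm_prod) (use assms in auto)
qed

text \<open>Cauchy-Schwarz over the eigenbasis with weights exp (x i). The square of a diagonal
  entry of \<open>B\<close> is at most the squared norm of its row, which is the corresponding
  diagonal entry of \<open>B * B\<close>.\<close>

lemma gibbs_cauchy_schwarz: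
  assumes h: "hermitian_mat d B"
  shows "(Re (mtrace (B * mexp X)))\<^sup>2 \<le> Re (mtrace (B * B * mexp X)) * partf X"
proof -
  note B = hermitian_mat_carrier[OF h]
  define r where "r i = Re (cf B $$ (i, i))" for i
  have "(\<Sum>i<d. r i * exp (x i)) = (\<Sum>i<d. (r i * sqrt (exp (x i))) * sqrt (exp (x i)))"
    by (intro sum.cong refl) (simp add: mult.assoc)
  then have "(Re (mtrace (B * mexp X)))\<^sup>2 = (\<Sum>i<d. (r i * sqrt (exp (x i))) * sqrt (exp (x i)))\<^sup>2"
    unfolding Re_mtrace_mult_mexp[OF B] r_def by simp
  also have "\<dots> \<le> (\<Sum>i<d. (r i * sqrt (exp (x i)))\<^sup>2) * (\<Sum>i<d. (sqrt (exp (x i)))\<^sup>2)"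
    by (rule Cauchy_Schwarz_ineq_sum)
  also have "\<dots> = (\<Sum>i<d. (r i)\<^sup>2 * exp (x i)) * partf X"
    by (simp add: power_mult_distrib partf_X)
  also have "\<dots> \<le> Re (mtrace (B * B * mexp X)) * partf X"
  proof (rule mult_right_mono)
    show "(\<Sum>i<d. (r i)\<^sup>2 * exp (x i)) \<le> Re (mtrace (B * B * mexp X))"
      unfolding Re_mtrace_mult_mexp[OF mult_carrier_mat[OF B B]]
    proof (intro sum_mono mult_right_mono)
      fix i assume i: "i \<in> {..<d}"
      have "(r i)\<^sup>2 \<le> (cmod (cf B $$ (i, i)))\<^sup>2"
        unfolding r_def using abs_Re_le_cmod[of "cf B $$ (i, i)"] by (metis abs_le_square_iff abs_norm_cancel)
      also have "\<dots> \<le> (\<Sum>j<d. (cmod (cf B $$ (i, j)))\<^sup>2)" using i by (intro member_le_sum) auto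
      also have "\<dots> = Re (cf (B * B) $$ (i, i))" using cf_square_diag[OF h, of i] i by simp
      finally show "(r i)\<^sup>2 \<le> Re (cf (B * B) $$ (i, i))" .
    qed auto
    show "0 \<le> partf X" unfolding partf_X by (intro sum_nonneg) auto
  qed
  finally show ?thesis .
qed

text \<open>The Duhamel (Bogoliubov) two-point function of \<open>Y\<close> with itself, not yet
  divided by the partition function: the integral over u in [0, 1] of Tr (Y exp (u X) Y exp ((1 - u)
  X)).\<close>

definition duhamel :: "complex mat \<Rightarrow> real" where
  "duhamel Y = (\<Sum>i<d. \<Sum>j<d. Re (cf Y $$ (i, j) * cf Y $$ (j, i)) * expquot (x j) (x i))"

context
  fixes Y :: "complex mat" and s :: real
  assumes h: "hermitian_mat d Y" and Y2: "Y * Y = complex_of_real s \<cdot>\<^sub>m 1\<^sub>m d"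
begin

text \<open>Because \<open>Y\<close> is Hermitian and squares to s, these weights form s times a
  symmetric doubly stochastic matrix. A sum weighted by them therefore collapses whenever the
  summand depends on one index only.\<close>

definition wt :: "nat \<Rightarrow> nat \<Rightarrow> real" where "wt i j = (cmod (cf Y $$ (i, j)))\<^sup>2"

lemma wt_prod: "i < d \<Longrightarrow> j < d \<Longrightarrow> cf Y $$ (i, j) * cf Y $$ (j, i) = complex_of_real (wt i j)"
  unfolding wt_def by (rule cf_herm_prod[OF h])

lemma wt_sym: "i < d \<Longrightarrow> j < d \<Longrightarrow> wt i j = wt j i"
  using wt_prod[of i j] wt_prod[of j i] by (simp add: mult.commute)

lemma wt_row: "i < d \<Longrightarrow> (\<Sum>j<d. wt i j) = s"
proof -
  assume i: "i < d"
  have "cf (Y * Y) = complex_of_real s \<cdot>\<^sub>m 1\<^sub>m d"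
    unfolding Y2 cf_def using U aU UU
    by (simp add: mult_smult_distrib[of _ d d _ d] mult_smult_assoc_mat[of _ d d _ d] right_mult_one_mat[of _ d d])
  then have "complex_of_real s = complex_of_real (\<Sum>j<d. wt i j)"
    using cf_square_diag[OF h i] i unfolding wt_def by simp
  then show ?thesis by (simp only: of_real_eq_iff)
qed

lemma duhamel_wt: "duhamel Y = (\<Sum>i<d. \<Sum>j<d. wt i j * expquot (x j) (x i))"
  unfolding duhamel_def by (intro sum.cong refl) (simp add: wt_prod)

lemma sum_wt_row: "(\<Sum>i<d. \<Sum>j<d. wt i j * f i) = s * (\<Sum>i<d. f i)"
proof -
  have "(\<Sum>i<d. \<Sum>j<d. wt i j * f i) = (\<Sum>i<d. s * f i)"
    by (intro sum.cong refl) (simp add: wt_row flip: sum_distrib_right)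
  then show ?thesis by (simp add: sum_distrib_left)
qed

lemma sum_wt_col: "(\<Sum>i<d. \<Sum>j<d. wt i j * f j) = s * (\<Sum>i<d. f i)"
  unfolding sum_wt_row[of f, symmetric] by (subst sum.swap) (intro sum.cong refl, simp add: wt_sym)

lemma duhamel_le: "duhamel Y \<le> s * partf X"
proof -
  have "duhamel Y \<le> (\<Sum>i<d. \<Sum>j<d. wt i j * (exp (x j) / 2) + wt i j * (exp (x i) / 2))"
    unfolding duhamel_wt distrib_left[symmetric] add_divide_distrib[symmetric]
    by (intro sum_mono mult_left_mono expquot_bounds(2)) (simp add: wt_def)
  also have "\<dots> = s * partf X"
    unfolding sum.distrib sum_wt_row sum_wt_col partf_X by (simp flip: sum_divide_distrib)
  finally show ?thesis .
qed

lemma duhamel_nonneg: "0 \<le> duhamel Y"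
  unfolding duhamel_wt using expquot_bounds(3) by (intro sum_nonneg mult_nonneg_nonneg) (auto simp: wt_def)

lemma Re_mtrace_X: "Re (mtrace (X * mexp X)) = (\<Sum>i<d. x i * exp (x i))"
  unfolding Re_mtrace_mult_mexp[OF X_carrier] by (simp add: X_fcal cf_fcal rdiag_def)

lemma Re_mtrace_YXY: "Re (mtrace (Y * X * Y * mexp X)) = (\<Sum>i<d. \<Sum>j<d. wt i j * (x j * exp (x i)))"
proof -
  note Y = hermitian_mat_carrier[OF h]
  have c: "Y * X \<in> carrier_mat d d" "Y * X * Y \<in> carrier_mat d d"
    using Y X_carrier by (auto intro!: mult_carrier_mat[of _ d d _ d])
  have "Re (cf (Y * X * Y) $$ (i, i)) = (\<Sum>j<d. wt i j * x j)" if i: "i < d" for i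
  proof -
    have "cf (Y * X * Y) = cf Y * rdiag d x * cf Y"
      unfolding cf_mult[OF c(1) Y] cf_mult[OF Y X_carrier] by (simp add: X_fcal cf_fcal)
    moreover have "(cf Y * rdiag d x * cf Y) $$ (i, i) = (\<Sum>j<d. (cf Y * rdiag d x) $$ (i, j) * cf Y $$ (j, i))"
      by (rule mult_mat_index[OF mult_carrier_mat[OF cf_carrier[OF Y] rdiag_carrier] cf_carrier[OF Y] i i])
    moreover have "\<dots> = (\<Sum>j<d. complex_of_real (wt i j * x j))"
      using i by (intro sum.cong refl) (simp add: mult_rdiag_index[OF cf_carrier[OF Y]] flip: wt_prod)
    ultimately show ?thesis by simp
  qed
  then show ?thesis unfolding Re_mtrace_mult_mexp[OF c(2)]
    by (intro sum.cong refl) (simp add: sum_distrib_right mult.assoc)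
qed

text \<open>Apply the lower bound for \<open>expquot\<close> to every pair of eigenvalues and expand
  (x j - x i)(exp (x j) - exp (x i)): the two unmixed terms give Tr (X exp X) and the two mixed ones
  Tr (Y X Y exp X). What is subtracted is a double commutator, since [Y, [X, Y]] = 2 Y X Y - 2 s
  X.\<close>

lemma duhamel_ge:
  "s * partf X - (s * Re (mtrace (X * mexp X)) - Re (mtrace (Y * X * Y * mexp X))) / 6 \<le> duhamel Y"
proof -
  have swap: "(\<Sum>i<d. \<Sum>j<d. wt i j * (x i * exp (x j))) = (\<Sum>i<d. \<Sum>j<d. wt i j * (x j * exp (x i)))"
    by (subst sum.swap) (intro sum.cong refl, simp add: wt_sym)
  have "(\<Sum>i<d. \<Sum>j<d. wt i j * ((exp (x j) + exp (x i)) / 2 - (x j - x i) * (exp (x j) - exp (x i)) / 12)) \<le> duhamel Y"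
    unfolding duhamel_wt using expquot_bounds(1) by (intro sum_mono mult_left_mono) (auto simp: wt_def)
  moreover have "(\<Sum>i<d. \<Sum>j<d. wt i j * ((exp (x j) + exp (x i)) / 2 - (x j - x i) * (exp (x j) - exp (x i)) / 12)) =
     (\<Sum>i<d. \<Sum>j<d. wt i j * (exp (x j) / 2) + wt i j * (exp (x i) / 2) - wt i j * (x j * exp (x j) / 12) - wt i j * (x i * exp (x i) / 12)
       + wt i j * (x j * exp (x i)) / 12 + wt i j * (x i * exp (x j)) / 12)"
    by (intro sum.cong refl) (simp add: field_simps)
  moreover have "\<dots> = s * partf X - s * Re (mtrace (X * mexp X)) / 6 + Re (mtrace (Y * X * Y * mexp X)) / 6"
    unfolding sum.distrib sum_subtractf sum_wt_row sum_wt_col Re_mtrace_X Re_mtrace_YXY partf_X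
      sum_divide_distrib[symmetric] swap by simp
  ultimately show ?thesis by (simp add: diff_divide_distrib)
qed

end

end

lemma spectral_smult:
  assumes "spectral d X U x"
  shows "spectral d (complex_of_real c \<cdot>\<^sub>m X) U (\<lambda>i. c * x i)"
proof -
  interpret spectral d X U x by fact
  have r: "rdiag d (\<lambda>i. c * x i) = complex_of_real c \<cdot>\<^sub>m rdiag d x"
    by (rule eq_matI) (auto simp: rdiag_def)
  have "complex_of_real c \<cdot>\<^sub>m X = U * rdiag d (\<lambda>i. c * x i) * adj U"
    unfolding r X using U aU
    by (simp add: mult_smult_distrib[of _ d d _ d] mult_smult_assoc_mat[of _ d d _ d] mult_carrier_mat[of _ d d _ d])
  then show ?thesis using U UU by (simp add: spectral_def)
qed

lemma hermitian_mtrace_mexp: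
  assumes "hermitian_mat d M"
  shows "mtrace (mexp M) = complex_of_real (partf M)"
proof -
  obtain U x where "spectral d M U x" using hermitian_spectral[OF assms] .
  then interpret spectral d M U x .
  show ?thesis by (simp add: mtrace_mexp partf_X)
qed

lemma hermitian_partf_pos:
  assumes "hermitian_mat d M" "0 < d"
  shows "0 < partf M"
proof -
  obtain U x where "spectral d M U x" using hermitian_spectral[OF assms(1)] .
  then interpret spectral d M U x .
  show ?thesis by (rule partf_pos[OF assms(2)])
qed

lemma hermitian_mexp_carrier:
  assumes "hermitian_mat d M"
  shows "mexp M \<in> carrier_mat d d"
proof -
  obtain U x where "spectral d M U x" using hermitian_spectral[OF assms] .
  then interpret spectral d M U x .
  show ?thesis by (rule mexp_carrier)
qed

lemma partf_zero: "partf (0\<^sub>m d d) = real d"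
proof -
  interpret spectral d "0\<^sub>m d d" "1\<^sub>m d" "\<lambda>_. 0"
  proof
    have r: "rdiag d (\<lambda>_. 0) = 0\<^sub>m d d" and a: "adj (1\<^sub>m d) = 1\<^sub>m d"
      by (rule eq_matI; auto simp: rdiag_def adj_def)+
    show "0\<^sub>m d d = 1\<^sub>m d * rdiag d (\<lambda>_. 0) * adj (1\<^sub>m d)" unfolding r a by simp
    show "adj (1\<^sub>m d) * 1\<^sub>m d = 1\<^sub>m d" "1\<^sub>m d * adj (1\<^sub>m d) = 1\<^sub>m d" unfolding a by simp_all
  qed auto
  show ?thesis by (simp add: partf_X)
qed

lemma gexp_square_le:
  assumes "hermitian_mat d M" "hermitian_mat d B" "0 < d"
  shows "(gexp M B)\<^sup>2 \<le> gexp M (B * B)"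
proof -
  obtain U x where "spectral d M U x" using hermitian_spectral[OF assms(1)] .
  then interpret spectral d M U x .
  show ?thesis using gibbs_cauchy_schwarz[OF assms(2)] partf_pos[OF assms(3)]
    by (simp add: gexp_def power_divide power2_eq_square field_simps)
qed

lemma gexp_scaled_one:
  assumes "hermitian_mat d M" "0 < d"
  shows "gexp M (complex_of_real s \<cdot>\<^sub>m 1\<^sub>m d) = s"
proof -
  have c: "mexp M \<in> carrier_mat d d" by (rule hermitian_mexp_carrier[OF assms(1)])
  have "mtrace (complex_of_real s \<cdot>\<^sub>m 1\<^sub>m d * mexp M) = mtrace (complex_of_real s \<cdot>\<^sub>m mexp M)"
    using c by (simp add: mult_smult_assoc_mat[of _ d d _ d])
  also have "\<dots> = complex_of_real s * mtrace (mexp M)"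
    using c by (simp add: mtrace_def sum_distrib_left)
  finally show ?thesis using hermitian_partf_pos[OF assms]
    by (simp add: gexp_def hermitian_mtrace_mexp[OF assms(1)])
qed

text \<open>Convexity of the log partition function in the inverse temperature, as a tangent
  inequality. Centre the eigenvalues at the Gibbs mean g and use exp y >= 1 + y for each; the linear
  terms then cancel on average.\<close>

lemma ln_partf_tangent:
  assumes "hermitian_mat d H" "0 < d"
  shows "ln (partf (complex_of_real b \<cdot>\<^sub>m H)) + (c - b) * gexp (complex_of_real b \<cdot>\<^sub>m H) H
    \<le> ln (partf (complex_of_real c \<cdot>\<^sub>m H))"
proof -
  obtain U x where sp: "spectral d H U x" using hermitian_spectral[OF assms(1)] .
  interpret H: spectral d H U x by fact
  interpret B: spectral d "complex_of_real b \<cdot>\<^sub>m H" U "\<lambda>i. b * x i" by (rule spectral_smult[OF sp])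
  interpret C: spectral d "complex_of_real c \<cdot>\<^sub>m H" U "\<lambda>i. c * x i" by (rule spectral_smult[OF sp])
  define Z where "Z = partf (complex_of_real b \<cdot>\<^sub>m H)"
  have Z: "Z > 0" and Z_eq: "Z = (\<Sum>i<d. exp (b * x i))"
    using B.partf_pos[OF assms(2)] by (simp_all add: Z_def B.partf_X)
  define g where "g = gexp (complex_of_real b \<cdot>\<^sub>m H) H"
  have "g = (\<Sum>i<d. x i * exp (b * x i)) / Z"
    unfolding g_def gexp_def B.Re_mtrace_mult_mexp[OF H.X_carrier] Z_def by (simp add: H.X_fcal H.cf_fcal rdiag_def)
  then have gZ: "(\<Sum>i<d. x i * exp (b * x i)) = g * Z" using Z by simp
  have "exp ((c - b) * g) * Z = (\<Sum>i<d. exp ((c - b) * g) * exp (b * x i) * (1 + (c - b) * x i - (c - b) * g))"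
  proof -
    have "(\<Sum>i<d. exp ((c - b) * g) * exp (b * x i) * (1 + (c - b) * x i - (c - b) * g)) =
      (\<Sum>i<d. exp ((c - b) * g) * (1 - (c - b) * g) * exp (b * x i) + exp ((c - b) * g) * (c - b) * (x i * exp (b * x i)))"
      by (intro sum.cong refl) (simp add: algebra_simps)
    also have "\<dots> = exp ((c - b) * g) * (1 - (c - b) * g) * Z + exp ((c - b) * g) * (c - b) * (g * Z)"
      unfolding sum.distrib Z_eq gZ[unfolded Z_eq, symmetric] by (simp only: sum_distrib_left)
    finally show ?thesis by (simp add: algebra_simps)
  qed
  also have "\<dots> \<le> (\<Sum>i<d. exp (c * x i))"
  proof (rule sum_mono)
    fix i
    have "1 + ((c - b) * x i - (c - b) * g) \<le> exp ((c - b) * x i - (c - b) * g)" by (rule exp_ge_add_one_self)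
    then have "exp ((c - b) * g) * exp (b * x i) * (1 + ((c - b) * x i - (c - b) * g)) \<le>
       exp ((c - b) * g) * exp (b * x i) * exp ((c - b) * x i - (c - b) * g)"
      by (intro mult_left_mono) auto
    also have "\<dots> = exp (c * x i)" by (simp flip: exp_add add: algebra_simps)
    finally show "exp ((c - b) * g) * exp (b * x i) * (1 + (c - b) * x i - (c - b) * g) \<le> exp (c * x i)" by (simp add: add_diff_eq)
  qed
  also have "\<dots> = partf (complex_of_real c \<cdot>\<^sub>m H)" by (simp add: C.partf_X)
  finally have "ln (exp ((c - b) * g) * Z) \<le> ln (partf (complex_of_real c \<cdot>\<^sub>m H))"
    using Z C.partf_pos[OF assms(2)] by (subst ln_le_cancel_iff) auto
  then show ?thesis using Z unfolding Z_def g_def by (simp add: ln_mult)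
qed

lemma hermitian_line:
  assumes "hermitian_mat d X" "hermitian_mat d Y"
  shows "hermitian_mat d (X + complex_of_real t \<cdot>\<^sub>m Y)"
proof (rule hermitian_matI)
  note X = hermitian_mat_carrier[OF assms(1)] and Y = hermitian_mat_carrier[OF assms(2)]
  show "X + complex_of_real t \<cdot>\<^sub>m Y \<in> carrier_mat d d" using X Y by auto
  fix i j assume ij: "i < d" "j < d"
  show "cnj ((X + complex_of_real t \<cdot>\<^sub>m Y) $$ (j, i)) = (X + complex_of_real t \<cdot>\<^sub>m Y) $$ (i, j)"
    unfolding mat_line_index[OF X Y ij] mat_line_index[OF X Y ij(2,1)]
    using hermitian_mat_entry[OF assms(1) ij] hermitian_mat_entry[OF assms(2) ij] by simp
qed

text \<open>The derivative of a Gibbs expectation in its own direction is a variance-type quantity: the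
  Duhamel two-point function minus the squared expectation.\<close>

theorem gexp_line_deriv:
  assumes X: "hermitian_mat d X" and Y: "hermitian_mat d Y" and d: "0 < d"
    and Y2: "Y * Y = complex_of_real s \<cdot>\<^sub>m 1\<^sub>m d"
  defines "M \<equiv> \<lambda>t. X + complex_of_real t \<cdot>\<^sub>m Y"
  obtains D where
    "\<And>t. ((\<lambda>t. ln (partf (M t))) has_real_derivative gexp (M t) Y) (at t)"
    "\<And>t. ((\<lambda>t. gexp (M t) Y) has_real_derivative D t - (gexp (M t) Y)\<^sup>2) (at t)"
    "continuous_on UNIV D"
    "\<And>t. 0 \<le> D t" "\<And>t. D t \<le> s"
    "\<And>t. s - (s * gexp (M t) (M t) - gexp (M t) (Y * M t * Y)) / 6 \<le> D t"
proof -
  note Xc = hermitian_mat_carrier[OF X] and Yc = hermitian_mat_carrier[OF Y]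
  define G where "G A t = (\<Sum>k. Re (mtrace (A * dpow d (M t) Y k)) / fact k)" for A t
  have hM: "hermitian_mat d (M t)" for t unfolding M_def by (rule hermitian_line[OF X Y])
  have der: "((\<lambda>t. Re (mtrace (A * mexp (M t)))) has_real_derivative G A t) (at t)"
    and cont: "continuous_on UNIV (G A)" if "A \<in> carrier_mat d d" for A t
    using mtrace_line_deriv_aux[OF Xc Yc that] unfolding G_def M_def by blast+
  have Zpos: "partf (M t) > 0" for t by (rule hermitian_partf_pos[OF hM d])
  have one: "1\<^sub>m d * mexp (M t) = mexp (M t)" for t
    by (rule left_mult_one_mat[OF hermitian_mexp_carrier[OF hM]])
  \<comment> \<open>For the plain trace only the diagonal survives, where the divided difference is
    \<open>exp\<close>; so the derivative of the partition function is Tr (Y exp M) although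
    \<open>Y\<close> and \<open>M\<close> need not commute.\<close>
  have G1: "G (1\<^sub>m d) t = Re (mtrace (Y * mexp (M t)))" for t
  proof -
    obtain U x where "spectral d (M t) U x" using hermitian_spectral[OF hM] .
    then interpret spectral d "M t" U x .
    have "cf (1\<^sub>m d) = 1\<^sub>m d" using cf_fcal[of "\<lambda>_. 1"] by (simp add: fcal_one rdiag_one)
    have "G (1\<^sub>m d) t = (\<Sum>i<d. \<Sum>j<d. Re (cf (1\<^sub>m d) $$ (i, j) * cf Y $$ (j, i)) * expquot (x j) (x i))"
      unfolding G_def by (rule sums_unique[OF dpow_trace_sums[OF one_carrier_mat Yc], symmetric])
    also have "\<dots> = (\<Sum>i<d. \<Sum>j<d. if j = i then Re (cf Y $$ (i, i)) * exp (x i) else 0)"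
      unfolding \<open>cf (1\<^sub>m d) = 1\<^sub>m d\<close> by (intro sum.cong refl) (auto simp: expquot_def)
    also have "\<dots> = Re (mtrace (Y * mexp (M t)))"
      unfolding Re_mtrace_mult_mexp[OF Yc] by (intro sum.cong refl) simp
    finally show ?thesis .
  qed
  have dZ: "((\<lambda>t. partf (M t)) has_real_derivative Re (mtrace (Y * mexp (M t)))) (at t)" for t
    using der[OF one_carrier_mat, of t] unfolding one G1 partf_def .
  define D where "D t = G Y t / partf (M t)" for t
  have 1: "((\<lambda>t. ln (partf (M t))) has_real_derivative gexp (M t) Y) (at t)" for t
    unfolding gexp_def using DERIV_chain'[OF dZ DERIV_ln_divide[OF Zpos]] by (simp add: mult.commute)
  have 2: "((\<lambda>t. gexp (M t) Y) has_real_derivative D t - (gexp (M t) Y)\<^sup>2) (at t)" for t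
    unfolding gexp_def D_def
    using DERIV_divide[OF der[OF Yc] dZ, of t] Zpos[of t]
    by (simp add: power2_eq_square field_simps)
  have 3: "continuous_on UNIV D"
    unfolding D_def using Zpos
    by (intro continuous_on_divide cont[OF Yc] continuous_at_imp_continuous_on ballI DERIV_isCont[OF dZ])
      (metis less_irrefl)
  \<comment> \<open>The bounds are pointwise in t, so an eigenbasis of \<open>M t\<close> may be
    picked for each t; continuity of \<open>D\<close> has already been obtained from the
    series.\<close>
  have b: "0 \<le> D t \<and> D t \<le> s \<and> s - (s * gexp (M t) (M t) - gexp (M t) (Y * M t * Y)) / 6 \<le> D t" for t
  proof -
    obtain U x where "spectral d (M t) U x" using hermitian_spectral[OF hM] .
    then interpret spectral d "M t" U x .
    have "G Y t = duhamel Y"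
      using sums_unique[OF dpow_trace_sums[OF Yc Yc]] unfolding G_def duhamel_def by simp
    then have D: "D t = duhamel Y / partf (M t)" by (simp add: D_def)
    have "(s * partf (M t) - (s * Re (mtrace (M t * mexp (M t))) - Re (mtrace (Y * M t * Y * mexp (M t)))) / 6) / partf (M t) \<le> D t"
      unfolding D using duhamel_ge[OF Y Y2] Zpos[of t] by (intro divide_right_mono) auto
    moreover have "(s * partf (M t) - (s * Re (mtrace (M t * mexp (M t))) - Re (mtrace (Y * M t * Y * mexp (M t)))) / 6) / partf (M t)
       = s - (s * gexp (M t) (M t) - gexp (M t) (Y * M t * Y)) / 6"
      using Zpos[of t] by (simp add: gexp_def field_simps)
    moreover have "0 \<le> D t" unfolding D using duhamel_nonneg[OF Y Y2] Zpos[of t] by (intro divide_nonneg_pos) auto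
    moreover have "D t \<le> s" unfolding D using duhamel_le[OF Y Y2] Zpos[of t] by (simp add: divide_le_eq)
    ultimately show ?thesis by simp
  qed
  show ?thesis by (rule that[OF 1 2 3]) (use b in blast)+
qed

section \<open>Gaussian product measures\<close>

abbreviation gauss :: "real \<Rightarrow> real measure" where
  "gauss \<sigma> \<equiv> density lborel (normal_density 0 \<sigma>)"

lemma prob_space_gauss: "0 < \<sigma> \<Longrightarrow> prob_space (gauss \<sigma>)"
  by (rule prob_space_normal_density)

lemma gauss_integrable_iff:
  "f \<in> borel_measurable borel \<Longrightarrow> integrable (gauss \<sigma>) f \<longleftrightarrow> integrable lborel (\<lambda>t. normal_density 0 \<sigma> t * f t)"
  for f :: "real \<Rightarrow> real"
  by (subst integrable_density) auto

lemma gauss_integral: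
  "f \<in> borel_measurable borel \<Longrightarrow> (\<integral>t. f t \<partial>gauss \<sigma>) = (\<integral>t. normal_density 0 \<sigma> t * f t \<partial>lborel)"
  for f :: "real \<Rightarrow> real"
  by (subst integral_density) auto

lemma gauss_square:
  assumes "0 < \<sigma>"
  shows "integrable (gauss \<sigma>) (\<lambda>t. t\<^sup>2)" "(\<integral>t. t\<^sup>2 \<partial>gauss \<sigma>) = \<sigma>\<^sup>2"
proof -
  have "has_bochner_integral lborel (\<lambda>t. normal_density 0 \<sigma> t * (t - 0) ^ (2 * 1)) (fact (2 * 1) / ((2 / \<sigma>\<^sup>2) ^ 1 * fact 1))"
    by (rule normal_moment_even[OF assms])
  then have "has_bochner_integral lborel (\<lambda>t. normal_density 0 \<sigma> t * t\<^sup>2) (\<sigma>\<^sup>2)"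
    by (simp add: power2_eq_square)
  then show "integrable (gauss \<sigma>) (\<lambda>t. t\<^sup>2)" "(\<integral>t. t\<^sup>2 \<partial>gauss \<sigma>) = \<sigma>\<^sup>2"
    by (simp_all add: gauss_integrable_iff gauss_integral has_bochner_integral_iff)
qed

lemma gauss_integrable_quadratic:
  assumes \<sigma>: "0 < \<sigma>" and m: "h \<in> borel_measurable borel" and b: "\<And>t. \<bar>h t\<bar> \<le> c * (1 + t\<^sup>2)"
  shows "integrable (gauss \<sigma>) h"
proof (rule Bochner_Integration.integrable_bound)
  interpret prob_space "gauss \<sigma>" by (rule prob_space_gauss[OF \<sigma>])
  show "integrable (gauss \<sigma>) (\<lambda>t. c * (1 + t\<^sup>2))" using gauss_square(1)[OF \<sigma>] by simp
  show "h \<in> borel_measurable (gauss \<sigma>)" using m by simp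
  have "\<bar>h t\<bar> \<le> \<bar>c * (1 + t\<^sup>2)\<bar>" for t using b[of t] by linarith
  then show "AE t in gauss \<sigma>. norm (h t) \<le> norm (c * (1 + t\<^sup>2))" by simp
qed

lemma abs_le_one_plus_square: "\<bar>t\<bar> \<le> 1 + t\<^sup>2" for t :: real
  using zero_le_power2[of "\<bar>t\<bar> - 1"] by (simp add: power2_diff)

lemma lipschitz_continuous_real:
  fixes h :: "real \<Rightarrow> real"
  assumes "\<And>s t. \<bar>h s - h t\<bar> \<le> L * \<bar>s - t\<bar>"
  shows "continuous_on UNIV h"
proof -
  have L: "0 \<le> L" using assms[of 0 1] by (simp add: order_trans[OF abs_ge_zero])
  have "L-lipschitz_on UNIV h" using assms L by (auto simp: lipschitz_on_def dist_real_def)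
  then show ?thesis by (rule lipschitz_on_continuous_on)
qed

text \<open>Stein's identity. The Gaussian density has derivative -(t / sigma^2) times itself, so
  density times g is an antiderivative of the difference of the two integrands.\<close>

lemma gauss_ibp:
  fixes g g' :: "real \<Rightarrow> real"
  assumes \<sigma>: "0 < \<sigma>" and g: "\<And>t. (g has_real_derivative g' t) (at t)"
    and g'c: "continuous_on UNIV g'" and g'b: "\<And>t. \<bar>g' t\<bar> \<le> C"
  shows "(\<integral>t. t * g t \<partial>gauss \<sigma>) = \<sigma>\<^sup>2 * (\<integral>t. g' t \<partial>gauss \<sigma>)"
proof -
  let ?\<phi> = "normal_density 0 \<sigma>"
  have gc: "continuous_on UNIV g" using g by (meson DERIV_isCont continuous_at_imp_continuous_on)
  have gm[measurable]: "g \<in> borel_measurable borel" "g' \<in> borel_measurable borel"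
    using gc g'c by (auto intro: borel_measurable_continuous_onI)
  have C: "0 \<le> C" using g'b[of 0] by linarith
  \<comment> \<open>A bounded derivative forces at most linear growth of g. This gives integrability
    of t g(t) and makes the boundary terms vanish.\<close>
  have gb: "\<bar>g t\<bar> \<le> \<bar>g 0\<bar> + C * \<bar>t\<bar>" for t
  proof -
    have "norm (g t - g 0) \<le> C * norm (t - 0)"
      by (rule field_differentiable_bound[of UNIV g g']) (use g g'b in auto)
    then show ?thesis by simp
  qed
  have \<phi>d: "(?\<phi> has_real_derivative - (t / \<sigma>\<^sup>2) * ?\<phi> t) (at t)" for t
    unfolding normal_density_def using \<sigma>
    by (auto intro!: derivative_eq_intros simp: field_simps power2_eq_square)
  have \<phi>c: "isCont ?\<phi> t" for t using \<phi>d by (rule DERIV_isCont)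
  define f where "f t = ?\<phi> t * g' t - ?\<phi> t * (t * g t) / \<sigma>\<^sup>2" for t
  have F: "((\<lambda>t. ?\<phi> t * g t) has_real_derivative f t) (at t)" for t
    unfolding f_def using \<phi>d g by (auto intro!: derivative_eq_intros simp: field_simps)
  have fc: "isCont f t" for t
    unfolding f_def using gc g'c \<sigma>
    by (intro continuous_intros \<phi>c) (auto simp: continuous_on_eq_continuous_at)
  have i1: "integrable (gauss \<sigma>) g'"
    using g'b C by (intro gauss_integrable_quadratic[where c = C] \<sigma>)
      (auto intro: order_trans[OF g'b] simp: algebra_simps)
  have i2: "integrable (gauss \<sigma>) (\<lambda>t. t * g t)"
  proof (rule gauss_integrable_quadratic[OF \<sigma>])
    fix t
    have "\<bar>t * g t\<bar> \<le> \<bar>t\<bar> * (\<bar>g 0\<bar> + C * \<bar>t\<bar>)" unfolding abs_mult by (intro mult_left_mono gb) auto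
    also have "\<dots> = \<bar>g 0\<bar> * \<bar>t\<bar> + C * t\<^sup>2" by (simp add: algebra_simps power2_eq_square)
    also have "\<dots> \<le> \<bar>g 0\<bar> * (1 + t\<^sup>2) + C * (1 + t\<^sup>2)"
      using C by (intro add_mono mult_left_mono abs_le_one_plus_square) auto
    finally show "\<bar>t * g t\<bar> \<le> (\<bar>g 0\<bar> + C) * (1 + t\<^sup>2)" by (simp add: algebra_simps)
  qed simp
  have j: "integrable lborel (\<lambda>t. ?\<phi> t * g' t)" "integrable lborel (\<lambda>t. ?\<phi> t * (t * g t))"
    using i1 i2 by (simp_all add: gauss_integrable_iff)
  have fi: "integrable lborel f" unfolding f_def using j by simp
  have lim: "((\<lambda>t. ?\<phi> t * g t) \<longlongrightarrow> 0) at_top" "((\<lambda>t. ?\<phi> t * g t) \<longlongrightarrow> 0) at_bot"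
  proof -
    have b: "\<bar>?\<phi> t * g t\<bar> \<le> ?\<phi> t * (\<bar>g 0\<bar> + C * \<bar>t\<bar>)" for t
      unfolding abs_mult using gb[of t] by (simp add: mult_left_mono)
    have l: "((\<lambda>t. ?\<phi> t * (\<bar>g 0\<bar> + C * \<bar>t\<bar>)) \<longlongrightarrow> 0) at_top" "((\<lambda>t. ?\<phi> t * (\<bar>g 0\<bar> + C * \<bar>t\<bar>)) \<longlongrightarrow> 0) at_bot"
      unfolding normal_density_def using \<sigma> by real_asymp+
    show "((\<lambda>t. ?\<phi> t * g t) \<longlongrightarrow> 0) at_top"
      by (rule Lim_null_comparison[OF _ l(1)]) (use b in \<open>auto intro!: always_eventually\<close>)
    show "((\<lambda>t. ?\<phi> t * g t) \<longlongrightarrow> 0) at_bot"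
      by (rule Lim_null_comparison[OF _ l(2)]) (use b in \<open>auto intro!: always_eventually\<close>)
  qed
  have "(LBINT t=-\<infinity>..\<infinity>. f t) = 0 - 0"
  proof (rule interval_integral_FTC_integrable)
    show "((\<lambda>t. ?\<phi> t * g t) has_vector_derivative f t) (at t)" for t
      using F by (simp add: has_real_derivative_iff_has_vector_derivative)
    show "isCont f t" for t by (rule fc)
    show "set_integrable lborel (einterval (-\<infinity>) \<infinity>) f" using fi by (simp add: set_integrable_def)
    show "(((\<lambda>t. ?\<phi> t * g t) \<circ> real_of_ereal) \<longlongrightarrow> 0) (at_right (-\<infinity>))"
      using lim(2) by (simp add: ereal_tendsto_simps)
    show "(((\<lambda>t. ?\<phi> t * g t) \<circ> real_of_ereal) \<longlongrightarrow> 0) (at_left \<infinity>)"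
      using lim(1) by (simp add: ereal_tendsto_simps)
  qed auto
  then have "(\<integral>t. f t \<partial>lborel) = 0"
    by (simp add: interval_lebesgue_integral_def set_lebesgue_integral_def)
  then have "(\<integral>t. ?\<phi> t * g' t \<partial>lborel) = (\<integral>t. ?\<phi> t * (t * g t) \<partial>lborel) / \<sigma>\<^sup>2"
    unfolding f_def using j by (subst (asm) Bochner_Integration.integral_diff) auto
  then show ?thesis using \<sigma> by (simp add: gauss_integral)
qed

text \<open>The variance is at most the mean square deviation from any fixed value, here h 0, and |h
  t - h 0| <= L |t|.\<close>

lemma gauss_second_moment_lipschitz:
  assumes \<sigma>: "0 < \<sigma>" and lip: "\<And>s t. \<bar>h s - h t\<bar> \<le> L * \<bar>s - t\<bar>"
  shows "integrable (gauss \<sigma>) h" "integrable (gauss \<sigma>) (\<lambda>t. (h t)\<^sup>2)"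
    "(\<integral>t. (h t)\<^sup>2 \<partial>gauss \<sigma>) \<le> (\<integral>t. h t \<partial>gauss \<sigma>)\<^sup>2 + L\<^sup>2 * \<sigma>\<^sup>2"
proof -
  interpret prob_space "gauss \<sigma>" by (rule prob_space_gauss[OF \<sigma>])
  have [measurable]: "h \<in> borel_measurable borel"
    by (rule borel_measurable_continuous_onI[OF lipschitz_continuous_real[OF lip]])
  have L: "0 \<le> L" using lip[of 0 1] by (simp add: order_trans[OF abs_ge_zero])
  have hb: "\<bar>h t\<bar> \<le> \<bar>h 0\<bar> + L * \<bar>t\<bar>" for t using lip[of t 0] by simp
  show i1: "integrable (gauss \<sigma>) h"
  proof (rule gauss_integrable_quadratic[OF \<sigma>])
    fix t
    have "\<bar>h 0\<bar> * 1 + L * \<bar>t\<bar> \<le> \<bar>h 0\<bar> * (1 + t\<^sup>2) + L * (1 + t\<^sup>2)"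
      using L by (intro add_mono mult_left_mono abs_le_one_plus_square) auto
    then show "\<bar>h t\<bar> \<le> (\<bar>h 0\<bar> + L) * (1 + t\<^sup>2)" using hb[of t] by (simp add: algebra_simps)
  qed simp
  show i2: "integrable (gauss \<sigma>) (\<lambda>t. (h t)\<^sup>2)"
  proof (rule gauss_integrable_quadratic[OF \<sigma>])
    fix t
    have "(h t)\<^sup>2 \<le> (\<bar>h 0\<bar> + L * \<bar>t\<bar>)\<^sup>2" using hb[of t] by (metis abs_ge_zero power2_abs power_mono)
    also have "\<dots> \<le> 2 * (h 0)\<^sup>2 + 2 * L\<^sup>2 * t\<^sup>2"
      using zero_le_power2[of "\<bar>h 0\<bar> - L * \<bar>t\<bar>"] by (simp add: power2_sum power2_diff power_mult_distrib)
    also have "\<dots> \<le> (2 * (h 0)\<^sup>2 + 2 * L\<^sup>2) * (1 + t\<^sup>2)" by (simp add: algebra_simps)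
    finally show "\<bar>(h t)\<^sup>2\<bar> \<le> (2 * (h 0)\<^sup>2 + 2 * L\<^sup>2) * (1 + t\<^sup>2)" by simp
  qed simp
  have i3: "integrable (gauss \<sigma>) (\<lambda>t. (h t - h 0)\<^sup>2)"
    unfolding power2_diff using i1 i2 by simp
  let ?E = "\<integral>t. h t \<partial>gauss \<sigma>"
  have "(\<integral>t. (h t - h 0)\<^sup>2 \<partial>gauss \<sigma>) \<le> (\<integral>t. L\<^sup>2 * t\<^sup>2 \<partial>gauss \<sigma>)"
  proof (rule integral_mono[OF i3])
    show "integrable (gauss \<sigma>) (\<lambda>t. L\<^sup>2 * t\<^sup>2)" using gauss_square(1)[OF \<sigma>] by simp
    fix t show "(h t - h 0)\<^sup>2 \<le> L\<^sup>2 * t\<^sup>2"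
      using lip[of t 0] by (metis abs_ge_zero diff_zero power2_abs power_mono power_mult_distrib)
  qed
  also have "\<dots> = L\<^sup>2 * \<sigma>\<^sup>2" using gauss_square(2)[OF \<sigma>] by simp
  finally have "(\<integral>t. (h t)\<^sup>2 \<partial>gauss \<sigma>) + (h 0)\<^sup>2 - 2 * ?E * h 0 \<le> L\<^sup>2 * \<sigma>\<^sup>2"
    unfolding power2_diff using i1 i2 prob_space by simp
  moreover have "0 \<le> (?E - h 0)\<^sup>2" by simp
  ultimately show "(\<integral>t. (h t)\<^sup>2 \<partial>gauss \<sigma>) \<le> ?E\<^sup>2 + L\<^sup>2 * \<sigma>\<^sup>2"
    by (simp add: power2_diff)
qed

section \<open>Concentration and integration by parts for finite Gaussian products\<close>

abbreviation gauss_prod :: "'i set \<Rightarrow> real \<Rightarrow> ('i \<Rightarrow> real) measure" where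
  "gauss_prod S \<sigma> \<equiv> \<Pi>\<^sub>M x\<in>S. gauss \<sigma>"

lemma prob_space_gauss_prod: "0 < \<sigma> \<Longrightarrow> prob_space (gauss_prod S \<sigma>)"
  by (intro prob_space_PiM prob_space_gauss)

lemma gauss_prod_square:
  assumes "0 < \<sigma>" "finite S" "x \<in> S"
  shows "integrable (gauss_prod S \<sigma>) (\<lambda>w. (w x)\<^sup>2)"
proof -
  interpret product_prob_space "\<lambda>_. gauss \<sigma>" S
    by (intro product_prob_spaceI prob_space_gauss assms)
  have "integrable (distr (gauss_prod S \<sigma>) (gauss \<sigma>) (\<lambda>w. w x)) (\<lambda>t. t\<^sup>2)"
    unfolding PiM_component[OF assms(3)] using gauss_square(1)[OF assms(1)] .
  then show ?thesis using assms(3) by (subst (asm) integrable_distr_eq) auto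
qed

text \<open>Turn \<open>v\<close> into \<open>w\<close> by changing one coordinate at a time and add
  the increments.\<close>

lemma coordinate_lipschitz_bound:
  fixes f :: "('i \<Rightarrow> real) \<Rightarrow> real"
  assumes "finite T" "\<And>w x t. x \<in> T \<Longrightarrow> \<bar>f (w(x := t)) - f w\<bar> \<le> L * \<bar>t - w x\<bar>"
    and "\<And>x. x \<notin> T \<Longrightarrow> w x = v x"
  shows "\<bar>f w - f v\<bar> \<le> L * (\<Sum>x\<in>T. \<bar>w x - v x\<bar>)"
  using assms
proof (induction T arbitrary: v rule: finite_induct)
  case empty
  then have "w = v" by auto
  then show ?case by simp
next
  case (insert y T)
  have "\<bar>f w - f (v(y := w y))\<bar> \<le> L * (\<Sum>x\<in>T. \<bar>w x - (v(y := w y)) x\<bar>)"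
    by (rule insert.IH) (use insert.prems in auto)
  also have "(\<Sum>x\<in>T. \<bar>w x - (v(y := w y)) x\<bar>) = (\<Sum>x\<in>T. \<bar>w x - v x\<bar>)"
    using insert.hyps by (intro sum.cong) auto
  finally have "\<bar>f w - f (v(y := w y))\<bar> \<le> L * (\<Sum>x\<in>T. \<bar>w x - v x\<bar>)" .
  moreover have "\<bar>f (v(y := w y)) - f v\<bar> \<le> L * \<bar>w y - v y\<bar>" by (rule insert.prems(1)) simp
  ultimately show ?case using insert.hyps by (simp add: distrib_left)
qed

lemma gauss_prod_lipschitz_integrable:
  fixes f :: "('i \<Rightarrow> real) \<Rightarrow> real"
  assumes \<sigma>: "0 < \<sigma>" and S: "finite S" and m: "f \<in> borel_measurable (gauss_prod S \<sigma>)"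
    and lip: "\<And>w x t. x \<in> S \<Longrightarrow> \<bar>f (w(x := t)) - f w\<bar> \<le> L * \<bar>t - w x\<bar>"
  shows "integrable (gauss_prod S \<sigma>) f" "integrable (gauss_prod S \<sigma>) (\<lambda>w. (f w)\<^sup>2)"
proof -
  interpret prob_space "gauss_prod S \<sigma>" by (rule prob_space_gauss_prod[OF \<sigma>])
  note [measurable] = m
  \<comment> \<open>Points of the product space are \<open>undefined\<close> outside
    \<open>S\<close>, so the reference point must be restricted in the same way to differ from them
    in finitely many coordinates only.\<close>
  define v :: "'i \<Rightarrow> real" where "v = (\<lambda>x\<in>S. 0)"
  define B where "B w = 2 * (f v)\<^sup>2 + 2 * L\<^sup>2 * real (card S) * (\<Sum>x\<in>S. (w x)\<^sup>2)" for w
  have Bi: "integrable (gauss_prod S \<sigma>) B"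
    unfolding B_def using gauss_prod_square[OF \<sigma> S] by simp
  have fb: "(f w)\<^sup>2 \<le> B w" if "w \<in> space (gauss_prod S \<sigma>)" for w
  proof -
    have "\<bar>f w - f v\<bar> \<le> L * (\<Sum>x\<in>S. \<bar>w x - v x\<bar>)"
      by (rule coordinate_lipschitz_bound[OF S lip])
        (use that in \<open>auto simp: v_def space_PiM PiE_def extensional_def\<close>)
    also have "(\<Sum>x\<in>S. \<bar>w x - v x\<bar>) = (\<Sum>x\<in>S. \<bar>w x\<bar>)" by (simp add: v_def)
    finally have "\<bar>f w\<bar> \<le> \<bar>f v\<bar> + L * (\<Sum>x\<in>S. \<bar>w x\<bar>)" by linarith
    then have "(f w)\<^sup>2 \<le> (\<bar>f v\<bar> + L * (\<Sum>x\<in>S. \<bar>w x\<bar>))\<^sup>2" by (metis abs_ge_zero power2_abs power_mono)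
    also have "\<dots> \<le> 2 * (f v)\<^sup>2 + 2 * L\<^sup>2 * (\<Sum>x\<in>S. \<bar>w x\<bar>)\<^sup>2"
      using zero_le_power2[of "\<bar>f v\<bar> - L * (\<Sum>x\<in>S. \<bar>w x\<bar>)"] by (simp add: power2_sum power2_diff power_mult_distrib)
    also have "(\<Sum>x\<in>S. \<bar>w x\<bar>)\<^sup>2 \<le> (\<Sum>x\<in>S. 1\<^sup>2) * (\<Sum>x\<in>S. \<bar>w x\<bar>\<^sup>2)"
      using Cauchy_Schwarz_ineq_sum[of "\<lambda>_. 1" "\<lambda>x. \<bar>w x\<bar>" S] by simp
    finally show ?thesis by (simp add: B_def mult_left_mono mult.assoc)
  qed
  show i2: "integrable (gauss_prod S \<sigma>) (\<lambda>w. (f w)\<^sup>2)"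
    by (rule Bochner_Integration.integrable_bound[OF Bi]) (use fb in \<open>auto intro!: AE_I2 order_trans[OF fb]\<close>)
  show "integrable (gauss_prod S \<sigma>) f"
    by (rule square_integrable_imp_integrable[OF m i2])
qed

text \<open>Tensorisation of the variance: integrating out one coordinate costs L^2 sigma^2 and
  leaves a function that is still L-Lipschitz in each remaining coordinate, so the costs add
  up.\<close>

theorem gauss_prod_variance_lipschitz:
  fixes f :: "('i \<Rightarrow> real) \<Rightarrow> real"
  assumes \<sigma>: "0 < \<sigma>" and S: "finite S" and "f \<in> borel_measurable (gauss_prod S \<sigma>)"
    and "\<And>w x t. x \<in> S \<Longrightarrow> \<bar>f (w(x := t)) - f w\<bar> \<le> L * \<bar>t - w x\<bar>"
  shows "(\<integral>w. (f w)\<^sup>2 \<partial>gauss_prod S \<sigma>) \<le> (\<integral>w. f w \<partial>gauss_prod S \<sigma>)\<^sup>2 + real (card S) * (L\<^sup>2 * \<sigma>\<^sup>2)"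
  using S assms(3,4)
proof (induction S arbitrary: f rule: finite_induct)
  case empty
  show ?case by (simp add: PiM_empty lebesgue_integral_count_space_finite)
next
  case (insert x T)
  interpret product_prob_space "\<lambda>_. gauss \<sigma>" T
    by (intro product_prob_spaceI prob_space_gauss \<sigma>)
  interpret N: finite_measure "gauss \<sigma>" by (rule prob_space.finite_measure[OF prob_space_gauss[OF \<sigma>]])
  interpret T: finite_measure "gauss_prod T \<sigma>" by (rule prob_space.finite_measure[OF prob_space_gauss_prod[OF \<sigma>]])
  note N1 = prob_space.prob_space[OF prob_space_gauss[OF \<sigma>]] and T1 = prob_space.prob_space[OF prob_space_gauss_prod[OF \<sigma>, of T]]
  note m [measurable] = insert.prems(1)
  note lip = insert.prems(2)
  have ST: "finite (insert x T)" using insert.hyps by simp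
  have lip1: "\<bar>f (w(x := s)) - f (w(x := t))\<bar> \<le> L * \<bar>s - t\<bar>" for w s t
    using lip[OF insertI1, of "w(x := t)" s] unfolding fun_upd_upd fun_upd_same .
  note h = gauss_second_moment_lipschitz[OF \<sigma> lip1]
  define g where "g w = (\<integral>t. f (w(x := t)) \<partial>gauss \<sigma>)" for w
  have um: "(\<lambda>(w, t). f (w(x := t))) \<in> borel_measurable (gauss_prod T \<sigma> \<Otimes>\<^sub>M gauss \<sigma>)"
    using measurable_comp[OF measurable_add_dim[of x T "\<lambda>_. gauss \<sigma>"] m] by (simp add: comp_def case_prod_beta')
  have gm[measurable]: "g \<in> borel_measurable (gauss_prod T \<sigma>)"
    unfolding g_def using um by measurable
  have glip: "\<bar>g (w(y := t)) - g w\<bar> \<le> L * \<bar>t - w y\<bar>" if y: "y \<in> T" for w y t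
  proof -
    have ne: "y \<noteq> x" using y insert.hyps by auto
    have "g (w(y := t)) - g w = (\<integral>s. f (w(y := t, x := s)) - f (w(x := s)) \<partial>gauss \<sigma>)"
      unfolding g_def by (rule Bochner_Integration.integral_diff[OF h(1) h(1), symmetric])
    also have "\<bar>\<dots>\<bar> \<le> (\<integral>s. \<bar>f (w(y := t, x := s)) - f (w(x := s))\<bar> \<partial>gauss \<sigma>)" by (rule integral_abs_bound)
    also have "\<dots> \<le> (\<integral>s. L * \<bar>t - w y\<bar> \<partial>gauss \<sigma>)"
    proof (rule integral_mono)
      show "integrable (gauss \<sigma>) (\<lambda>s. \<bar>f (w(y := t, x := s)) - f (w(x := s))\<bar>)"
        by (intro integrable_abs Bochner_Integration.integrable_diff h(1))
      fix s show "\<bar>f (w(y := t, x := s)) - f (w(x := s))\<bar> \<le> L * \<bar>t - w y\<bar>"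
        using lip[OF insertI2[OF y], of "w(x := s)" t] unfolding fun_upd_twist[OF ne] fun_upd_other[OF ne] .
    qed simp
    also have "\<dots> = L * \<bar>t - w y\<bar>" using N1 by simp
    finally show ?thesis .
  qed
  note fi = gauss_prod_lipschitz_integrable[OF \<sigma> ST m lip]
  note gi = gauss_prod_lipschitz_integrable[OF \<sigma> insert.hyps(1) gm glip]
  have "(\<integral>w. (f w)\<^sup>2 \<partial>gauss_prod (insert x T) \<sigma>) = (\<integral>w. (\<integral>t. (f (w(x := t)))\<^sup>2 \<partial>gauss \<sigma>) \<partial>gauss_prod T \<sigma>)"
    by (rule product_integral_insert[OF insert.hyps fi(2)])
  also have "\<dots> \<le> (\<integral>w. (g w)\<^sup>2 + L\<^sup>2 * \<sigma>\<^sup>2 \<partial>gauss_prod T \<sigma>)"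
  proof (rule integral_mono_AE')
    show "integrable (gauss_prod T \<sigma>) (\<lambda>w. (g w)\<^sup>2 + L\<^sup>2 * \<sigma>\<^sup>2)" using gi(2) by simp
    show "AE w in gauss_prod T \<sigma>. (\<integral>t. (f (w(x := t)))\<^sup>2 \<partial>gauss \<sigma>) \<le> (g w)\<^sup>2 + L\<^sup>2 * \<sigma>\<^sup>2"
      unfolding g_def using h(3) by simp
    show "AE w in gauss_prod T \<sigma>. 0 \<le> (g w)\<^sup>2 + L\<^sup>2 * \<sigma>\<^sup>2" by simp
  qed
  also have "\<dots> = (\<integral>w. (g w)\<^sup>2 \<partial>gauss_prod T \<sigma>) + L\<^sup>2 * \<sigma>\<^sup>2" using gi(2) T1 by simp
  also have "\<dots> \<le> (\<integral>w. g w \<partial>gauss_prod T \<sigma>)\<^sup>2 + real (card T) * (L\<^sup>2 * \<sigma>\<^sup>2) + L\<^sup>2 * \<sigma>\<^sup>2"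
    using insert.IH[OF gm glip] by simp
  also have "(\<integral>w. g w \<partial>gauss_prod T \<sigma>) = (\<integral>w. f w \<partial>gauss_prod (insert x T) \<sigma>)"
    unfolding g_def by (rule product_integral_insert[OF insert.hyps fi(1), symmetric])
  finally show ?case using insert.hyps by (simp add: algebra_simps)
qed

corollary gauss_prod_chebyshev_lipschitz:
  fixes f :: "('i \<Rightarrow> real) \<Rightarrow> real"
  assumes \<sigma>: "0 < \<sigma>" and S: "finite S" and m: "f \<in> borel_measurable (gauss_prod S \<sigma>)"
    and lip: "\<And>w x t. x \<in> S \<Longrightarrow> \<bar>f (w(x := t)) - f w\<bar> \<le> L * \<bar>t - w x\<bar>" and a: "0 < a"
  shows "measure (gauss_prod S \<sigma>) {w \<in> space (gauss_prod S \<sigma>). a \<le> \<bar>f w - (\<integral>w. f w \<partial>gauss_prod S \<sigma>)\<bar>}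
    \<le> real (card S) * (L\<^sup>2 * \<sigma>\<^sup>2) / a\<^sup>2"
proof -
  interpret prob_space "gauss_prod S \<sigma>" by (rule prob_space_gauss_prod[OF \<sigma>])
  note i = gauss_prod_lipschitz_integrable[OF \<sigma> S m lip]
  have "variance f \<le> real (card S) * (L\<^sup>2 * \<sigma>\<^sup>2)"
    using gauss_prod_variance_lipschitz[OF \<sigma> S m lip] by (simp add: variance_eq[OF i])
  then show ?thesis
    using Chebyshev_inequality[OF m i(2) a] a by (meson divide_right_mono order_trans zero_le_power2)
qed

theorem gauss_prod_ibp:
  fixes f f' :: "('i \<Rightarrow> real) \<Rightarrow> real"
  assumes \<sigma>: "0 < \<sigma>" and S: "finite S" and x: "x \<in> S"
    and f: "integrable (gauss_prod S \<sigma>) (\<lambda>w. w x * f w)"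
    and f': "integrable (gauss_prod S \<sigma>) f'"
    and d: "\<And>w t. ((\<lambda>t. f (w(x := t))) has_real_derivative f' (w(x := t))) (at t)"
    and c: "\<And>w. continuous_on UNIV (\<lambda>t. f' (w(x := t)))"
    and b: "\<And>w. \<exists>C. \<forall>t. \<bar>f' (w(x := t))\<bar> \<le> C"
  shows "(\<integral>w. w x * f w \<partial>gauss_prod S \<sigma>) = \<sigma>\<^sup>2 * (\<integral>w. f' w \<partial>gauss_prod S \<sigma>)"
proof -
  interpret product_prob_space "\<lambda>_. gauss \<sigma>" S
    by (intro product_prob_spaceI prob_space_gauss \<sigma>)
  define T where "T = S - {x}"
  have T: "finite T" "x \<notin> T" "insert x T = S" using S x by (auto simp: T_def)
  have "(\<integral>w. w x * f w \<partial>gauss_prod S \<sigma>) = (\<integral>w. (\<integral>t. t * f (w(x := t)) \<partial>gauss \<sigma>) \<partial>gauss_prod T \<sigma>)"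
    using product_integral_insert[OF T(1,2), of "\<lambda>w. w x * f w"] f by (simp add: T(3))
  also have "\<dots> = (\<integral>w. \<sigma>\<^sup>2 * (\<integral>t. f' (w(x := t)) \<partial>gauss \<sigma>) \<partial>gauss_prod T \<sigma>)"
  proof (intro Bochner_Integration.integral_cong refl)
    fix w
    obtain C where "\<forall>t. \<bar>f' (w(x := t))\<bar> \<le> C" using b[of w] by blast
    then show "(\<integral>t. t * f (w(x := t)) \<partial>gauss \<sigma>) = \<sigma>\<^sup>2 * (\<integral>t. f' (w(x := t)) \<partial>gauss \<sigma>)"
      by (intro gauss_ibp[OF \<sigma> d c]) auto
  qed
  also have "\<dots> = \<sigma>\<^sup>2 * (\<integral>w. f' w \<partial>gauss_prod S \<sigma>)"
    using product_integral_insert[OF T(1,2), of f'] f' by (simp add: T(3))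
  finally show ?thesis .
qed

section \<open>Random Hamiltonians over an ensemble of (anti)commuting observables\<close>

lemma smult_smult_mat: "a \<cdot>\<^sub>m (b \<cdot>\<^sub>m B) = (a * b :: complex) \<cdot>\<^sub>m B"
  by (rule eq_matI) (auto simp: mult.assoc)

lemma add_mat_rearrange:
  fixes A B C D :: "complex mat"
  assumes "A \<in> carrier_mat n m" "B \<in> carrier_mat n m" "C \<in> carrier_mat n m" "D \<in> carrier_mat n m"
  shows "(A + B) + (C + D) = (A + D) + (C + B)"
  by (rule eq_matI) (use assms in auto)

text \<open>What the argument needs of the Majorana monomials. \<open>R\<close> marks the
  anticommuting pairs, and its being a regular graph of degree \<open>K\<close> is what turns sums
  over pairs into multiples of sums over single observables.\<close>

locale pauli_ensemble =
  fixes d :: nat and Q :: "'i set" and A :: "'i \<Rightarrow> complex mat" and s :: real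
    and R :: "'i \<Rightarrow> 'i \<Rightarrow> bool" and K :: nat
  assumes d: "0 < d" and Q: "finite Q" and s: "0 < s"
    and herm: "I \<in> Q \<Longrightarrow> hermitian_mat d (A I)"
    and square: "I \<in> Q \<Longrightarrow> A I * A I = complex_of_real s \<cdot>\<^sub>m 1\<^sub>m d"
    and comm: "I \<in> Q \<Longrightarrow> J \<in> Q \<Longrightarrow> A I * A J = (if R I J then - 1 else 1) \<cdot>\<^sub>m (A J * A I)"
    and R_card: "J \<in> Q \<Longrightarrow> card {I \<in> Q. R I J} = K"
    and R_sym: "I \<in> Q \<Longrightarrow> J \<in> Q \<Longrightarrow> R I J \<Longrightarrow> R J I"
    and K: "0 < K"
begin

definition ham :: "('i \<Rightarrow> real) \<Rightarrow> complex mat" where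
  "ham J = mat d d (\<lambda>(a, b). \<Sum>I\<in>Q. complex_of_real (J I) * A I $$ (a, b))"

definition nham :: "real \<Rightarrow> ('i \<Rightarrow> real) \<Rightarrow> complex mat" where
  "nham b J = complex_of_real (- b) \<cdot>\<^sub>m ham J"

definition av :: "real \<Rightarrow> ('i \<Rightarrow> real) \<Rightarrow> 'i \<Rightarrow> real" where
  "av b J I = gexp (nham b J) (A I)"

definition energy :: "real \<Rightarrow> ('i \<Rightarrow> real) \<Rightarrow> real" where
  "energy b J = (\<Sum>I\<in>Q. J I * av b J I)"

lemma A_carrier: "I \<in> Q \<Longrightarrow> A I \<in> carrier_mat d d"
  by (rule hermitian_mat_carrier[OF herm])

lemma ham_carrier: "ham J \<in> carrier_mat d d"
  by (simp add: ham_def)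

lemma ham_index: "a < d \<Longrightarrow> b < d \<Longrightarrow> ham J $$ (a, b) = (\<Sum>I\<in>Q. complex_of_real (J I) * A I $$ (a, b))"
  by (simp add: ham_def)

lemma hermitian_smult: "hermitian_mat d B \<Longrightarrow> hermitian_mat d (complex_of_real c \<cdot>\<^sub>m B)"
  by (rule hermitian_matI) (use hermitian_mat_carrier[of d B] in \<open>auto simp: hermitian_mat_entry\<close>)

lemma ham_hermitian: "hermitian_mat d (ham J)"
  by (rule hermitian_matI[OF ham_carrier]) (auto simp: ham_index hermitian_mat_entry[OF herm] intro!: sum.cong)

lemma nham_hermitian: "hermitian_mat d (nham b J)"
  unfolding nham_def by (rule hermitian_smult[OF ham_hermitian])

lemma nham_carrier: "nham b J \<in> carrier_mat d d"
  by (rule hermitian_mat_carrier[OF nham_hermitian])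

lemma mtrace_ham_mult:
  assumes E: "E \<in> carrier_mat d d"
  shows "mtrace (ham J * E) = (\<Sum>I\<in>Q. complex_of_real (J I) * mtrace (A I * E))"
proof -
  have "mtrace (ham J * E) = (\<Sum>a<d. \<Sum>b<d. \<Sum>I\<in>Q. complex_of_real (J I) * (A I $$ (a, b) * E $$ (b, a)))"
    unfolding mtrace_mult[OF ham_carrier E]
    by (intro sum.cong refl) (simp add: ham_index sum_distrib_right mult.assoc)
  also have "\<dots> = (\<Sum>a<d. \<Sum>I\<in>Q. \<Sum>b<d. complex_of_real (J I) * (A I $$ (a, b) * E $$ (b, a)))"
    by (intro sum.cong refl sum.swap)
  also have "\<dots> = (\<Sum>I\<in>Q. \<Sum>a<d. \<Sum>b<d. complex_of_real (J I) * (A I $$ (a, b) * E $$ (b, a)))"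
    by (rule sum.swap)
  also have "\<dots> = (\<Sum>I\<in>Q. complex_of_real (J I) * mtrace (A I * E))"
    by (intro sum.cong refl) (simp add: mtrace_mult[OF A_carrier E] sum_distrib_left)
  finally show ?thesis .
qed

lemma mtrace_smult: "B \<in> carrier_mat d d \<Longrightarrow> mtrace (c \<cdot>\<^sub>m B) = c * mtrace B"
  by (simp add: mtrace_def sum_distrib_left)

lemma mtrace_smult_mult:
  "B \<in> carrier_mat d d \<Longrightarrow> E \<in> carrier_mat d d \<Longrightarrow> mtrace ((c \<cdot>\<^sub>m B) * E) = c * mtrace (B * E)"
  by (simp add: mult_smult_assoc_mat[of _ d d _ d] mtrace_smult mult_carrier_mat[of _ d d _ d])

lemma gexp_smult:
  "hermitian_mat d N \<Longrightarrow> B \<in> carrier_mat d d \<Longrightarrow> gexp N (complex_of_real c \<cdot>\<^sub>m B) = c * gexp N B"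
  by (simp add: gexp_def mtrace_smult_mult hermitian_mexp_carrier)

lemma gexp_add:
  assumes "hermitian_mat d N" "B \<in> carrier_mat d d" "C \<in> carrier_mat d d"
  shows "gexp N (B + C) = gexp N B + gexp N C"
proof -
  note E = hermitian_mexp_carrier[OF assms(1)]
  have "mtrace ((B + C) * mexp N) = mtrace (B * mexp N) + mtrace (C * mexp N)"
    unfolding mtrace_mult[OF add_carrier_mat[OF assms(3), of B] E] mtrace_mult[OF assms(2) E] mtrace_mult[OF assms(3) E]
      sum.distrib[symmetric] using assms by (intro sum.cong refl) (simp add: distrib_right)
  then show ?thesis by (simp add: gexp_def add_divide_distrib)
qed

lemma gexp_ham: "hermitian_mat d N \<Longrightarrow> gexp N (ham J) = (\<Sum>I\<in>Q. J I * gexp N (A I))"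
  by (simp add: gexp_def mtrace_ham_mult hermitian_mexp_carrier sum_divide_distrib)

lemma energy_gexp: "energy b J = gexp (nham b J) (ham J)"
  by (simp add: energy_def av_def gexp_ham[OF nham_hermitian])

lemma gexp_nham: "gexp (nham b J) (nham b J) = - b * energy b J"
  using gexp_smult[OF nham_hermitian ham_carrier, of b J "- b" J] unfolding energy_gexp nham_def by simp

lemma gexp_A_square:
  assumes "hermitian_mat d N" "I \<in> Q" shows "(gexp N (A I))\<^sup>2 \<le> s"
  using gexp_square_le[OF assms(1) herm[OF assms(2)] d] unfolding square[OF assms(2)] gexp_scaled_one[OF assms(1) d] .

lemma av_abs_le: "I \<in> Q \<Longrightarrow> \<bar>av b J I\<bar> \<le> sqrt s"
  unfolding av_def by (rule real_le_rsqrt[of "\<bar>_\<bar>", simplified]) (rule gexp_A_square[OF nham_hermitian])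

text \<open>The observable \<open>a A\<^sub>I + b A\<^sub>J\<close>, with \<open>a\<close> and \<open>b\<close> the two expectations, squares to the scalar
  \<open>(a\<^sup>2 + b\<^sup>2) s\<close> and has expectation \<open>a\<^sup>2 + b\<^sup>2\<close>.\<close>

lemma anticommuting_pair:
  assumes N: "hermitian_mat d N" and IJ: "I \<in> Q" "J \<in> Q" "R I J"
  shows "(gexp N (A I))\<^sup>2 + (gexp N (A J))\<^sup>2 \<le> s"
proof -
  define a b where "a = gexp N (A I)" and "b = gexp N (A J)"
  define X Y where "X = complex_of_real a \<cdot>\<^sub>m A I" and "Y = complex_of_real b \<cdot>\<^sub>m A J"
  note c = A_carrier[OF IJ(1)] A_carrier[OF IJ(2)]
  have XY: "X \<in> carrier_mat d d" "Y \<in> carrier_mat d d" using c by (auto simp: X_def Y_def)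
  have hB: "hermitian_mat d (X + Y)"
    unfolding Y_def by (rule hermitian_line) (auto simp: X_def intro: hermitian_smult herm IJ)
  have sq: "X * X = complex_of_real (a\<^sup>2 * s) \<cdot>\<^sub>m 1\<^sub>m d" "Y * Y = complex_of_real (b\<^sup>2 * s) \<cdot>\<^sub>m 1\<^sub>m d"
    unfolding X_def Y_def using c square[OF IJ(1)] square[OF IJ(2)]
    by (simp_all add: mult_smult_assoc_mat[of _ d d _ d] mult_smult_distrib[of _ d d _ d] smult_smult_mat power2_eq_square mult.assoc)
  have "X * Y + Y * X = complex_of_real (a * b) \<cdot>\<^sub>m (A I * A J) + complex_of_real (a * b) \<cdot>\<^sub>m (A J * A I)"
    unfolding X_def Y_def using c
    by (simp add: mult_smult_assoc_mat[of _ d d _ d] mult_smult_distrib[of _ d d _ d] smult_smult_mat mult.commute)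
  also have "\<dots> = 0\<^sub>m d d"
    using comm[OF IJ(1,2)] IJ(3) c by (intro eq_matI) auto
  finally have XYX: "X * Y + Y * X = 0\<^sub>m d d" .
  have p: "X * X \<in> carrier_mat d d" "Y * Y \<in> carrier_mat d d" "X * Y \<in> carrier_mat d d" "Y * X \<in> carrier_mat d d"
    using XY by (auto intro!: mult_carrier_mat[of _ d d _ d])
  have "(X + Y) * (X + Y) = (X * X + Y * X) + (X * Y + Y * Y)"
    using XY by (simp add: add_mult_distrib_mat[of _ d d _ _ d] mult_add_distrib_mat[of _ d d _ d])
  also have "\<dots> = (X * X + Y * Y) + (X * Y + Y * X)"
    by (rule add_mat_rearrange[OF p(1,4,3,2)])
  also have "\<dots> = complex_of_real ((a\<^sup>2 + b\<^sup>2) * s) \<cdot>\<^sub>m 1\<^sub>m d"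
    unfolding XYX sq by (intro eq_matI) (auto simp: algebra_simps)
  finally have B2: "(X + Y) * (X + Y) = complex_of_real ((a\<^sup>2 + b\<^sup>2) * s) \<cdot>\<^sub>m 1\<^sub>m d" .
  have "gexp N (X + Y) = a\<^sup>2 + b\<^sup>2"
    unfolding gexp_add[OF N XY] unfolding X_def Y_def gexp_smult[OF N c(1)] gexp_smult[OF N c(2)]
    by (simp add: a_def b_def power2_eq_square)
  then have "(a\<^sup>2 + b\<^sup>2)\<^sup>2 \<le> (a\<^sup>2 + b\<^sup>2) * s"
    using gexp_square_le[OF N hB d] unfolding B2 gexp_scaled_one[OF N d] by simp
  then show ?thesis unfolding a_def[symmetric] b_def[symmetric]
    by (cases "a\<^sup>2 + b\<^sup>2 = 0") (use s in \<open>auto simp: power2_eq_square sum_squares_gt_zero_iff mult_le_cancel_left\<close>)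
qed

lemma R_card': "I \<in> Q \<Longrightarrow> card {J \<in> Q. R I J} = K"
proof -
  assume I: "I \<in> Q"
  have "{J \<in> Q. R I J} = {J \<in> Q. R J I}" using R_sym I by blast
  then show ?thesis using R_card[OF I] by simp
qed

text \<open>Sum the bound for anticommuting pairs over all edges of the graph \<open>R\<close>; by
  regularity every observable occurs K times in each role. The gain of 1/2 over the trivial bound s
  |Q| is what keeps the leading term of the energy estimate positive.\<close>

lemma gexp_A_square_sum:
  assumes N: "hermitian_mat d N"
  shows "(\<Sum>I\<in>Q. (gexp N (A I))\<^sup>2) \<le> s * real (card Q) / 2"
proof -
  let ?g = "\<lambda>I. (gexp N (A I))\<^sup>2"
  have f: "finite {J \<in> Q. R I J}" for I using Q by simp
  have "(\<Sum>I\<in>Q. \<Sum>J | J \<in> Q \<and> R I J. ?g I + ?g J) \<le> (\<Sum>I\<in>Q. \<Sum>J | J \<in> Q \<and> R I J. s)"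
    by (intro sum_mono anticommuting_pair[OF N]) auto
  also have "\<dots> = real (card Q) * (real K * s)" by (simp add: R_card')
  finally have u: "(\<Sum>I\<in>Q. \<Sum>J | J \<in> Q \<and> R I J. ?g I + ?g J) \<le> real (card Q) * (real K * s)" .
  have 1: "(\<Sum>I\<in>Q. \<Sum>J | J \<in> Q \<and> R I J. ?g I) = real K * (\<Sum>I\<in>Q. ?g I)"
    by (simp add: R_card' sum_distrib_left)
  have "(\<Sum>I\<in>Q. \<Sum>J | J \<in> Q \<and> R I J. ?g J) = (\<Sum>J\<in>Q. \<Sum>I | I \<in> Q \<and> R I J. ?g J)"
    by (rule sum.swap_restrict[OF Q Q])
  also have "\<dots> = real K * (\<Sum>I\<in>Q. ?g I)" by (simp add: R_card sum_distrib_left)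
  finally have 2: "(\<Sum>I\<in>Q. \<Sum>J | J \<in> Q \<and> R I J. ?g J) = real K * (\<Sum>I\<in>Q. ?g I)" .
  have "real K * (2 * (\<Sum>I\<in>Q. ?g I)) \<le> real K * (real (card Q) * s)"
    using u unfolding sum.distrib 1 2 by (simp add: algebra_simps)
  then show ?thesis using K by (simp add: mult_le_cancel_left mult.commute)
qed

text \<open>Conjugating \<open>A L\<close> by \<open>A I\<close> multiplies it by s or by -s, and
  for fixed L the minus sign occurs for exactly K of the I. Every \<open>A L\<close> gets the same
  total factor, so the Hamiltonian is reproduced up to a scalar.\<close>

lemma gexp_twirl:
  assumes N: "hermitian_mat d N"
  shows "(\<Sum>I\<in>Q. gexp N (A I * nham b J * A I)) = s * (real (card Q) - 2 * real K) * gexp N (nham b J)"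
proof -
  note E = hermitian_mexp_carrier[OF N]
  have sgn: "A I * A L * A I = complex_of_real (if R I L then - s else s) \<cdot>\<^sub>m A L" if "I \<in> Q" "L \<in> Q" for I L
  proof -
    note c = A_carrier[OF that(1)] A_carrier[OF that(2)]
    have "A I * A L * A I = (if R I L then - 1 else 1) \<cdot>\<^sub>m (A L * A I) * A I" using comm[OF that] by simp
    also have "\<dots> = (if R I L then - 1 else 1) \<cdot>\<^sub>m (A L * (A I * A I))"
      using c by (simp add: mult_smult_assoc_mat[of _ d d _ d] mult_carrier_mat[of _ d d _ d] assoc_mult_mat[of _ d d _ d _ d])
    also have "A L * (A I * A I) = complex_of_real s \<cdot>\<^sub>m A L"
      unfolding square[OF that(1)] using c by (simp add: mult_smult_distrib[of _ d d _ d])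
    finally show ?thesis by (simp add: smult_smult_mat)
  qed
  have lin: "gexp N (A I * nham b J * A I) = - b * (\<Sum>L\<in>Q. J L * gexp N (A I * A L * A I))" if I: "I \<in> Q" for I
  proof -
    note c = A_carrier[OF I]
    \<comment> \<open>Cyclicity of the trace moves the conjugation onto the exponential, so that
      linearity in the Hamiltonian can be used.\<close>
    define F where "F = A I * mexp N * A I"
    have F: "F \<in> carrier_mat d d" unfolding F_def using c E by (auto intro!: mult_carrier_mat[of _ d d _ d])
    have cyc: "mtrace (A I * B * A I * mexp N) = mtrace (B * F)" if B: "B \<in> carrier_mat d d" for B
    proof -
      have "A I * B * A I * mexp N = A I * (B * (A I * mexp N))"
        using B c E by (simp add: assoc_mult_mat[of _ d d _ d _ d] mult_carrier_mat[of _ d d _ d])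
      then have "mtrace (A I * B * A I * mexp N) = mtrace (B * (A I * mexp N) * A I)"
        using mtrace_mult_commute[OF c, of "B * (A I * mexp N)"] B c E by (simp add: mult_carrier_mat[of _ d d _ d])
      also have "B * (A I * mexp N) * A I = B * F"
        unfolding F_def using B c E by (simp add: assoc_mult_mat[of _ d d _ d _ d] mult_carrier_mat[of _ d d _ d])
      finally show ?thesis .
    qed
    have "mtrace (A I * nham b J * A I * mexp N) = complex_of_real (- b) * (\<Sum>L\<in>Q. complex_of_real (J L) * mtrace (A L * F))"
      unfolding cyc[OF nham_carrier] unfolding nham_def by (simp only: mtrace_smult_mult[OF ham_carrier F] mtrace_ham_mult[OF F])
    also have "\<dots> = complex_of_real (- b) * (\<Sum>L\<in>Q. complex_of_real (J L) * mtrace (A I * A L * A I * mexp N))"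
      by (intro arg_cong2[where f = "(*)"] refl sum.cong) (simp add: cyc A_carrier)
    finally show ?thesis by (simp add: gexp_def sum_divide_distrib sum_distrib_left)
  qed
  have g: "gexp N (nham b J) = - b * (\<Sum>L\<in>Q. J L * gexp N (A L))"
    unfolding nham_def gexp_smult[OF N ham_carrier] gexp_ham[OF N] ..
  have row: "(\<Sum>I\<in>Q. (if R I L then - s else s)) = s * (real (card Q) - 2 * real K)" if L: "L \<in> Q" for L
  proof -
    have "(\<Sum>I\<in>Q. (if R I L then - s else s)) = (\<Sum>I\<in>Q. s - (if R I L then 2 * s else 0))"
      by (intro sum.cong) auto
    also have "\<dots> = real (card Q) * s - (\<Sum>I | I \<in> Q \<and> R I L. 2 * s)"
      unfolding sum_subtractf sum.inter_filter[OF Q, symmetric] by simp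
    finally show ?thesis using R_card[OF L] by (simp add: algebra_simps)
  qed
  have "(\<Sum>I\<in>Q. gexp N (A I * nham b J * A I)) = (\<Sum>I\<in>Q. - b * (\<Sum>L\<in>Q. J L * ((if R I L then - s else s) * gexp N (A L))))"
    by (intro sum.cong refl) (simp add: lin sgn gexp_smult[OF N A_carrier])
  also have "\<dots> = - b * (\<Sum>I\<in>Q. \<Sum>L\<in>Q. J L * ((if R I L then - s else s) * gexp N (A L)))"
    by (simp only: sum_distrib_left)
  also have "(\<Sum>I\<in>Q. \<Sum>L\<in>Q. J L * ((if R I L then - s else s) * gexp N (A L))) =
    (\<Sum>L\<in>Q. (\<Sum>I\<in>Q. (if R I L then - s else s)) * (J L * gexp N (A L)))"
    by (subst sum.swap) (intro sum.cong refl, simp add: sum_distrib_left sum_distrib_right ac_simps)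
  also have "\<dots> = s * (real (card Q) - 2 * real K) * (\<Sum>L\<in>Q. J L * gexp N (A L))"
    unfolding sum_distrib_left by (intro sum.cong refl) (simp add: row)
  finally show ?thesis unfolding g by (simp add: algebra_simps)
qed

end

section \<open>Measurability of Gibbs quantities depending on random matrices\<close>

lemma measurable_pow_mat_entry:
  fixes N :: "'w \<Rightarrow> complex mat"
  assumes c: "\<And>w. N w \<in> carrier_mat d d"
    and m: "\<And>i j. i < d \<Longrightarrow> j < d \<Longrightarrow> (\<lambda>w. N w $$ (i, j)) \<in> borel_measurable P"
  shows "i < d \<Longrightarrow> j < d \<Longrightarrow> (\<lambda>w. (N w ^\<^sub>m k) $$ (i, j)) \<in> borel_measurable P"
proof (induction k arbitrary: i j)
  case 0
  have "(N w ^\<^sub>m 0) $$ (i, j) = (if i = j then 1 else 0)" for w using c[of w] 0 by simp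
  then show ?case by simp
next
  case (Suc k)
  have "(N w ^\<^sub>m Suc k) $$ (i, j) = (\<Sum>l<d. (N w ^\<^sub>m k) $$ (i, l) * N w $$ (l, j))" for w
    unfolding pow_mat.simps by (rule mult_mat_index[OF pow_carrier_mat[OF c] c Suc.prems])
  moreover have "(\<lambda>w. (N w ^\<^sub>m k) $$ (i, l) * N w $$ (l, j)) \<in> borel_measurable P" if "l < d" for l
    by (rule borel_measurable_times[OF Suc.IH[OF Suc.prems(1) that] m[OF that Suc.prems(2)]])
  then have "(\<lambda>w. (\<Sum>l<d. (N w ^\<^sub>m k) $$ (i, l) * N w $$ (l, j))) \<in> borel_measurable P"
    by (rule borel_measurable_sum) simp
  ultimately show ?case by presburger
qed

lemma mexp_carrier_mat: "N \<in> carrier_mat d d \<Longrightarrow> mexp N \<in> carrier_mat d d"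
  by (auto simp: mexp_def)

lemma measurable_mtrace_mexp:
  assumes c: "\<And>w. N w \<in> carrier_mat d d" and B: "B \<in> carrier_mat d d"
    and m: "\<And>i j. i < d \<Longrightarrow> j < d \<Longrightarrow> (\<lambda>w. N w $$ (i, j)) \<in> borel_measurable P"
  shows "(\<lambda>w. mtrace (B * mexp (N w))) \<in> borel_measurable P"
proof -
  have "(\<lambda>w. mexp (N w) $$ (i, j)) \<in> borel_measurable P" if "i < d" "j < d" for i j
  proof -
    have "mexp (N w) $$ (i, j) = (\<Sum>k. (N w ^\<^sub>m k) $$ (i, j) / of_nat (fact k))" for w
      using c[of w] that by (auto simp: mexp_def)
    moreover have "(\<lambda>w. \<Sum>k. (N w ^\<^sub>m k) $$ (i, j) / of_nat (fact k)) \<in> borel_measurable P"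
      by (intro borel_measurable_suminf borel_measurable_divide borel_measurable_const measurable_pow_mat_entry[OF c m] that)
    ultimately show ?thesis by presburger
  qed
  then have "(\<lambda>w. \<Sum>i<d. \<Sum>j<d. B $$ (i, j) * mexp (N w) $$ (j, i)) \<in> borel_measurable P"
    by (intro borel_measurable_sum borel_measurable_times borel_measurable_const) auto
  then show ?thesis by (simp add: mtrace_mult[OF B mexp_carrier_mat[OF c]])
qed

lemma measurable_partf:
  assumes c: "\<And>w. N w \<in> carrier_mat d d"
    and m: "\<And>i j. i < d \<Longrightarrow> j < d \<Longrightarrow> (\<lambda>w. N w $$ (i, j)) \<in> borel_measurable P"
  shows "(\<lambda>w. partf (N w)) \<in> borel_measurable P"
proof -
  have "(\<lambda>w. mtrace (1\<^sub>m d * mexp (N w))) \<in> borel_measurable P"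
    by (rule measurable_mtrace_mexp[OF c _ m]) auto
  moreover have "1\<^sub>m d * mexp (N w) = mexp (N w)" for w by (rule left_mult_one_mat[OF mexp_carrier_mat[OF c]])
  ultimately have "(\<lambda>w. mtrace (mexp (N w))) \<in> borel_measurable P" by simp
  then have "(\<lambda>w. Re (mtrace (mexp (N w)))) \<in> borel_measurable P" by measurable
  then show ?thesis by (simp add: partf_def)
qed

context pauli_ensemble
begin

text \<open>In a single coupling the exponent moves along a line with direction \<open>- b\<close>
  times the observable, which is the situation of \<open>gexp_line_deriv\<close>.\<close>

lemma nham_update:
  assumes I: "I \<in> Q"
  shows "nham b (J(I := t)) = nham b (J(I := 0)) + complex_of_real t \<cdot>\<^sub>m (complex_of_real (- b) \<cdot>\<^sub>m A I)"
proof (rule eq_matI)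
  note c = A_carrier[OF I]
  let ?r = "nham b (J(I := 0)) + complex_of_real t \<cdot>\<^sub>m (complex_of_real (- b) \<cdot>\<^sub>m A I)"
  have rc: "?r \<in> carrier_mat d d" using c nham_carrier by auto
  show "dim_row (nham b (J(I := t))) = dim_row ?r" "dim_col (nham b (J(I := t))) = dim_col ?r"
    using rc nham_carrier[of b "J(I := t)"] by (metis carrier_matD)+
  fix i j assume "i < dim_row ?r" "j < dim_col ?r"
  then have ij: "i < d" "j < d" using rc by (metis carrier_matD)+
  have h: "nham b J' $$ (i, j) = complex_of_real (- b) * (\<Sum>L\<in>Q. complex_of_real (J' L) * A L $$ (i, j))" for J'
    using ij ham_carrier[of J'] by (auto simp: nham_def ham_index)
  have sp: "(\<Sum>L\<in>Q. complex_of_real ((J(I := u)) L) * A L $$ (i, j)) =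
      complex_of_real u * A I $$ (i, j) + (\<Sum>L\<in>Q - {I}. complex_of_real (J L) * A L $$ (i, j))" for u
    by (subst sum.remove[OF Q I]) (auto intro!: sum.cong)
  have "?r $$ (i, j) = nham b (J(I := 0)) $$ (i, j) + complex_of_real t * (complex_of_real (- b) * A I $$ (i, j))"
    using ij c nham_carrier[of b "J(I := 0)"] by auto
  then show "nham b (J(I := t)) $$ (i, j) = ?r $$ (i, j)"
    unfolding h sp by (simp add: algebra_simps)
qed

text \<open>The direction -b A_I squares to b^2 s, so the quantity supplied by
  \<open>gexp_line_deriv\<close> is b^2 times the two-point function of A_I; dividing by b^2
  restores the normalisation.\<close>

lemma av_deriv:
  assumes I: "I \<in> Q" and b: "0 < b"
  obtains D where
    "\<And>t. ((\<lambda>t. ln (partf (nham b (J(I := t))))) has_real_derivative - b * av b (J(I := t)) I) (at t)"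
    "\<And>t. ((\<lambda>t. av b (J(I := t)) I) has_real_derivative - b * (D t - (av b (J(I := t)) I)\<^sup>2)) (at t)"
    "continuous_on UNIV D" "\<And>t. 0 \<le> D t" "\<And>t. D t \<le> s"
    "\<And>t. s - (s * gexp (nham b (J(I := t))) (nham b (J(I := t))) -
        gexp (nham b (J(I := t))) (A I * nham b (J(I := t)) * A I)) / 6 \<le> D t"
proof -
  note c = A_carrier[OF I]
  define Y where "Y = complex_of_real (- b) \<cdot>\<^sub>m A I"
  have Y: "hermitian_mat d Y" unfolding Y_def by (rule hermitian_smult[OF herm[OF I]])
  have Y2: "Y * Y = complex_of_real (b\<^sup>2 * s) \<cdot>\<^sub>m 1\<^sub>m d"
    unfolding Y_def using c square[OF I]
    by (simp add: mult_smult_assoc_mat[of _ d d _ d] mult_smult_distrib[of _ d d _ d] smult_smult_mat power2_eq_square mult.assoc)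
  have gY: "gexp N Y = - b * gexp N (A I)" if "hermitian_mat d N" for N
    unfolding Y_def by (rule gexp_smult[OF that c])
  have YNY: "gexp N (Y * B * Y) = b\<^sup>2 * gexp N (A I * B * A I)" if "hermitian_mat d N" "B \<in> carrier_mat d d" for N B
  proof -
    have "Y * B * Y = complex_of_real (b\<^sup>2) \<cdot>\<^sub>m (A I * B * A I)"
      unfolding Y_def using c that
      by (simp add: mult_smult_assoc_mat[of _ d d _ d] mult_smult_distrib[of _ d d _ d] smult_smult_mat
          mult_carrier_mat[of _ d d _ d] power2_eq_square)
    then show ?thesis
      using gexp_smult[OF that(1), of "A I * B * A I" "b\<^sup>2"] c that by (simp add: mult_carrier_mat[of _ d d _ d])
  qed
  obtain D0 where D0:
    "\<And>t. ((\<lambda>t. ln (partf (nham b (J(I := t))))) has_real_derivative gexp (nham b (J(I := t))) Y) (at t)"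
    "\<And>t. ((\<lambda>t. gexp (nham b (J(I := t))) Y) has_real_derivative D0 t - (gexp (nham b (J(I := t))) Y)\<^sup>2) (at t)"
    "continuous_on UNIV D0" "\<And>t. 0 \<le> D0 t" "\<And>t. D0 t \<le> b\<^sup>2 * s"
    "\<And>t. b\<^sup>2 * s - (b\<^sup>2 * s * gexp (nham b (J(I := t))) (nham b (J(I := t))) - gexp (nham b (J(I := t))) (Y * nham b (J(I := t)) * Y)) / 6 \<le> D0 t"
    using gexp_line_deriv[OF nham_hermitian[of b "J(I := 0)"] Y d Y2]
    unfolding Y_def nham_update[OF I, of b J, symmetric] by blast
  note g = gY[OF nham_hermitian] and h = YNY[OF nham_hermitian nham_carrier]
  define D where "D t = D0 t / b\<^sup>2" for t
  have D0D: "D0 t = b\<^sup>2 * D t" for t using b by (simp add: D_def)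
  show ?thesis
  proof (rule that[of D])
    fix t
    show "((\<lambda>t. ln (partf (nham b (J(I := t))))) has_real_derivative - b * av b (J(I := t)) I) (at t)"
      using D0(1)[of t] unfolding g av_def .
    have "((\<lambda>t. (- 1 / b) * (- b * av b (J(I := t)) I)) has_real_derivative
        (- 1 / b) * (b\<^sup>2 * D t - (- b * av b (J(I := t)) I)\<^sup>2)) (at t)"
      using D0(2)[of t] unfolding g D0D av_def by (rule DERIV_cmult)
    moreover have "(\<lambda>t. (- 1 / b) * (- b * av b (J(I := t)) I)) = (\<lambda>t. av b (J(I := t)) I)" using b by auto
    moreover have "(- 1 / b) * (b\<^sup>2 * D t - (- b * av b (J(I := t)) I)\<^sup>2) = - b * (D t - (av b (J(I := t)) I)\<^sup>2)"
      using b by (simp add: power2_eq_square field_simps)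
    ultimately show "((\<lambda>t. av b (J(I := t)) I) has_real_derivative - b * (D t - (av b (J(I := t)) I)\<^sup>2)) (at t)" by simp
    show "continuous_on UNIV D" unfolding D_def using D0(3) b by (intro continuous_intros) auto
    show "0 \<le> D t" using D0(4)[of t] by (simp add: D_def)
    show "D t \<le> s" using D0(5)[of t] b unfolding D0D by simp
    have "b\<^sup>2 * (s - (s * gexp (nham b (J(I := t))) (nham b (J(I := t))) -
        gexp (nham b (J(I := t))) (A I * nham b (J(I := t)) * A I)) / 6) \<le> b\<^sup>2 * D t"
      using D0(6)[of t] unfolding D0D h by (simp add: algebra_simps)
    then show "s - (s * gexp (nham b (J(I := t))) (nham b (J(I := t))) -
        gexp (nham b (J(I := t))) (A I * nham b (J(I := t)) * A I)) / 6 \<le> D t"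
      using b by (simp add: mult_le_cancel_left)
  qed
qed

text \<open>The partial derivative of the Gibbs expectation in its own coupling. The function
  \<open>D\<close> of \<open>av_deriv\<close> is obtained separately for each \<open>J\<close>; as a
  \<open>deriv\<close> the quantity becomes one function of \<open>J\<close>, whose measurability
  follows from difference quotients.\<close>

definition avd :: "real \<Rightarrow> ('i \<Rightarrow> real) \<Rightarrow> 'i \<Rightarrow> real" where
  "avd b J I = deriv (\<lambda>t. av b (J(I := t)) I) (J I)"

lemma
  assumes I: "I \<in> Q" and b: "0 < b"
  shows av_has_deriv: "((\<lambda>t. av b (J(I := t)) I) has_real_derivative avd b (J(I := t)) I) (at t)"
    and avd_continuous: "continuous_on UNIV (\<lambda>t. avd b (J(I := t)) I)"
    and avd_abs_le: "\<bar>avd b J I\<bar> \<le> b * s"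
    and avd_le: "b * (s - (s * gexp (nham b J) (nham b J) - gexp (nham b J) (A I * nham b J * A I)) / 6 - (av b J I)\<^sup>2) \<le> - avd b J I"
    and ln_partf_lipschitz: "\<bar>ln (partf (nham b (J(I := t)))) - ln (partf (nham b J))\<bar> \<le> b * sqrt s * \<bar>t - J I\<bar>"
proof -
  obtain D where D:
    "\<And>t. ((\<lambda>t. ln (partf (nham b (J(I := t))))) has_real_derivative - b * av b (J(I := t)) I) (at t)"
    "\<And>t. ((\<lambda>t. av b (J(I := t)) I) has_real_derivative - b * (D t - (av b (J(I := t)) I)\<^sup>2)) (at t)"
    "continuous_on UNIV D" "\<And>t. 0 \<le> D t" "\<And>t. D t \<le> s"
    "\<And>t. s - (s * gexp (nham b (J(I := t))) (nham b (J(I := t))) -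
        gexp (nham b (J(I := t))) (A I * nham b (J(I := t)) * A I)) / 6 \<le> D t"
    using av_deriv[OF I b, of J] by blast
  have e: "avd b (J(I := t)) I = - b * (D t - (av b (J(I := t)) I)\<^sup>2)" for t
    unfolding avd_def fun_upd_upd fun_upd_same by (rule DERIV_imp_deriv[OF D(2)])
  show "((\<lambda>t. av b (J(I := t)) I) has_real_derivative avd b (J(I := t)) I) (at t)" for t
    unfolding e by (rule D(2))
  have "continuous_on UNIV (\<lambda>t. av b (J(I := t)) I)"
    by (intro continuous_at_imp_continuous_on ballI DERIV_isCont[OF D(2)])
  then show "continuous_on UNIV (\<lambda>t. avd b (J(I := t)) I)"
    unfolding e using D(3) by (intro continuous_intros)
  have J: "J(I := J I) = J" by simp
  have "(av b J I)\<^sup>2 \<le> s" unfolding av_def by (rule gexp_A_square[OF nham_hermitian I])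
  then have "\<bar>D (J I) - (av b J I)\<^sup>2\<bar> \<le> s"
    using D(4)[of "J I"] D(5)[of "J I"] zero_le_power2[of "av b J I"] by linarith
  then show "\<bar>avd b J I\<bar> \<le> b * s"
    using e[of "J I"] b unfolding J by (simp add: abs_mult mult_left_mono)
  show "b * (s - (s * gexp (nham b J) (nham b J) - gexp (nham b J) (A I * nham b J * A I)) / 6 - (av b J I)\<^sup>2) \<le> - avd b J I"
    using e[of "J I"] D(6)[of "J I"] b unfolding J by (simp add: mult_left_mono)
  have "norm (ln (partf (nham b (J(I := t)))) - ln (partf (nham b (J(I := J I))))) \<le> b * sqrt s * norm (t - J I)"
  proof (rule field_differentiable_bound[of UNIV "\<lambda>t. ln (partf (nham b (J(I := t))))" "\<lambda>t. - b * av b (J(I := t)) I"])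
    show "norm (- b * av b (J(I := t)) I) \<le> b * sqrt s" for t
      using av_abs_le[OF I, of b "J(I := t)"] b by (simp add: abs_mult mult_left_mono)
  qed (use D(1) in auto)
  then show "\<bar>ln (partf (nham b (J(I := t)))) - ln (partf (nham b J))\<bar> \<le> b * sqrt s * \<bar>t - J I\<bar>"
    unfolding J by simp
qed

text \<open>Sum the lower bounds over I. By the twirl the double commutators add up to a multiple of
  K times the energy, and the squared expectations use up at most half of s |Q|.\<close>

lemma avd_sum_le:
  assumes b: "0 < b"
  shows "b * (s * real (card Q) / 2 - s * real K * b / 3 * (- energy b J)) \<le> - (\<Sum>I\<in>Q. avd b J I)"
proof -
  let ?N = "nham b J"
  have "(\<Sum>I\<in>Q. b * (s - (s * gexp ?N ?N - gexp ?N (A I * ?N * A I)) / 6 - (av b J I)\<^sup>2)) \<le> (\<Sum>I\<in>Q. - avd b J I)"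
    by (intro sum_mono avd_le b)
  moreover have "(\<Sum>I\<in>Q. b * (s - (s * gexp ?N ?N - gexp ?N (A I * ?N * A I)) / 6 - (av b J I)\<^sup>2)) =
    b * (real (card Q) * s - (real (card Q) * (s * gexp ?N ?N) - s * (real (card Q) - 2 * real K) * gexp ?N ?N) / 6 - (\<Sum>I\<in>Q. (av b J I)\<^sup>2))"
    unfolding sum_distrib_left[symmetric] sum_subtractf sum_divide_distrib[symmetric] gexp_twirl[OF nham_hermitian] by simp
  moreover have "\<dots> = b * (real (card Q) * s - s * real K * b / 3 * (- energy b J) - (\<Sum>I\<in>Q. (av b J I)\<^sup>2))"
    unfolding gexp_nham by (simp add: algebra_simps)
  moreover have "b * (s * real (card Q) / 2) \<le> b * (real (card Q) * s - (\<Sum>I\<in>Q. (av b J I)\<^sup>2))"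
    using gexp_A_square_sum[OF nham_hermitian[of b J]] b unfolding av_def by (intro mult_left_mono) (auto simp: mult.commute)
  ultimately show ?thesis by (simp add: sum_negf algebra_simps)
qed

context
  fixes P :: "'w measure" and J :: "'w \<Rightarrow> 'i \<Rightarrow> real"
  assumes J: "\<And>I. I \<in> Q \<Longrightarrow> (\<lambda>w. J w I) \<in> borel_measurable P"
begin

lemma measurable_nham_entry:
  assumes "i < d" "j < d"
  shows "(\<lambda>w. nham b (J w) $$ (i, j)) \<in> borel_measurable P"
proof -
  have "nham b (J w) $$ (i, j) = complex_of_real (- b) * (\<Sum>L\<in>Q. complex_of_real (J w L) * A L $$ (i, j))" for w
    using assms ham_carrier[of "J w"] by (auto simp: nham_def ham_index)
  moreover have "(\<lambda>w. complex_of_real (- b) * (\<Sum>L\<in>Q. complex_of_real (J w L) * A L $$ (i, j))) \<in> borel_measurable P"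
    using J by measurable
  ultimately show ?thesis by presburger
qed

lemma measurable_ln_partf: "(\<lambda>w. ln (partf (nham b (J w)))) \<in> borel_measurable P"
  by (intro borel_measurable_ln measurable_partf[OF nham_carrier measurable_nham_entry])

lemma measurable_mtrace_A: "I \<in> Q \<Longrightarrow> (\<lambda>w. mtrace (A I * mexp (nham b (J w)))) \<in> borel_measurable P"
  by (intro measurable_mtrace_mexp[OF nham_carrier A_carrier measurable_nham_entry])

lemma measurable_av: "I \<in> Q \<Longrightarrow> (\<lambda>w. av b (J w) I) \<in> borel_measurable P"
  unfolding av_def gexp_def
  by (intro borel_measurable_divide measurable_compose[OF measurable_mtrace_A borel_measurable_Re]
      measurable_partf[OF nham_carrier measurable_nham_entry])

end

lemma measurable_avd:
  assumes J: "\<And>I. I \<in> Q \<Longrightarrow> (\<lambda>w. J w I) \<in> borel_measurable P" and I: "I \<in> Q" and b: "0 < b"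
  shows "(\<lambda>w. avd b (J w) I) \<in> borel_measurable P"
proof (rule borel_measurable_LIMSEQ_real)
  fix w
  let ?h = "\<lambda>n. inverse (real (Suc n))"
  have "((\<lambda>t. av b ((J w)(I := t)) I) has_real_derivative avd b (J w) I) (at (J w I))"
    using av_has_deriv[OF I b, of "J w" "J w I"] by simp
  then have "((\<lambda>h. (av b ((J w)(I := J w I + h)) I - av b ((J w)(I := J w I)) I) / h) \<longlongrightarrow> avd b (J w) I) (at 0)"
    by (simp add: DERIV_def)
  moreover have "filterlim ?h (at 0) sequentially"
    by (rule filterlim_atI[OF LIMSEQ_inverse_real_of_nat]) simp
  ultimately show "(\<lambda>n. (av b ((J w)(I := J w I + ?h n)) I - av b ((J w)(I := J w I)) I) / ?h n) \<longlonglongrightarrow> avd b (J w) I"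
    by (rule filterlim_compose)
next
  fix n
  show "(\<lambda>w. (av b ((J w)(I := J w I + inverse (real (Suc n)))) I - av b ((J w)(I := J w I)) I) / inverse (real (Suc n))) \<in> borel_measurable P"
  proof (intro borel_measurable_divide borel_measurable_diff measurable_av I borel_measurable_const)
    show "(\<lambda>w. ((J w)(I := J w I + inverse (real (Suc n)))) L) \<in> borel_measurable P" if "L \<in> Q" for L
      using J[OF that] J[OF I] by (cases "L = I") (simp_all del: of_nat_Suc)
    show "(\<lambda>w. ((J w)(I := J w I)) L) \<in> borel_measurable P" if "L \<in> Q" for L
      using J[OF that] by simp
  qed
qed

end

section \<open>Two independent Gaussian coupling vectors: energy, log partition function, cross
  terms\<close>

locale gaussian_pauli_ensemble = pauli_ensemble +
  fixes \<sigma> :: real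
  assumes \<sigma>: "0 < \<sigma>" and Qne: "Q \<noteq> {}"
begin

abbreviation S :: "('a \<times> bool) set" where "S \<equiv> Q \<times> UNIV"
abbreviation P :: "('a \<times> bool \<Rightarrow> real) measure" where "P \<equiv> gauss_prod S \<sigma>"

definition cpl :: "bool \<Rightarrow> ('a \<times> bool \<Rightarrow> real) \<Rightarrow> 'a \<Rightarrow> real" where "cpl c w I = w (I, c)"

lemma S_finite: "finite S" using Q by simp

lemma card_S: "card S = 2 * card Q" by (simp add: card_cartesian_product)

lemma card_Q_pos: "0 < card Q" using Q Qne by (simp add: card_gt_0_iff)

lemma P_prob: "prob_space P" by (rule prob_space_gauss_prod[OF \<sigma>])

lemma cpl_upd_same: "cpl c (w((I, c) := t)) = (cpl c w)(I := t)" by (auto simp: cpl_def)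

lemma cpl_upd_other: "c' \<noteq> c \<Longrightarrow> cpl c (w((I, c') := t)) = cpl c w" by (auto simp: cpl_def)

lemma coord_measurable: "x \<in> S \<Longrightarrow> (\<lambda>w. w x) \<in> borel_measurable P"
  using measurable_component_singleton[of x S "\<lambda>_. gauss \<sigma>"] by simp

lemma cpl_measurable: "I \<in> Q \<Longrightarrow> (\<lambda>w. cpl c w I) \<in> borel_measurable P"
  unfolding cpl_def by (rule coord_measurable) simp

lemmas av_meas = measurable_av[OF cpl_measurable]
lemmas avd_meas = measurable_avd[OF cpl_measurable]

lemma coord_lipschitz: "\<bar>(w(y := t)) x - w x\<bar> \<le> 1 * \<bar>t - w y\<bar>" for w :: "'a \<times> bool \<Rightarrow> real"
  by simp

lemma coord_integrable:
  assumes "x \<in> S"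
  shows "integrable P (\<lambda>w. w x)" "integrable P (\<lambda>w. (w x)\<^sup>2)"
  using gauss_prod_lipschitz_integrable[OF \<sigma> S_finite coord_measurable[OF assms] coord_lipschitz] by auto

lemma integrable_coord_mult:
  assumes x: "x \<in> S" and f: "f \<in> borel_measurable P" and b: "\<And>w. \<bar>f w\<bar> \<le> B"
  shows "integrable P (\<lambda>w. w x * f w)"
proof (rule Bochner_Integration.integrable_bound)
  show "integrable P (\<lambda>w. B * w x)" using coord_integrable(1)[OF x] by simp
  show "(\<lambda>w. w x * f w) \<in> borel_measurable P" by (intro borel_measurable_times coord_measurable x f)
  have "norm (w x * f w) \<le> norm (B * w x)" for w
    using b[of w] mult_left_mono[of "\<bar>f w\<bar>" "\<bar>B\<bar>" "\<bar>w x\<bar>"] by (simp add: abs_mult mult.commute)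
  then show "AE w in P. norm (w x * f w) \<le> norm (B * w x)" by simp
qed

text \<open>Integration by parts against the constant 1; taking the coordinate itself as the
  function gives the variance in \<open>coord_variance\<close>.\<close>

lemma coord_mean: "x \<in> S \<Longrightarrow> (\<integral>w. w x \<partial>P) = 0"
  using gauss_prod_ibp[OF \<sigma> S_finite, of x "\<lambda>_. 1" "\<lambda>_. 0"] coord_integrable(1)[of x] by auto

lemma coord_variance:
  assumes x: "x \<in> S" shows "(\<integral>w. (w x)\<^sup>2 \<partial>P) = \<sigma>\<^sup>2"
proof -
  interpret prob_space P by (rule P_prob)
  have "(\<integral>w. w x * w x \<partial>P) = \<sigma>\<^sup>2 * (\<integral>w. 1 \<partial>P)"
    by (rule gauss_prod_ibp[OF \<sigma> S_finite x])
      (use coord_integrable(2)[OF x] in \<open>auto simp: power2_eq_square intro: exI[of _ 1]\<close>)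
  then show ?thesis using prob_space by (simp add: power2_eq_square)
qed

text \<open>From the second moment via |x| <= (sigma + x^2 / sigma) / 2, an instance of the
  arithmetic-geometric mean inequality.\<close>

lemma coord_abs_mean:
  assumes x: "x \<in> S" shows "(\<integral>w. \<bar>w x\<bar> \<partial>P) \<le> \<sigma>"
proof -
  interpret prob_space P by (rule P_prob)
  have "(\<integral>w. \<bar>w x\<bar> \<partial>P) \<le> (\<integral>w. (\<sigma> + (w x)\<^sup>2 / \<sigma>) / 2 \<partial>P)"
  proof (rule integral_mono)
    show "integrable P (\<lambda>w. \<bar>w x\<bar>)" using coord_integrable(1)[OF x] by simp
    show "integrable P (\<lambda>w. (\<sigma> + (w x)\<^sup>2 / \<sigma>) / 2)" using coord_integrable(2)[OF x] by simp
    fix w :: "'a \<times> bool \<Rightarrow> real"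
    have "0 \<le> (\<sigma> - \<bar>w x\<bar>)\<^sup>2" by simp
    then have "2 * \<sigma> * \<bar>w x\<bar> \<le> \<sigma>\<^sup>2 + (w x)\<^sup>2" by (simp add: power2_diff)
    then have "2 * \<sigma> * \<bar>w x\<bar> \<le> \<sigma> * \<sigma> + (w x)\<^sup>2" by (simp add: power2_eq_square[of \<sigma>])
    then show "\<bar>w x\<bar> \<le> (\<sigma> + (w x)\<^sup>2 / \<sigma>) / 2" using \<sigma> by (simp add: field_simps)
  qed
  also have "\<dots> = \<sigma>"
    using coord_integrable(2)[OF x] coord_variance[OF x] \<sigma> prob_space by (simp add: power2_eq_square)
  finally show ?thesis .
qed

lemma coord_av_integrable: "I \<in> Q \<Longrightarrow> integrable P (\<lambda>w. w (I, c) * av b (cpl c' w) I)"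
  by (rule integrable_coord_mult[where B = "sqrt s"]) (auto simp: av_meas av_abs_le)

lemma avd_integrable:
  assumes "I \<in> Q" "0 < b" shows "integrable P (\<lambda>w. avd b (cpl c w) I)"
proof -
  interpret prob_space P by (rule P_prob)
  show ?thesis
    by (rule integrable_const_bound[where B = "b * s"]) (use assms avd_abs_le avd_meas in auto)
qed

lemma expectation_coord_av:
  assumes I: "I \<in> Q" and b: "0 < b"
  shows "(\<integral>w. w (I, c) * av b (cpl c w) I \<partial>P) = \<sigma>\<^sup>2 * (\<integral>w. avd b (cpl c w) I \<partial>P)"
proof (rule gauss_prod_ibp[OF \<sigma> S_finite])
  show "(I, c) \<in> S" using I by simp
  show "integrable P (\<lambda>w. w (I, c) * av b (cpl c w) I)" by (rule coord_av_integrable[OF I])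
  show "integrable P (\<lambda>w. avd b (cpl c w) I)" by (rule avd_integrable[OF I b])
  fix w t
  show "((\<lambda>t. av b (cpl c (w((I, c) := t))) I) has_real_derivative avd b (cpl c (w((I, c) := t))) I) (at t)"
    unfolding cpl_upd_same by (rule av_has_deriv[OF I b])
  show "continuous_on UNIV (\<lambda>t. avd b (cpl c (w((I, c) := t))) I)"
    unfolding cpl_upd_same by (rule avd_continuous[OF I b])
  show "\<exists>C. \<forall>t. \<bar>avd b (cpl c (w((I, c) := t))) I\<bar> \<le> C" using avd_abs_le[OF I b] by blast
qed

lemma energy_cpl: "energy b (cpl c w) = (\<Sum>I\<in>Q. w (I, c) * av b (cpl c w) I)"
  by (simp add: energy_def cpl_def)

lemma energy_integrable: "integrable P (\<lambda>w. energy b (cpl c w))"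
  unfolding energy_cpl by (intro Bochner_Integration.integrable_sum coord_av_integrable)

text \<open>With e the mean of the negated energy, integration by parts turns
  \<open>avd_sum_le\<close> into e >= b sigma^2 (s |Q| / 2 - s K b e / 3). Collecting the terms in e
  on the left gives the quotient.\<close>

lemma expectation_energy:
  assumes b: "0 < b"
  shows "b * \<sigma>\<^sup>2 * s * real (card Q) / 2 / (1 + b\<^sup>2 * \<sigma>\<^sup>2 * s * real K / 3) \<le> - (\<integral>w. energy b (cpl c w) \<partial>P)"
proof -
  interpret prob_space P by (rule P_prob)
  define e where "e = - (\<integral>w. energy b (cpl c w) \<partial>P)"
  note ei = energy_integrable[of b c]
  have "(\<integral>w. b * (s * real (card Q) / 2 - s * real K * b / 3 * (- energy b (cpl c w))) \<partial>P) \<le> (\<integral>w. - (\<Sum>I\<in>Q. avd b (cpl c w) I) \<partial>P)"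
    by (intro integral_mono avd_sum_le b) (use ei avd_integrable[OF _ b] in auto)
  also have "\<dots> = - (\<Sum>I\<in>Q. \<integral>w. avd b (cpl c w) I \<partial>P)"
    using avd_integrable[OF _ b] by (simp add: Bochner_Integration.integral_sum)
  finally have 1: "b * (s * real (card Q) / 2 - s * real K * b / 3 * e) \<le> - (\<Sum>I\<in>Q. \<integral>w. avd b (cpl c w) I \<partial>P)"
    unfolding e_def using ei prob_space by simp
  have "e = - (\<Sum>I\<in>Q. \<sigma>\<^sup>2 * (\<integral>w. avd b (cpl c w) I \<partial>P))"
    unfolding e_def energy_cpl
    by (subst Bochner_Integration.integral_sum[OF coord_av_integrable]) (simp_all add: expectation_coord_av[OF _ b])
  then have "e = \<sigma>\<^sup>2 * (- (\<Sum>I\<in>Q. \<integral>w. avd b (cpl c w) I \<partial>P))" by (simp add: sum_distrib_left)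
  moreover have "\<sigma>\<^sup>2 * (b * (s * real (card Q) / 2 - s * real K * b / 3 * e)) \<le> \<sigma>\<^sup>2 * (- (\<Sum>I\<in>Q. \<integral>w. avd b (cpl c w) I \<partial>P))"
    by (rule mult_left_mono[OF 1]) simp
  ultimately have "b * \<sigma>\<^sup>2 * s * real (card Q) / 2 \<le> e * (1 + b\<^sup>2 * \<sigma>\<^sup>2 * s * real K / 3)"
    by (simp add: algebra_simps power2_eq_square)
  moreover have "0 < 1 + b\<^sup>2 * \<sigma>\<^sup>2 * s * real K / 3" using s by (intro add_pos_nonneg) auto
  ultimately show ?thesis unfolding e_def[symmetric] by (simp only: pos_divide_le_eq)
qed

text \<open>Subtracting ln d, the value at infinite temperature, leaves a quantity that the energy
  alone bounds from above.\<close>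

definition logZ :: "real \<Rightarrow> bool \<Rightarrow> ('a \<times> bool \<Rightarrow> real) \<Rightarrow> real" where
  "logZ b c w = ln (partf (nham b (cpl c w))) - ln (real d)"

lemma nham_zero: "complex_of_real 0 \<cdot>\<^sub>m ham J = 0\<^sub>m d d"
  by (rule eq_matI) (use ham_carrier[of J] in auto)

text \<open>Convexity along the ray of Hamiltonians, with tangents at inverse temperatures \<open>0\<close> and \<open>b / 2\<close>.\<close>

lemma logZ_ge: "- (b / 2) * gexp (0\<^sub>m d d) (ham (cpl c w)) - (b / 2) * energy (b / 2) (cpl c w) \<le> logZ b c w"
proof -
  let ?H = "ham (cpl c w)"
  have "ln (partf (0\<^sub>m d d)) + (- (b / 2) - 0) * gexp (0\<^sub>m d d) ?H \<le> ln (partf (nham (b / 2) (cpl c w)))"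
    using ln_partf_tangent[OF ham_hermitian d, of 0 _ "- (b / 2)"] unfolding nham_zero nham_def .
  moreover have "ln (partf (nham (b / 2) (cpl c w))) + (- b - (- (b / 2))) * energy (b / 2) (cpl c w) \<le> ln (partf (nham b (cpl c w)))"
    unfolding energy_gexp nham_def by (rule ln_partf_tangent[OF ham_hermitian d])
  moreover have "- b - (- (b / 2)) = - (b / 2)" by simp
  ultimately show ?thesis unfolding logZ_def partf_zero by simp
qed

text \<open>The tangent at inverse temperature b, evaluated at 0.\<close>

lemma logZ_le: "logZ b c w \<le> - b * energy b (cpl c w)"
proof -
  have "ln (partf (nham b (cpl c w))) + (0 - (- b)) * energy b (cpl c w) \<le> ln (partf (0\<^sub>m d d))"
    using ln_partf_tangent[OF ham_hermitian d, of "- b" "cpl c w" 0] unfolding nham_zero energy_gexp nham_def .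
  then show ?thesis unfolding logZ_def partf_zero by simp
qed

lemma logZ_measurable: "logZ b c \<in> borel_measurable P"
  unfolding logZ_def[abs_def] by (intro borel_measurable_diff measurable_ln_partf cpl_measurable) auto

lemma logZ_lipschitz:
  assumes b: "0 < b" and x: "x \<in> S"
  shows "\<bar>logZ b c (w(x := t)) - logZ b c w\<bar> \<le> b * sqrt s * \<bar>t - w x\<bar>"
proof -
  obtain I c' where xe: "x = (I, c')" and I: "I \<in> Q" using x by auto
  show ?thesis
  proof (cases "c' = c")
    case True
    then show ?thesis unfolding xe logZ_def using ln_partf_lipschitz[OF I b, of "cpl c w" t]
      by (simp add: cpl_upd_same) (simp add: cpl_def)
  next
    case False
    then show ?thesis unfolding xe logZ_def using b s by (simp add: cpl_upd_other)
  qed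
qed

text \<open>The infinite-temperature term of \<open>logZ_ge\<close> is linear in the centred
  couplings and disappears on average.\<close>

lemma expectation_logZ:
  assumes b: "0 < b"
  shows "(b / 2) * (- (\<integral>w. energy (b / 2) (cpl c w) \<partial>P)) \<le> (\<integral>w. logZ b c w \<partial>P)"
proof -
  have g: "gexp (0\<^sub>m d d) (ham (cpl c w)) = (\<Sum>I\<in>Q. w (I, c) * gexp (0\<^sub>m d d) (A I))" for w
    using gexp_ham[of "0\<^sub>m d d" "cpl c w"] hermitian_smult[OF ham_hermitian, of 0]
    unfolding nham_zero by (simp add: cpl_def)
  have gi: "integrable P (\<lambda>w. gexp (0\<^sub>m d d) (ham (cpl c w)))"
    unfolding g using coord_integrable(1) by auto
  have g0: "(\<integral>w. gexp (0\<^sub>m d d) (ham (cpl c w)) \<partial>P) = 0"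
    unfolding g using coord_integrable(1) coord_mean by (subst Bochner_Integration.integral_sum) auto
  note ei = energy_integrable[of "b / 2" c]
  have "(\<integral>w. - (b / 2) * gexp (0\<^sub>m d d) (ham (cpl c w)) - (b / 2) * energy (b / 2) (cpl c w) \<partial>P) \<le> (\<integral>w. logZ b c w \<partial>P)"
    using gi ei gauss_prod_lipschitz_integrable(1)[OF \<sigma> S_finite logZ_measurable logZ_lipschitz[OF b]]
    by (intro integral_mono logZ_ge) auto
  then show ?thesis using gi ei g0 by simp
qed

text \<open>The energy of the Hamiltonian of copy \<open>c\<close> in the Gibbs state of the other,
  independent copy.\<close>

definition cross :: "real \<Rightarrow> bool \<Rightarrow> ('a \<times> bool \<Rightarrow> real) \<Rightarrow> real" where
  "cross b c w = (\<Sum>I\<in>Q. w (I, c) * av b (cpl (\<not> c) w) I)"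

lemma cross_measurable: "cross b c \<in> borel_measurable P"
  unfolding cross_def[abs_def]
  by (intro borel_measurable_sum borel_measurable_times coord_measurable av_meas) auto

lemma cross_sq_integrable: "integrable P (\<lambda>w. (cross b c w)\<^sup>2)"
proof (rule Bochner_Integration.integrable_bound)
  show "integrable P (\<lambda>w. (\<Sum>I\<in>Q. (w (I, c))\<^sup>2) * (real (card Q) * s))"
    using coord_integrable(2) by auto
  show "(\<lambda>w. (cross b c w)\<^sup>2) \<in> borel_measurable P" using cross_measurable by measurable
  have "(cross b c w)\<^sup>2 \<le> (\<Sum>I\<in>Q. (w (I, c))\<^sup>2) * (real (card Q) * s)" for w
  proof -
    have "(cross b c w)\<^sup>2 \<le> (\<Sum>I\<in>Q. (w (I, c))\<^sup>2) * (\<Sum>I\<in>Q. (av b (cpl (\<not> c) w) I)\<^sup>2)"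
      unfolding cross_def by (rule Cauchy_Schwarz_ineq_sum)
    also have "\<dots> \<le> (\<Sum>I\<in>Q. (w (I, c))\<^sup>2) * (real (card Q) * s)"
      using gexp_A_square[OF nham_hermitian] unfolding av_def
      by (intro mult_left_mono sum_bounded_above sum_nonneg) auto
    finally show ?thesis .
  qed
  then show "AE w in P. norm ((cross b c w)\<^sup>2) \<le> norm ((\<Sum>I\<in>Q. (w (I, c))\<^sup>2) * (real (card Q) * s))"
    using s by (auto simp: abs_mult sum_nonneg)
qed

text \<open>Write the square as a sum over I of a coupling times the rest and integrate by parts in
  that coupling. The expectations belong to the other copy and do not depend on it, so only the
  explicit occurrence in the second factor is differentiated; what remains is sigma^2 times the sum
  of the squared expectations.\<close>

lemma cross_second_moment: "(\<integral>w. (cross b c w)\<^sup>2 \<partial>P) \<le> \<sigma>\<^sup>2 * (s * real (card Q) / 2)"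
proof -
  interpret prob_space P by (rule P_prob)
  let ?a = "\<lambda>w I. av b (cpl (\<not> c) w) I"
  have m: "(\<lambda>w. ?a w I) \<in> borel_measurable P" if "I \<in> Q" for I by (rule av_meas[OF _ that])
  have ai: "integrable P (\<lambda>w. (?a w I)\<^sup>2)" if I: "I \<in> Q" for I
    by (rule integrable_const_bound[where B = s])
      (use m[OF I] gexp_A_square[OF nham_hermitian I] in \<open>auto simp: av_def\<close>)
  have ii: "integrable P (\<lambda>w. w (I, c) * (?a w I * cross b c w))" if I: "I \<in> Q" for I
  proof (rule Bochner_Integration.integrable_bound)
    show "integrable P (\<lambda>w. sqrt s * ((w (I, c))\<^sup>2 + (cross b c w)\<^sup>2))"
      using coord_integrable(2)[of "(I, c)"] cross_sq_integrable I by auto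
    show "(\<lambda>w. w (I, c) * (?a w I * cross b c w)) \<in> borel_measurable P"
      using I by (intro borel_measurable_times coord_measurable m cross_measurable) auto
    have "\<bar>w (I, c) * (?a w I * cross b c w)\<bar> \<le> sqrt s * ((w (I, c))\<^sup>2 + (cross b c w)\<^sup>2)" for w
    proof -
      have "\<bar>w (I, c) * (?a w I * cross b c w)\<bar> = \<bar>?a w I\<bar> * (\<bar>w (I, c)\<bar> * \<bar>cross b c w\<bar>)" by (simp add: abs_mult)
      also have "\<dots> \<le> sqrt s * ((w (I, c))\<^sup>2 + (cross b c w)\<^sup>2)"
      proof (rule mult_mono[OF av_abs_le[OF I]])
        have "0 \<le> (\<bar>w (I, c)\<bar> - \<bar>cross b c w\<bar>)\<^sup>2 + (w (I, c))\<^sup>2 + (cross b c w)\<^sup>2" by simp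
        then show "\<bar>w (I, c)\<bar> * \<bar>cross b c w\<bar> \<le> (w (I, c))\<^sup>2 + (cross b c w)\<^sup>2"
          by (simp add: power2_diff)
      qed (use s in auto)
      finally show ?thesis .
    qed
    then show "AE w in P. norm (w (I, c) * (?a w I * cross b c w)) \<le> norm (sqrt s * ((w (I, c))\<^sup>2 + (cross b c w)\<^sup>2))"
      using s by (auto simp: abs_mult)
  qed
  have ibp: "(\<integral>w. w (I, c) * (?a w I * cross b c w) \<partial>P) = \<sigma>\<^sup>2 * (\<integral>w. (?a w I)\<^sup>2 \<partial>P)" if I: "I \<in> Q" for I
  proof (rule gauss_prod_ibp[OF \<sigma> S_finite _ ii[OF I] ai[OF I]])
    show "(I, c) \<in> S" using I by simp
    \<comment> \<open>Independence of the two copies enters here: as a function of one coupling of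
      copy \<open>c\<close> the cross term is affine.\<close>
    have au: "?a (w((I, c) := t)) L = ?a w L" for w t L by (simp add: cpl_upd_other)
    have cu: "cross b c (w((I, c) := t)) = t * ?a w I + (\<Sum>L\<in>Q - {I}. w (L, c) * ?a w L)" for w t
      unfolding cross_def au by (subst sum.remove[OF Q I]) (auto intro!: sum.cong)
    fix w t
    show "((\<lambda>t. ?a (w((I, c) := t)) I * cross b c (w((I, c) := t))) has_real_derivative (?a (w((I, c) := t)) I)\<^sup>2) (at t)"
      unfolding au cu by (auto intro!: derivative_eq_intros simp: power2_eq_square)
    show "continuous_on UNIV (\<lambda>t. (?a (w((I, c) := t)) I)\<^sup>2)" unfolding au by simp
    show "\<exists>C. \<forall>t. \<bar>(?a (w((I, c) := t)) I)\<^sup>2\<bar> \<le> C" unfolding au by blast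
  qed
  have "(\<integral>w. (cross b c w)\<^sup>2 \<partial>P) = (\<integral>w. (\<Sum>I\<in>Q. w (I, c) * (?a w I * cross b c w)) \<partial>P)"
    by (intro Bochner_Integration.integral_cong refl) (simp add: power2_eq_square cross_def sum_distrib_right mult.assoc)
  also have "\<dots> = \<sigma>\<^sup>2 * (\<integral>w. (\<Sum>I\<in>Q. (?a w I)\<^sup>2) \<partial>P)"
    using ii ai ibp by (simp add: Bochner_Integration.integral_sum sum_distrib_left)
  also have "\<dots> \<le> \<sigma>\<^sup>2 * (s * real (card Q) / 2)"
  proof (rule mult_left_mono)
    have "(\<integral>w. (\<Sum>I\<in>Q. (?a w I)\<^sup>2) \<partial>P) \<le> (\<integral>w. s * real (card Q) / 2 \<partial>P)"
      using gexp_A_square_sum[OF nham_hermitian] ai by (intro integral_mono) (auto simp: av_def)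
    then show "(\<integral>w. (\<Sum>I\<in>Q. (?a w I)\<^sup>2) \<partial>P) \<le> s * real (card Q) / 2" using prob_space by simp
  qed simp
  finally show ?thesis .
qed

lemma cross_tail:
  assumes a: "0 < a"
  shows "measure P {w \<in> space P. a \<le> \<bar>cross b c w\<bar>} \<le> \<sigma>\<^sup>2 * (s * real (card Q) / 2) / a\<^sup>2"
proof -
  interpret prob_space P by (rule P_prob)
  have "measure P {w \<in> space P. a \<le> \<bar>cross b c w\<bar>} = measure P {w \<in> space P. a\<^sup>2 \<le> (cross b c w)\<^sup>2}"
    using a by (intro arg_cong[where f = "measure P"] Collect_cong) (auto simp: abs_le_square_iff[symmetric])
  also have "\<dots> \<le> (\<integral>w. (cross b c w)\<^sup>2 \<partial>P) / a\<^sup>2"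
    using a by (intro integral_Markov_inequality_measure[OF cross_sq_integrable, where A = "{}"]) auto
  also have "\<dots> \<le> \<sigma>\<^sup>2 * (s * real (card Q) / 2) / a\<^sup>2"
    by (rule divide_right_mono[OF cross_second_moment]) simp
  finally show ?thesis .
qed

definition abs_sum :: "('a \<times> bool \<Rightarrow> real) \<Rightarrow> real" where "abs_sum w = (\<Sum>x\<in>S. \<bar>w x\<bar>)"

lemma abs_sum_measurable: "abs_sum \<in> borel_measurable P"
  unfolding abs_sum_def[abs_def] using coord_measurable by (intro borel_measurable_sum borel_measurable_abs) auto

lemma abs_sum_tail:
  "measure P {w \<in> space P. real (card S) * \<sigma> \<le> \<bar>abs_sum w - (\<integral>w. abs_sum w \<partial>P)\<bar>} \<le> 1 / real (card S)"
proof -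
  have cS: "0 < real (card S)" using card_Q_pos by (simp add: card_S)
  have "measure P {w \<in> space P. real (card S) * \<sigma> \<le> \<bar>abs_sum w - (\<integral>w. abs_sum w \<partial>P)\<bar>}
    \<le> real (card S) * (1\<^sup>2 * \<sigma>\<^sup>2) / (real (card S) * \<sigma>)\<^sup>2"
  proof (rule gauss_prod_chebyshev_lipschitz[OF \<sigma> S_finite abs_sum_measurable])
    show "\<bar>abs_sum (w(x := t)) - abs_sum w\<bar> \<le> 1 * \<bar>t - w x\<bar>" if x: "x \<in> S" for w x t
    proof -
      have "abs_sum (w(x := t)) = \<bar>t\<bar> + (\<Sum>y\<in>S - {x}. \<bar>w y\<bar>)" for t
        unfolding abs_sum_def by (subst sum.remove[OF S_finite x]) (auto intro!: sum.cong)
      moreover have "abs_sum w = \<bar>w x\<bar> + (\<Sum>y\<in>S - {x}. \<bar>w y\<bar>)"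
        unfolding abs_sum_def by (rule sum.remove[OF S_finite x])
      ultimately show ?thesis by simp
    qed
    show "0 < real (card S) * \<sigma>" using cS \<sigma> by simp
  qed
  also have "\<dots> = 1 / real (card S)" using cS \<sigma> by (simp add: power2_eq_square field_simps)
  finally show ?thesis .
qed

lemma expectation_abs_sum: "(\<integral>w. abs_sum w \<partial>P) \<le> real (card S) * \<sigma>"
proof -
  have "(\<integral>w. abs_sum w \<partial>P) = (\<Sum>x\<in>S. \<integral>w. \<bar>w x\<bar> \<partial>P)"
    unfolding abs_sum_def using coord_integrable(1) by (intro Bochner_Integration.integral_sum) auto
  also have "\<dots> \<le> real (card S) * \<sigma>" using coord_abs_mean by (intro sum_bounded_above) auto
  finally show ?thesis .
qed

end

section \<open>From energies to the gap between the Gibbs expectations\<close>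

context gaussian_pauli_ensemble
begin

lemma gibbs_mtrace:
  assumes "I \<in> Q"
  shows "mtrace (A I * gibbs b (ham J)) = mtrace (A I * mexp (nham b J)) / complex_of_real (partf (nham b J))"
proof -
  note E = hermitian_mexp_carrier[OF nham_hermitian[of b J]]
  have "gibbs b (ham J) = (1 / complex_of_real (partf (nham b J))) \<cdot>\<^sub>m mexp (nham b J)"
    using hermitian_mtrace_mexp[OF nham_hermitian[of b J]] unfolding gibbs_def nham_def by simp
  then have "A I * gibbs b (ham J) = (1 / complex_of_real (partf (nham b J))) \<cdot>\<^sub>m (A I * mexp (nham b J))"
    using mult_smult_distrib[OF A_carrier[OF assms] E] by simp
  then show ?thesis using mtrace_smult[OF mult_carrier_mat[OF A_carrier[OF assms] E]] by simp
qed

lemma Re_gibbs_mtrace: "I \<in> Q \<Longrightarrow> Re (mtrace (A I * gibbs b (ham J))) = av b J I"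
  unfolding gibbs_mtrace Re_divide_of_real av_def gexp_def ..

text \<open>Kept with complex traces and \<open>gibbs\<close> so that it agrees literally with the
  quantity in the final theorem; only its real parts are used for the lower bound.\<close>

definition obs_gap :: "real \<Rightarrow> ('a \<times> bool \<Rightarrow> real) \<Rightarrow> real" where
  "obs_gap b w = (MAX I\<in>Q. cmod (mtrace (A I * gibbs b (ham (cpl False w))) - mtrace (A I * gibbs b (ham (cpl True w)))))"

lemma obs_gap_measurable: "obs_gap b \<in> borel_measurable P"
proof -
  have m: "(\<lambda>w. mtrace (A I * gibbs b (ham (cpl c w)))) \<in> borel_measurable P" if I: "I \<in> Q" for I c
    unfolding gibbs_mtrace[OF I]
    by (intro borel_measurable_divide measurable_mtrace_A cpl_measurable I
        measurable_compose[OF measurable_partf[OF nham_carrier measurable_nham_entry] borel_measurable_of_real])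
  have "(\<lambda>w. cmod (mtrace (A I * gibbs b (ham (cpl False w))) - mtrace (A I * gibbs b (ham (cpl True w))))) \<in> borel_measurable P"
    if I: "I \<in> Q" for I
    using m[OF I, of False] m[OF I, of True] by measurable
  then show ?thesis unfolding obs_gap_def[abs_def] by (rule borel_measurable_Max[OF Q])
qed

lemma av_gap_le: "I \<in> Q \<Longrightarrow> \<bar>av b (cpl False w) I - av b (cpl True w) I\<bar> \<le> obs_gap b w"
proof -
  assume I: "I \<in> Q"
  have "\<bar>av b (cpl False w) I - av b (cpl True w) I\<bar> \<le>
      cmod (mtrace (A I * gibbs b (ham (cpl False w))) - mtrace (A I * gibbs b (ham (cpl True w))))"
    unfolding Re_gibbs_mtrace[OF I, symmetric] minus_complex.sel(1)[symmetric] by (rule abs_Re_le_cmod)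
  also have "\<dots> \<le> obs_gap b w" unfolding obs_gap_def using I Q by (intro Max_ge) auto
  finally show ?thesis .
qed

text \<open>Pairing the difference of the couplings with the difference of the expectations expands
  into both energies minus both cross terms, and is bounded by the gap times \<open>abs_sum\<close>.
  The energies are then exchanged for \<open>logZ\<close>, the quantity that concentrates.\<close>

lemma gap_duality: "logZ b False w + logZ b True w \<le> b * (obs_gap b w * abs_sum w + \<bar>cross b False w\<bar> + \<bar>cross b True w\<bar>)"
  if b: "0 < b"
proof -
  let ?aF = "\<lambda>I. av b (cpl False w) I" and ?aT = "\<lambda>I. av b (cpl True w) I"
  have "- (\<Sum>I\<in>Q. (w (I, False) - w (I, True)) * (?aF I - ?aT I)) \<le> (\<Sum>I\<in>Q. (\<bar>w (I, False)\<bar> + \<bar>w (I, True)\<bar>) * obs_gap b w)"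
    unfolding sum_negf[symmetric]
  proof (rule sum_mono)
    fix I assume I: "I \<in> Q"
    have "- ((w (I, False) - w (I, True)) * (?aF I - ?aT I)) \<le> \<bar>w (I, False) - w (I, True)\<bar> * \<bar>?aF I - ?aT I\<bar>"
      unfolding abs_mult[symmetric] by simp
    also have "\<dots> \<le> (\<bar>w (I, False)\<bar> + \<bar>w (I, True)\<bar>) * obs_gap b w"
      using av_gap_le[OF I, of b w] by (intro mult_mono) auto
    finally show "- ((w (I, False) - w (I, True)) * (?aF I - ?aT I)) \<le> (\<bar>w (I, False)\<bar> + \<bar>w (I, True)\<bar>) * obs_gap b w" .
  qed
  also have "\<dots> = obs_gap b w * abs_sum w"
    unfolding abs_sum_def sum.cartesian_product[of "\<lambda>I c. \<bar>w (I, c)\<bar>" UNIV Q, simplified, symmetric]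
    by (simp add: UNIV_bool sum.distrib sum_distrib_left distrib_left distrib_right mult.commute add.commute)
  finally have 1: "- (\<Sum>I\<in>Q. (w (I, False) - w (I, True)) * (?aF I - ?aT I)) \<le> obs_gap b w * abs_sum w" .
  have 2: "(\<Sum>I\<in>Q. (w (I, False) - w (I, True)) * (?aF I - ?aT I)) =
      energy b (cpl False w) + energy b (cpl True w) - cross b False w - cross b True w"
    unfolding energy_cpl cross_def by (simp add: sum.distrib sum_subtractf algebra_simps)
  have "- energy b (cpl False w) - energy b (cpl True w) \<le> obs_gap b w * abs_sum w + \<bar>cross b False w\<bar> + \<bar>cross b True w\<bar>"
    using 1 unfolding 2 by linarith
  then have "b * (- energy b (cpl False w) - energy b (cpl True w)) \<le> b * (obs_gap b w * abs_sum w + \<bar>cross b False w\<bar> + \<bar>cross b True w\<bar>)"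
    using b by (intro mult_left_mono) auto
  then show ?thesis using logZ_le[of b False w] logZ_le[of b True w] by (simp add: algebra_simps)
qed

text \<open>\<open>e\<close> is a lower bound for the mean of \<open>logZ\<close>. Off the
  exceptional events each \<open>logZ\<close> is at least e / 2, the cross terms contribute at most
  e / 2 to the right side of \<open>gap_duality\<close>, and \<open>abs_sum\<close> is at most 2 |S|
  sigma = 4 |Q| sigma. The remaining e / 2 must come from the gap, which explains the 8.\<close>

theorem obs_gap_lower_bound:
  assumes b: "0 < b" and e: "0 < e"
    and e_le: "e \<le> (b / 2) * ((b / 2) * \<sigma>\<^sup>2 * s * real (card Q) / 2 / (1 + (b / 2)\<^sup>2 * \<sigma>\<^sup>2 * s * real K / 3))"
    and thr: "thr \<le> e / (8 * b * real (card Q) * \<sigma>)"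
  shows "1 - (16 * real (card Q) * b\<^sup>2 * s * \<sigma>\<^sup>2 / e\<^sup>2 + 16 * real (card Q) * b\<^sup>2 * s * \<sigma>\<^sup>2 / e\<^sup>2 + 1 / real (card S))
    \<le> measure P {w \<in> space P. thr \<le> obs_gap b w}"
proof -
  interpret prob_space P by (rule P_prob)
  let ?E = "\<lambda>f. \<integral>w. f w \<partial>P"
  \<comment> \<open>The tolerances split the budget e: half of it for the fluctuation of each
    \<open>logZ\<close>, and e / (4 b) for each cross term, which is multiplied by b later.\<close>
  define B1 where "B1 c = {w \<in> space P. e / 2 \<le> \<bar>logZ b c w - ?E (logZ b c)\<bar>}" for c
  define B2 where "B2 c = {w \<in> space P. e / (4 * b) \<le> \<bar>cross b c w\<bar>}" for c
  define B3 where "B3 = {w \<in> space P. real (card S) * \<sigma> \<le> \<bar>abs_sum w - ?E abs_sum\<bar>}"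
  define G where "G = {w \<in> space P. thr \<le> obs_gap b w}"
  note [measurable] = logZ_measurable cross_measurable abs_sum_measurable obs_gap_measurable
  have ms: "B1 c \<in> events" "B2 c \<in> events" "B3 \<in> events" "G \<in> events" for c
    unfolding B1_def B2_def B3_def G_def by measurable
  have p1: "prob (B1 c) \<le> 8 * real (card Q) * b\<^sup>2 * s * \<sigma>\<^sup>2 / e\<^sup>2" for c
  proof -
    have "prob (B1 c) \<le> real (card S) * ((b * sqrt s)\<^sup>2 * \<sigma>\<^sup>2) / (e / 2)\<^sup>2"
      unfolding B1_def by (rule gauss_prod_chebyshev_lipschitz[OF \<sigma> S_finite logZ_measurable logZ_lipschitz[OF b]]) (use e in auto)
    also have "\<dots> = 8 * real (card Q) * b\<^sup>2 * s * \<sigma>\<^sup>2 / e\<^sup>2"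
      using s e by (simp add: card_S power_mult_distrib power_divide)
    finally show ?thesis .
  qed
  have p2: "prob (B2 c) \<le> 8 * real (card Q) * b\<^sup>2 * s * \<sigma>\<^sup>2 / e\<^sup>2" for c
  proof -
    have "prob (B2 c) \<le> \<sigma>\<^sup>2 * (s * real (card Q) / 2) / (e / (4 * b))\<^sup>2"
      unfolding B2_def by (rule cross_tail) (use e b in auto)
    also have "\<dots> = 8 * real (card Q) * b\<^sup>2 * s * \<sigma>\<^sup>2 / e\<^sup>2"
      using b e by (simp add: power_mult_distrib power_divide field_simps)
    finally show ?thesis .
  qed
  have p3: "prob B3 \<le> 1 / real (card S)" unfolding B3_def by (rule abs_sum_tail)
  have Ee: "e \<le> ?E (logZ b c)" for c
  proof -
    have "(b / 2) * ((b / 2) * \<sigma>\<^sup>2 * s * real (card Q) / 2 / (1 + (b / 2)\<^sup>2 * \<sigma>\<^sup>2 * s * real K / 3)) \<le>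
        (b / 2) * (- (\<integral>w. energy (b / 2) (cpl c w) \<partial>P))"
      using b by (intro mult_left_mono expectation_energy) auto
    then show ?thesis using e_le expectation_logZ[OF b, of c] by linarith
  qed
  have "space P - G \<subseteq> (B1 False \<union> B1 True) \<union> (B2 False \<union> B2 True) \<union> B3"
  proof
    fix w assume w: "w \<in> space P - G"
    show "w \<in> (B1 False \<union> B1 True) \<union> (B2 False \<union> B2 True) \<union> B3"
    proof (rule ccontr)
      assume n: "w \<notin> (B1 False \<union> B1 True) \<union> (B2 False \<union> B2 True) \<union> B3"
      have l: "e / 2 \<le> logZ b False w" "e / 2 \<le> logZ b True w"
      proof -
        have "\<bar>logZ b False w - ?E (logZ b False)\<bar> < e / 2" "\<bar>logZ b True w - ?E (logZ b True)\<bar> < e / 2"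
          using n w unfolding B1_def by auto
        then show "e / 2 \<le> logZ b False w" "e / 2 \<le> logZ b True w"
          using Ee[of False] Ee[of True] by linarith+
      qed
      have c: "\<bar>cross b False w\<bar> \<le> e / (4 * b)" "\<bar>cross b True w\<bar> \<le> e / (4 * b)"
        using n w unfolding B2_def by auto
      have a: "abs_sum w \<le> 2 * real (card S) * \<sigma>"
        using n w expectation_abs_sum unfolding B3_def by auto
      have g0: "0 \<le> obs_gap b w" using av_gap_le[of _ b w] Qne by (metis abs_ge_zero ex_in_conv order_trans)
      have "e \<le> b * (obs_gap b w * abs_sum w + \<bar>cross b False w\<bar> + \<bar>cross b True w\<bar>)"
        using gap_duality[OF b, of w] l by linarith
      also have "\<dots> \<le> b * (obs_gap b w * (2 * real (card S) * \<sigma>) + e / (4 * b) + e / (4 * b))"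
        using b c a g0 by (intro mult_left_mono add_mono) auto
      also have "\<dots> = 4 * b * real (card Q) * \<sigma> * obs_gap b w + e / 2"
        using b by (simp add: card_S algebra_simps)
      finally have "e / 2 \<le> 4 * b * real (card Q) * \<sigma> * obs_gap b w" by simp
      then have "e / (8 * b * real (card Q) * \<sigma>) \<le> obs_gap b w"
        using b \<sigma> card_Q_pos by (simp add: field_simps)
      then show False using w thr unfolding G_def by auto
    qed
  qed
  then have "prob (space P - G) \<le> prob ((B1 False \<union> B1 True) \<union> (B2 False \<union> B2 True) \<union> B3)"
    using ms by (intro finite_measure_mono) auto
  also have "\<dots> \<le> (prob (B1 False) + prob (B1 True)) + (prob (B2 False) + prob (B2 True)) + prob B3"
    using ms by (intro order_trans[OF measure_Un_le] add_mono) auto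
  also have "\<dots> \<le> 16 * real (card Q) * b\<^sup>2 * s * \<sigma>\<^sup>2 / e\<^sup>2 + 16 * real (card Q) * b\<^sup>2 * s * \<sigma>\<^sup>2 / e\<^sup>2 + 1 / real (card S)"
    using p1[of False] p1[of True] p2[of False] p2[of True] p3 by linarith
  finally show ?thesis using prob_compl[OF ms(4)] unfolding G_def by linarith
qed

end

section \<open>Majorana monomials\<close>

lemma one_smult_mat: "(1 :: complex) \<cdot>\<^sub>m B = B"
  by (rule eq_matI) auto

lemma adj_smult: "adj (c \<cdot>\<^sub>m B) = cnj c \<cdot>\<^sub>m adj B"
  by (rule eq_matI) (auto simp: adj_def)

lemma adj_one: "adj (1\<^sub>m d) = 1\<^sub>m d"
  by (rule eq_matI) (auto simp: adj_def)

context
  fixes n :: nat and \<psi> :: "nat \<Rightarrow> complex mat"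
  assumes maj: "majorana n \<psi>"
begin

abbreviation (input) dm :: nat where "dm \<equiv> 2 ^ (n div 2)"

definition mprod :: "nat list \<Rightarrow> complex mat" where
  "mprod l = foldr (\<lambda>i M. \<psi> i * M) l (1\<^sub>m dm)"

lemma psi_hermitian: "i \<in> {1..n} \<Longrightarrow> hermitian_mat dm (\<psi> i)"
  using maj unfolding majorana_def by blast

lemma psi_carrier: "i \<in> {1..n} \<Longrightarrow> \<psi> i \<in> carrier_mat dm dm"
  by (rule hermitian_mat_carrier[OF psi_hermitian])

lemma psi_adj: "i \<in> {1..n} \<Longrightarrow> adj (\<psi> i) = \<psi> i"
  using psi_hermitian hermitian_mat_iff_adj by blast

lemma psi_anticomm_rel:
  "i \<in> {1..n} \<Longrightarrow> j \<in> {1..n} \<Longrightarrow> \<psi> i * \<psi> j + \<psi> j * \<psi> i = (if i = j then 1\<^sub>m dm else 0\<^sub>m dm dm)"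
  using maj unfolding majorana_def by blast

lemma psi_square:
  assumes "i \<in> {1..n}"
  shows "\<psi> i * \<psi> i = (1 / 2) \<cdot>\<^sub>m 1\<^sub>m dm"
proof -
  define X where "X = \<psi> i * \<psi> i"
  have X: "X \<in> carrier_mat dm dm" unfolding X_def using psi_carrier[OF assms] by (auto intro: mult_carrier_mat)
  have e: "X + X = 1\<^sub>m dm" using psi_anticomm_rel[OF assms assms] by (simp add: X_def)
  have "X = (1 / 2) \<cdot>\<^sub>m (X + X)" using X by (intro eq_matI) auto
  then have "X = (1 / 2) \<cdot>\<^sub>m 1\<^sub>m dm" unfolding e .
  then show ?thesis unfolding X_def .
qed

lemma psi_anticomm:
  assumes "i \<in> {1..n}" "j \<in> {1..n}" "i \<noteq> j"
  shows "\<psi> i * \<psi> j = (- 1) \<cdot>\<^sub>m (\<psi> j * \<psi> i)"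
proof -
  define X Y where "X = \<psi> i * \<psi> j" and "Y = \<psi> j * \<psi> i"
  have X: "X \<in> carrier_mat dm dm" "Y \<in> carrier_mat dm dm"
    unfolding X_def Y_def using psi_carrier[OF assms(1)] psi_carrier[OF assms(2)] by (auto intro: mult_carrier_mat)
  have e: "X + Y = 0\<^sub>m dm dm" using psi_anticomm_rel[OF assms(1,2)] assms(3) by (simp add: X_def Y_def)
  have "X = (- 1) \<cdot>\<^sub>m Y"
  proof (rule eq_matI)
    fix a b assume "a < dim_row ((- 1) \<cdot>\<^sub>m Y)" "b < dim_col ((- 1) \<cdot>\<^sub>m Y)"
    then have ab: "a < dm" "b < dm" using X by auto
    have "(X + Y) $$ (a, b) = 0" unfolding e using ab by simp
    then show "X $$ (a, b) = ((- 1) \<cdot>\<^sub>m Y) $$ (a, b)" using X ab by (auto simp: add_eq_0_iff2)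
  qed (use X in auto)
  then show ?thesis by (simp add: X_def Y_def)
qed

lemma mprod_simps: "mprod [] = 1\<^sub>m dm" "mprod (i # l) = \<psi> i * mprod l"
  by (simp_all add: mprod_def)

lemma mprod_carrier: "set l \<subseteq> {1..n} \<Longrightarrow> mprod l \<in> carrier_mat dm dm"
  by (induction l) (auto simp: mprod_simps intro!: mult_carrier_mat[of _ dm dm _ dm] psi_carrier)

lemmas massoc = assoc_mult_mat[of _ dm dm _ dm _ dm]
lemmas mcar = mult_carrier_mat[of _ dm dm _ dm]
lemmas msmult = mult_smult_distrib[of _ dm dm _ dm] mult_smult_assoc_mat[of _ dm dm _ dm]

lemma mprod_append:
  "set l \<subseteq> {1..n} \<Longrightarrow> set l' \<subseteq> {1..n} \<Longrightarrow> mprod (l @ l') = mprod l * mprod l'"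
  by (induction l) (simp_all add: mprod_simps mprod_carrier psi_carrier massoc left_mult_one_mat[OF mprod_carrier])

text \<open>Moving \<open>\<psi> j\<close> to the right changes the sign once for each factor with a
  different index; a factor with the same index commutes with it.\<close>

lemma psi_mprod_comm:
  assumes j: "j \<in> {1..n}"
  shows "set l \<subseteq> {1..n} \<Longrightarrow> \<psi> j * mprod l = (- 1) ^ length (filter (\<lambda>i. i \<noteq> j) l) \<cdot>\<^sub>m (mprod l * \<psi> j)"
proof (induction l)
  case Nil
  then show ?case using psi_carrier[OF j] by (auto simp: mprod_simps)
next
  case (Cons i l)
  then have i: "i \<in> {1..n}" and l: "set l \<subseteq> {1..n}" by auto
  note c = psi_carrier[OF i] psi_carrier[OF j] mprod_carrier[OF l]
  have sw: "\<psi> j * \<psi> i = (if i \<noteq> j then - 1 else 1) \<cdot>\<^sub>m (\<psi> i * \<psi> j)"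
    using psi_anticomm[OF j i] c by (cases "i = j") auto
  have "\<psi> j * mprod (i # l) = (\<psi> j * \<psi> i) * mprod l" using c by (simp add: mprod_simps massoc)
  also have "\<dots> = (if i \<noteq> j then - 1 else 1) \<cdot>\<^sub>m (\<psi> i * (\<psi> j * mprod l))"
    unfolding sw using c by (simp add: msmult massoc mcar)
  also have "\<psi> i * (\<psi> j * mprod l) = (- 1) ^ length (filter (\<lambda>i. i \<noteq> j) l) \<cdot>\<^sub>m (mprod (i # l) * \<psi> j)"
    unfolding Cons.IH[OF l] using c by (simp add: mprod_simps msmult massoc mcar)
  finally show ?case by (simp add: smult_smult_mat)
qed

lemma mprod_mprod_comm:
  "set l \<subseteq> {1..n} \<Longrightarrow> set l' \<subseteq> {1..n} \<Longrightarrow>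
    mprod l * mprod l' = (- 1) ^ (\<Sum>i\<leftarrow>l. length (filter (\<lambda>k. k \<noteq> i) l')) \<cdot>\<^sub>m (mprod l' * mprod l)"
proof (induction l)
  case Nil
  then show ?case using mprod_carrier[of l'] by (auto simp: mprod_simps)
next
  case (Cons i l)
  then have i: "i \<in> {1..n}" and l: "set l \<subseteq> {1..n}" by auto
  note c = psi_carrier[OF i] mprod_carrier[OF l] mprod_carrier[OF Cons.prems(2)]
  let ?a = "(- 1 :: complex) ^ (\<Sum>i\<leftarrow>l. length (filter (\<lambda>k. k \<noteq> i) l'))"
  let ?b = "(- 1 :: complex) ^ length (filter (\<lambda>k. k \<noteq> i) l')"
  have "mprod (i # l) * mprod l' = \<psi> i * (mprod l * mprod l')" using c by (simp add: mprod_simps massoc)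
  also have "\<dots> = ?a \<cdot>\<^sub>m ((\<psi> i * mprod l') * mprod l)"
    unfolding Cons.IH[OF l Cons.prems(2)] using c by (simp add: msmult massoc mcar)
  also have "(\<psi> i * mprod l') * mprod l = ?b \<cdot>\<^sub>m (mprod l' * mprod (i # l))"
    unfolding psi_mprod_comm[OF i Cons.prems(2)] using c by (simp add: mprod_simps msmult massoc mcar)
  finally show ?case by (simp add: smult_smult_mat power_add mult.commute)
qed

lemma adj_mprod: "set l \<subseteq> {1..n} \<Longrightarrow> adj (mprod l) = mprod (rev l)"
proof (induction l)
  case Nil
  then show ?case by (simp add: mprod_simps adj_one)
next
  case (Cons i l)
  then have i: "i \<in> {1..n}" and l: "set l \<subseteq> {1..n}" by auto
  have "mprod [i] = \<psi> i" using psi_carrier[OF i] by (simp add: mprod_simps)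
  then show ?case
    using Cons.IH[OF l] adj_mult[OF psi_carrier[OF i] mprod_carrier[OF l]] i l
    by (simp add: mprod_simps psi_adj mprod_append)
qed

text \<open>Undoing the reversal moves the head of the list past all later factors, and recursively
  so for the tail; for a list of length k this makes 0 + 1 + ... + (k - 1) sign changes.\<close>

lemma mprod_rev:
  "set l \<subseteq> {1..n} \<Longrightarrow> distinct l \<Longrightarrow> mprod (rev l) = (- 1) ^ (\<Sum>i<length l. i) \<cdot>\<^sub>m mprod l"
proof (induction l)
  case Nil
  then show ?case by (auto simp: mprod_simps)
next
  case (Cons i l)
  then have i: "i \<in> {1..n}" and l: "set l \<subseteq> {1..n}" by auto
  note c = psi_carrier[OF i] mprod_carrier[OF l]
  have f: "filter (\<lambda>k. k \<noteq> i) l = l" using Cons.prems by (auto simp: filter_id_conv)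
  have "mprod [i] = \<psi> i" using psi_carrier[OF i] by (simp add: mprod_simps)
  then have "mprod (rev (i # l)) = ((- 1) ^ (\<Sum>i<length l. i) \<cdot>\<^sub>m mprod l) * \<psi> i"
    using Cons i l by (simp add: mprod_append)
  also have "\<dots> = (- 1) ^ (\<Sum>i<length l. i) \<cdot>\<^sub>m (mprod l * \<psi> i)" using c by (simp add: msmult)
  also have "mprod l * \<psi> i = (- 1) ^ length l \<cdot>\<^sub>m mprod (i # l)"
    unfolding mprod_simps psi_mprod_comm[OF i l] f using c
    by (simp add: smult_smult_mat one_smult_mat flip: power_mult_distrib)
  finally show ?case by (simp add: smult_smult_mat power_add)
qed

text \<open>Equal factors meet in the middle and collapse pair by pair, each pair leaving the scalar
  1/2.\<close>

lemma mprod_mult_rev: "set l \<subseteq> {1..n} \<Longrightarrow> mprod l * mprod (rev l) = (1 / 2) ^ length l \<cdot>\<^sub>m 1\<^sub>m dm"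
proof (induction l)
  case Nil
  then show ?case by (auto simp: mprod_simps)
next
  case (Cons i l)
  then have i: "i \<in> {1..n}" and l: "set l \<subseteq> {1..n}" by auto
  have lr: "set (rev l) \<subseteq> {1..n}" using l by simp
  note c = psi_carrier[OF i] mprod_carrier[OF l] mprod_carrier[OF lr]
  have s1: "mprod [i] = \<psi> i" using psi_carrier[OF i] by (simp add: mprod_simps)
  have "mprod (i # l) * mprod (rev (i # l)) = (\<psi> i * mprod l) * (mprod (rev l) * \<psi> i)"
    using i l lr s1 by (simp add: mprod_append) (simp add: mprod_simps)
  also have "\<dots> = \<psi> i * ((mprod l * mprod (rev l)) * \<psi> i)" using c by (simp add: massoc mcar)
  also have "\<dots> = (1 / 2) ^ length l \<cdot>\<^sub>m (\<psi> i * \<psi> i)" unfolding Cons.IH[OF l] using c by (simp add: msmult)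
  finally show ?case unfolding psi_square[OF i] by (simp add: smult_smult_mat)
qed

lemma psi_set_mprod: "psi_set n \<psi> I = \<i> ^ (card I div 2) \<cdot>\<^sub>m mprod (sorted_list_of_set I)"
  by (simp add: psi_set_def mprod_def)

context
  fixes q :: nat
  assumes q: "even q"
begin

lemma qsubset_list:
  assumes "I \<in> qsubsets n q"
  shows "set (sorted_list_of_set I) = I" "set (sorted_list_of_set I) \<subseteq> {1..n}" "length (sorted_list_of_set I) = q"
    "distinct (sorted_list_of_set I)" "card I = q" "finite I"
proof -
  have "finite I" using assms by (auto simp: qsubsets_def intro: finite_subset)
  then show "set (sorted_list_of_set I) = I" "set (sorted_list_of_set I) \<subseteq> {1..n}" "length (sorted_list_of_set I) = q"
    "distinct (sorted_list_of_set I)" "card I = q" "finite I"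
    using assms by (auto simp: qsubsets_def)
qed

text \<open>This is what the prefactor of \<open>psi_set\<close> is for. Reversing q factors gives
  the sign (-1)^(q (q - 1) / 2), which for even q equals (-1)^(q / 2) and compensates the
  conjugation of i^(q / 2).\<close>

lemma adj_psi_set:
  assumes "I \<in> qsubsets n q" shows "adj (psi_set n \<psi> I) = psi_set n \<psi> I"
proof -
  note l = qsubset_list[OF assms]
  obtain r where r: "q = 2 * r" using q by (auto elim: evenE)
  have ex: "(- 1 :: complex) ^ (\<Sum>i<q. i) = (- 1) ^ r"
  proof -
    have "(\<Sum>i<2 * r. i) + r = 2 * r * r" by (induction r) (auto simp: algebra_simps)
    then have "even (\<Sum>i<q. i) \<longleftrightarrow> even r" unfolding r by (metis dvd_triv_left even_add mult.assoc)
    then show ?thesis by (auto simp: minus_one_power_iff)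
  qed
  have "adj (psi_set n \<psi> I) = (cnj \<i> ^ r * (- 1) ^ r) \<cdot>\<^sub>m mprod (sorted_list_of_set I)"
    unfolding psi_set_mprod adj_smult adj_mprod[OF l(2)] mprod_rev[OF l(2,4)] l(3,5) ex smult_smult_mat unfolding r by simp
  also have "cnj \<i> ^ r * (- 1) ^ r = \<i> ^ r" by (simp flip: power_mult_distrib)
  finally show ?thesis unfolding psi_set_mprod l(5) r by simp
qed

lemma psi_set_hermitian: "I \<in> qsubsets n q \<Longrightarrow> hermitian_mat dm (psi_set n \<psi> I)"
  unfolding hermitian_mat_iff_adj using adj_psi_set mprod_carrier[OF qsubset_list(2)] by (auto simp: psi_set_mprod)

text \<open>Replacing one factor by its adjoint reverses the list, so \<open>mprod_mult_rev\<close>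
  applies and the unimodular prefactors cancel.\<close>

lemma psi_set_square:
  assumes "I \<in> qsubsets n q"
  shows "psi_set n \<psi> I * psi_set n \<psi> I = complex_of_real ((1 / 2) ^ q) \<cdot>\<^sub>m 1\<^sub>m dm"
proof -
  note l = qsubset_list[OF assms]
  have lr: "set (rev (sorted_list_of_set I)) \<subseteq> {1..n}" using l by simp
  have "psi_set n \<psi> I * psi_set n \<psi> I = psi_set n \<psi> I * adj (psi_set n \<psi> I)" using adj_psi_set[OF assms] by simp
  also have "\<dots> = (\<i> ^ (q div 2) * cnj (\<i> ^ (q div 2))) \<cdot>\<^sub>m (mprod (sorted_list_of_set I) * mprod (rev (sorted_list_of_set I)))"
    unfolding psi_set_mprod adj_smult adj_mprod[OF l(2)] l(5)
    using mprod_carrier[OF l(2)] mprod_carrier[OF lr] by (simp add: msmult smult_smult_mat mult.commute)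
  also have "\<i> ^ (q div 2) * cnj (\<i> ^ (q div 2)) = 1" by (simp flip: power_mult_distrib)
  finally show ?thesis unfolding mprod_mult_rev[OF l(2)] l(3) by (simp add: smult_smult_mat power_divide)
qed

text \<open>Interchanging the products costs one sign for each pair of distinct indices, q^2 - |I
  \<inter> J| in all. As q is even, only the parity of the intersection counts.\<close>

lemma psi_set_comm:
  assumes I: "I \<in> qsubsets n q" and J: "J \<in> qsubsets n q"
  shows "psi_set n \<psi> I * psi_set n \<psi> J = (if odd (card (I \<inter> J)) then - 1 else 1) \<cdot>\<^sub>m (psi_set n \<psi> J * psi_set n \<psi> I)"
proof -
  note l = qsubset_list[OF I] and l' = qsubset_list[OF J]
  let ?L = "sorted_list_of_set I" and ?L' = "sorted_list_of_set J"
  have f: "length (filter (\<lambda>k. k \<noteq> i) ?L') + (if i \<in> J then 1 else 0) = q" for i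
  proof -
    have "length (filter (\<lambda>k. k \<noteq> i) ?L') = card (J - {i})"
      using l'(4) by (subst distinct_card[symmetric]) (auto simp: l'(1,6) intro!: arg_cong[where f = card])
    then show ?thesis using l'(5) card_Suc_Diff1[OF l'(6), of i] by (cases "i \<in> J") auto
  qed
  have "(\<Sum>i\<leftarrow>?L. length (filter (\<lambda>k. k \<noteq> i) ?L')) = (\<Sum>i\<in>I. length (filter (\<lambda>k. k \<noteq> i) ?L'))"
    using sum_list_distinct_conv_sum_set[OF l(4)] l(1) by simp
  moreover have "(\<Sum>i\<in>I. length (filter (\<lambda>k. k \<noteq> i) ?L')) + card (I \<inter> J) = q * q"
  proof -
    have "card (I \<inter> J) = (\<Sum>i\<in>I. if i \<in> J then 1 else 0)" using l(6) by (simp add: sum.If_cases Int_def)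
    then have "(\<Sum>i\<in>I. length (filter (\<lambda>k. k \<noteq> i) ?L')) + card (I \<inter> J) = (\<Sum>i\<in>I. q)"
      by (simp add: f flip: sum.distrib)
    then show ?thesis using l(5) by simp
  qed
  ultimately have "even ((\<Sum>i\<leftarrow>?L. length (filter (\<lambda>k. k \<noteq> i) ?L')) + card (I \<inter> J))" using q by simp
  then have sg: "(- 1 :: complex) ^ (\<Sum>i\<leftarrow>?L. length (filter (\<lambda>k. k \<noteq> i) ?L')) = (if odd (card (I \<inter> J)) then - 1 else 1)"
    by (auto simp: minus_one_power_iff)
  show ?thesis
    using mprod_mprod_comm[OF l(2) l'(2)] mprod_carrier[OF l(2)] mprod_carrier[OF l'(2)]
    unfolding psi_set_mprod l(5) l'(5) sg by (simp add: msmult smult_smult_mat mcar mult.commute)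
qed

end

end

section \<open>Counting q-subsets that meet a given one in an odd number of points\<close>

lemma finite_qsubsets: "finite (qsubsets n q)"
  by (rule finite_subset[of _ "Pow {1..n}"]) (auto simp: qsubsets_def)

lemma card_qsubsets: "card (qsubsets n q) = n choose q"
  using n_subsets[of "{1..n}" q] by (simp add: qsubsets_def)

text \<open>Glue a bijection between the two subsets with one between their complements, which also
  have equal size.\<close>

lemma qsubsets_transitive:
  assumes J: "J \<in> qsubsets n q" and J': "J' \<in> qsubsets n q"
  obtains \<pi> where "bij_betw \<pi> {1..n} {1..n}" "\<pi> ` J = J'"
proof -
  have f: "finite J" "finite J'" and sub: "J \<subseteq> {1..n}" "J' \<subseteq> {1..n}" and c: "card J = card J'"
    using J J' by (auto simp: qsubsets_def intro: finite_subset)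
  obtain f where f1: "bij_betw f J J'" using finite_same_card_bij[OF f c] by blast
  have "card ({1..n} - J) = card ({1..n} - J')" using sub f c by (simp add: card_Diff_subset)
  then obtain g where g1: "bij_betw g ({1..n} - J) ({1..n} - J')" using finite_same_card_bij[of "{1..n} - J" "{1..n} - J'"] by auto
  define \<pi> where "\<pi> x = (if x \<in> J then f x else g x)" for x
  have a: "bij_betw \<pi> J J'" using f1 by (rule bij_betw_cong[THEN iffD1, rotated]) (simp add: \<pi>_def)
  have b: "bij_betw \<pi> ({1..n} - J) ({1..n} - J')" using g1 by (rule bij_betw_cong[THEN iffD1, rotated]) (simp add: \<pi>_def)
  have "bij_betw \<pi> (J \<union> ({1..n} - J)) (J' \<union> ({1..n} - J'))" by (rule bij_betw_combine[OF a b]) auto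
  then have "bij_betw \<pi> {1..n} {1..n}" using sub by (simp add: Un_absorb1)
  moreover have "\<pi> ` J = J'" using a by (simp add: bij_betw_def)
  ultimately show ?thesis by (rule that)
qed

text \<open>A permutation of {1..n} that takes \<open>J\<close> to \<open>J'\<close> maps q-subsets
  injectively to q-subsets and preserves the sizes of intersections. With the roles exchanged this
  yields equality, that is, regularity of the anticommutation graph.\<close>

lemma card_odd_intersections_le:
  assumes J: "J \<in> qsubsets n q" and J': "J' \<in> qsubsets n q"
  shows "card {I \<in> qsubsets n q. odd (card (I \<inter> J))} \<le> card {I \<in> qsubsets n q. odd (card (I \<inter> J'))}"
proof -
  obtain \<pi> where p: "bij_betw \<pi> {1..n} {1..n}" "\<pi> ` J = J'" using qsubsets_transitive[OF assms] .
  have inj: "inj_on \<pi> {1..n}" and im: "\<pi> ` {1..n} = {1..n}" using p by (auto simp: bij_betw_def)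
  have Js: "J \<subseteq> {1..n}" using J by (simp add: qsubsets_def)
  show ?thesis
  proof (rule card_inj_on_le[of "image \<pi>"])
    show "inj_on (image \<pi>) {I \<in> qsubsets n q. odd (card (I \<inter> J))}"
      by (rule inj_on_subset[OF inj_on_image_Pow[OF inj]]) (auto simp: qsubsets_def)
    show "image \<pi> ` {I \<in> qsubsets n q. odd (card (I \<inter> J))} \<subseteq> {I \<in> qsubsets n q. odd (card (I \<inter> J'))}"
    proof
      fix B assume "B \<in> image \<pi> ` {I \<in> qsubsets n q. odd (card (I \<inter> J))}"
      then obtain I where I: "B = \<pi> ` I" "I \<subseteq> {1..n}" "card I = q" "odd (card (I \<inter> J))" by (auto simp: qsubsets_def)
      have "\<pi> ` (I \<inter> J) = B \<inter> J'" using inj_on_image_Int[OF inj I(2) Js] p(2) I(1) by simp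
      moreover have "card (\<pi> ` (I \<inter> J)) = card (I \<inter> J)" using I(2) by (intro card_image inj_on_subset[OF inj]) auto
      moreover have "card B = q" unfolding I(1) using I(2,3) card_image[OF inj_on_subset[OF inj]] by simp
      moreover have "B \<subseteq> {1..n}" using I(1,2) im by auto
      ultimately show "B \<in> {I \<in> qsubsets n q. odd (card (I \<inter> J'))}" using I(4) by (simp add: qsubsets_def)
    qed
  qed (simp add: finite_qsubsets)
qed

text \<open>The degree of the anticommutation graph, read off at the reference subset {1..q};
  \<open>card_odd_intersections\<close> shows that it does not depend on this choice.\<close>

definition odd_count :: "nat \<Rightarrow> nat \<Rightarrow> nat" where
  "odd_count n q = card {I \<in> qsubsets n q. odd (card (I \<inter> {1..q}))}"

lemma card_odd_intersections:
  assumes "J \<in> qsubsets n q" "q \<le> n"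
  shows "card {I \<in> qsubsets n q. odd (card (I \<inter> J))} = odd_count n q"
proof -
  have "{1..q} \<in> qsubsets n q" using assms(2) by (auto simp: qsubsets_def)
  then show ?thesis unfolding odd_count_def using card_odd_intersections_le assms(1) by (meson le_antisym)
qed

lemma odd_count_pos:
  assumes "1 \<le> q" "2 * q \<le> n" shows "0 < odd_count n q"
proof -
  \<comment> \<open>One point inside {1..q} and q - 1 points beyond it, so that the intersection is
    a single point; the hypothesis on n leaves room for them.\<close>
  let ?I = "insert 1 {q + 1..<2 * q}"
  have e: "?I \<inter> {1..q} = {1}" using assms by auto
  have "card ?I = q" using assms by simp
  then have "?I \<in> qsubsets n q" using assms by (auto simp: qsubsets_def)
  moreover have "odd (card (?I \<inter> {1..q}))" unfolding e by simp
  ultimately have "?I \<in> {I \<in> qsubsets n q. odd (card (I \<inter> {1..q}))}" by blast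
  then show ?thesis unfolding odd_count_def by (auto simp: card_gt_0_iff finite_qsubsets)
qed

text \<open>An odd intersection is nonempty, so a union bound over the common element applies. The
  bound is of order n^(q - 1), one power of n below the number of all q-subsets.\<close>

lemma odd_count_le: "odd_count n q \<le> q * ((n - 1) choose (q - 1))"
proof -
  have c: "card {I \<in> qsubsets n q. j \<in> I} \<le> (n - 1) choose (q - 1)" for j
  proof (cases "j \<in> {1..n}")
    case False
    then have e: "{I \<in> qsubsets n q. j \<in> I} = {}" by (auto simp: qsubsets_def)
    show ?thesis unfolding e by simp
  next
    case True
    have "card {I \<in> qsubsets n q. j \<in> I} \<le> card {B. B \<subseteq> {1..n} - {j} \<and> card B = q - 1}"
    proof (rule card_inj_on_le[of "\<lambda>I. I - {j}"])
      show "inj_on (\<lambda>I. I - {j}) {I \<in> qsubsets n q. j \<in> I}" by (rule inj_onI) blast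
      show "finite {B. B \<subseteq> {1..n} - {j} \<and> card B = q - 1}" by (rule finite_subset[of _ "Pow {1..n}"]) auto
      show "(\<lambda>I. I - {j}) ` {I \<in> qsubsets n q. j \<in> I} \<subseteq> {B. B \<subseteq> {1..n} - {j} \<and> card B = q - 1}"
        by (auto simp: qsubsets_def)
    qed
    also have "\<dots> = (n - 1) choose (q - 1)"
      using n_subsets[of "{1..n} - {j}" "q - 1"] True by simp
    finally show ?thesis .
  qed
  have "odd_count n q \<le> card (\<Union>j\<in>{1..q}. {I \<in> qsubsets n q. j \<in> I})"
    unfolding odd_count_def
  proof (rule card_mono)
    show "finite (\<Union>j\<in>{1..q}. {I \<in> qsubsets n q. j \<in> I})" by (auto simp: finite_qsubsets)
    show "{I \<in> qsubsets n q. odd (card (I \<inter> {1..q}))} \<subseteq> (\<Union>j\<in>{1..q}. {I \<in> qsubsets n q. j \<in> I})"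
    proof
      fix I assume I: "I \<in> {I \<in> qsubsets n q. odd (card (I \<inter> {1..q}))}"
      then have "I \<inter> {1..q} \<noteq> {}" by (intro notI) simp
      with I show "I \<in> (\<Union>j\<in>{1..q}. {I \<in> qsubsets n q. j \<in> I})" by auto
    qed
  qed
  also have "\<dots> \<le> (\<Sum>j\<in>{1..q}. card {I \<in> qsubsets n q. j \<in> I})" by (rule card_UN_le) simp
  also have "\<dots> \<le> (\<Sum>j\<in>{1..q}. (n - 1) choose (q - 1))" by (rule sum_mono[OF c])
  finally show ?thesis by simp
qed

section \<open>The SYK model\<close>

lemma syk_pauli_ensemble:
  assumes maj: "majorana n \<psi>" and q: "even q" "1 \<le> q" "2 * q \<le> n"
  shows "pauli_ensemble (2 ^ (n div 2)) (qsubsets n q) (psi_set n \<psi>) ((1 / 2) ^ q)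
    (\<lambda>I J. odd (card (I \<inter> J))) (odd_count n q)"
proof
  fix I J assume I: "I \<in> qsubsets n q" and J: "J \<in> qsubsets n q"
  show "psi_set n \<psi> I * psi_set n \<psi> J = (if odd (card (I \<inter> J)) then - 1 else 1) \<cdot>\<^sub>m (psi_set n \<psi> J * psi_set n \<psi> I)"
    by (rule psi_set_comm[OF maj q(1) I J])
  show "odd (card (I \<inter> J)) \<Longrightarrow> odd (card (J \<inter> I))" by (simp add: Int_commute)
next
  fix I assume I: "I \<in> qsubsets n q"
  show "hermitian_mat (2 ^ (n div 2)) (psi_set n \<psi> I)" by (rule psi_set_hermitian[OF maj q(1) I])
  show "psi_set n \<psi> I * psi_set n \<psi> I = complex_of_real ((1 / 2) ^ q) \<cdot>\<^sub>m 1\<^sub>m (2 ^ (n div 2))"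
    by (rule psi_set_square[OF maj q(1) I])
  show "card {L \<in> qsubsets n q. odd (card (L \<inter> I))} = odd_count n q"
    by (rule card_odd_intersections[OF I]) (use q in simp)
qed (use q finite_qsubsets odd_count_pos in auto)

text \<open>The scalings behind the argument: the variance times the number of couplings is of exact
  order n, while the variance times the degree of the anticommutation graph is bounded.\<close>

lemma syk_var_mult_card_bounds:
  assumes "1 \<le> q" "q \<le> n"
  shows "fact (q - 1) / real q ^ q * real n \<le> syk_var n q * real (card (qsubsets n q))"
    and "real (card (qsubsets n q)) \<le> real n ^ q"
    and "syk_var n q * real (card (qsubsets n q)) \<le> fact (q - 1) * real n"
    and "syk_var n q * real (odd_count n q) \<le> real q * fact (q - 1)"
proof -
  have n: "0 < real n" using assms by simp
  obtain r where r: "q = Suc r" using assms by (cases q) auto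
  have "(real n / real q) ^ q \<le> real (n choose q)" by (rule binomial_ge_n_over_k_pow_k[OF assms(2)])
  then have "syk_var n q * (real n / real q) ^ q \<le> syk_var n q * real (card (qsubsets n q))"
    unfolding card_qsubsets by (intro mult_left_mono) (simp_all add: syk_var_def)
  moreover have "syk_var n q * (real n / real q) ^ q = fact (q - 1) / real q ^ q * real n"
    using n unfolding syk_var_def r by (simp add: power_divide)
  ultimately show "fact (q - 1) / real q ^ q * real n \<le> syk_var n q * real (card (qsubsets n q))" by simp
  have "n choose q \<le> n ^ q" by (rule binomial_le_pow[OF assms(2)])
  then show N: "real (card (qsubsets n q)) \<le> real n ^ q"
    unfolding card_qsubsets by (metis of_nat_le_iff of_nat_power)
  have "syk_var n q * real (card (qsubsets n q)) \<le> syk_var n q * real n ^ q"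
    by (rule mult_left_mono[OF N]) (simp add: syk_var_def)
  also have "\<dots> = fact (q - 1) * real n" using n unfolding syk_var_def r by simp
  finally show "syk_var n q * real (card (qsubsets n q)) \<le> fact (q - 1) * real n" .
  have "(n - 1) choose (q - 1) \<le> (n - 1) ^ (q - 1)" using assms by (intro binomial_le_pow) auto
  also have "\<dots> \<le> n ^ (q - 1)" by (rule power_mono) auto
  finally have "odd_count n q \<le> q * n ^ (q - 1)"
    using odd_count_le[of n q] by (meson le_trans mult_le_mono2)
  then have "real (odd_count n q) \<le> real q * real n ^ (q - 1)"
    by (metis of_nat_le_iff of_nat_mult of_nat_power)
  then have "syk_var n q * real (odd_count n q) \<le> syk_var n q * (real q * real n ^ (q - 1))"
    by (intro mult_left_mono) (simp_all add: syk_var_def)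
  also have "\<dots> = real q * fact (q - 1)" using n by (simp add: syk_var_def)
  finally show "syk_var n q * real (odd_count n q) \<le> real q * fact (q - 1)" .
qed

text \<open>The standard deviation of a coupling has the order of the target rate. The second
  identity shows that n / (n^q sigma), the size of gap that \<open>obs_gap_lower_bound\<close>
  produces, is again of that order.\<close>

lemma sqrt_syk_var:
  assumes "1 \<le> q" "1 \<le> n"
  shows "sqrt (syk_var n q) = sqrt (fact (q - 1)) * real n powr (- (real q - 1) / 2)"
    and "(real n powr (- (real q - 1) / 2))\<^sup>2 * real n ^ q = real n"
proof -
  have n: "0 < real n" using assms by simp
  have e: "real n ^ (q - 1) = real n powr (real q - 1)" using n assms by (simp add: powr_realpow[symmetric] of_nat_diff)
  have "sqrt (real n ^ (q - 1)) = real n powr ((real q - 1) / 2)"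
    unfolding e using n by (simp add: powr_half_sqrt[symmetric] powr_powr)
  then have "sqrt (syk_var n q) = sqrt (fact (q - 1)) * real n powr (- ((real q - 1) / 2))"
    unfolding syk_var_def real_sqrt_divide powr_minus_divide by simp
  then show "sqrt (syk_var n q) = sqrt (fact (q - 1)) * real n powr (- (real q - 1) / 2)"
    by (simp only: minus_divide_left)
  have "(real n powr (- (real q - 1) / 2))\<^sup>2 * real n ^ q = real n powr (- (real q - 1) / 2 + - (real q - 1) / 2 + real q)"
    unfolding power2_eq_square powr_realpow[OF n, symmetric] powr_add ..
  also have "- (real q - 1) / 2 + - (real q - 1) / 2 + real q = 1" by (simp add: field_simps)
  finally show "(real n powr (- (real q - 1) / 2))\<^sup>2 * real n ^ q = real n" using n by simp
qed

theorem mainTheorem12: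
  fixes q :: nat and \<beta> :: real and \<psi> :: "nat \<Rightarrow> nat \<Rightarrow> complex mat"
  assumes "even q" and "q \<ge> 4" and "\<beta> > 0"
    and "\<And>n. even n \<Longrightarrow> majorana n (\<psi> n)"
  shows "\<exists>c>0. (\<lambda>m. let n = 2 * m in
           measure (two_syk_space n q)
             {w \<in> space (two_syk_space n q).
                (MAX I\<in>qsubsets n q.
                   cmod (mtrace (psi_set n (\<psi> n) I * gibbs \<beta> (syk_ham n q (\<psi> n) (\<lambda>I. w (I, False))))
                       - mtrace (psi_set n (\<psi> n) I * gibbs \<beta> (syk_ham n q (\<psi> n) (\<lambda>I. w (I, True))))))
                \<ge> c * real n powr (- (real q - 1) / 2)})
         \<longlonglongrightarrow> 1"
proof -
  define s :: real where "s = (1 / 2) ^ q"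
  define f :: real where "f = fact (q - 1)"
  \<comment> \<open>\<open>c1\<close> and \<open>c2\<close> are the constants in sigma^2 |Q| >= c1 n
    and sigma^2 K <= c2; with them \<open>c3\<close> becomes the constant in the lower bound c3 n
    for the mean of \<open>logZ\<close>.\<close>
  define c1 c2 where "c1 = f / real q ^ q" and "c2 = real q * f"
  define c3 where "c3 = (\<beta> / 2) * ((\<beta> / 2) * s * c1 / 2 / (1 + (\<beta> / 2)\<^sup>2 * s * c2 / 3))"
  define c where "c = c3 / (8 * \<beta> * sqrt f)"
  \<comment> \<open>The failure probability is at most C / n: twice the error term with 16, one for
    the two \<open>logZ\<close> and one for the two cross terms, plus the bound on 1 / |S| from the
    tail of \<open>abs_sum\<close>.\<close>
  define C where "C = 32 * \<beta>\<^sup>2 * s * f / c3\<^sup>2 + f / c1"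
  have q1: "1 \<le> q" using assms(2) by simp
  have s: "0 < s" and f: "0 < f" by (simp_all add: s_def f_def)
  have c12: "0 < c1" "0 < c2" using f q1 by (simp_all add: c1_def c2_def)
  have den: "0 < 1 + (\<beta> / 2)\<^sup>2 * s * c2 / 3" using s c12 assms(3) by (intro add_pos_pos) auto
  have c3: "0 < c3" unfolding c3_def using assms(3) s c12 den by (intro mult_pos_pos divide_pos_pos) auto
  have c: "0 < c" unfolding c_def using c3 assms(3) f by simp
  define p where "p n = measure (two_syk_space n q)
     {w \<in> space (two_syk_space n q).
        (MAX I\<in>qsubsets n q.
           cmod (mtrace (psi_set n (\<psi> n) I * gibbs \<beta> (syk_ham n q (\<psi> n) (\<lambda>I. w (I, False))))
               - mtrace (psi_set n (\<psi> n) I * gibbs \<beta> (syk_ham n q (\<psi> n) (\<lambda>I. w (I, True))))))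
        \<ge> c * real n powr (- (real q - 1) / 2)}" for n
  have bounds: "1 - C / real n \<le> p n \<and> p n \<le> 1" if n: "even n" "2 * q \<le> n" for n
  proof -
    have n1: "1 \<le> n" "q \<le> n" using n q1 by auto
    define \<sigma> where "\<sigma> = sqrt (syk_var n q)"
    define v where "v = syk_var n q"
    define N where "N = real (card (qsubsets n q))"
    define K where "K = real (odd_count n q)"
    define e where "e = c3 * real n"
    define pw where "pw = real n powr (- (real q - 1) / 2)"
    have v: "0 < v" using n1 by (simp add: v_def syk_var_def)
    have v_le: "v \<le> f" using n1 unfolding v_def syk_var_def f_def by (simp add: divide_le_eq)
    have \<sigma>: "0 < \<sigma>" and \<sigma>2: "\<sigma>\<^sup>2 = v" using v by (simp_all add: \<sigma>_def v_def)
    have Nb: "c1 * real n \<le> v * N" "N \<le> real n ^ q" "v * N \<le> f * real n" "v * K \<le> c2"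
      using syk_var_mult_card_bounds[OF q1 n1(2)] unfolding c1_def c2_def f_def v_def N_def K_def by auto
    interpret pauli_ensemble "2 ^ (n div 2)" "qsubsets n q" "psi_set n (\<psi> n)" s "\<lambda>I J. odd (card (I \<inter> J))" "odd_count n q"
      unfolding s_def by (rule syk_pauli_ensemble[OF assms(4)[OF n(1)] assms(1) q1 n(2)])
    have "0 < card (qsubsets n q)" using n1 by (simp add: card_qsubsets)
    then have ne: "qsubsets n q \<noteq> {}" and N: "0 < N" by (auto simp: N_def)
    interpret gaussian_pauli_ensemble "2 ^ (n div 2)" "qsubsets n q" "psi_set n (\<psi> n)" s "\<lambda>I J. odd (card (I \<inter> J))" "odd_count n q" \<sigma>
      by unfold_locales (use \<sigma> ne in auto)
    have P: "two_syk_space n q = P" by (simp add: two_syk_space_def \<sigma>_def)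
    have h: "syk_ham n q (\<psi> n) = ham" by (simp add: fun_eq_iff syk_ham_def ham_def)
    have p_eq: "p n = measure P {w \<in> space P. c * pw \<le> obs_gap \<beta> w}"
      unfolding p_def P h obs_gap_def pw_def cpl_def[abs_def] ..
    have n0: "0 < real n" and pw: "0 < pw" using n1 by (simp_all add: pw_def)
    have e0: "0 < e" using c3 n0 by (simp add: e_def)
    \<comment> \<open>The quotient increases with sigma^2 |Q| in the numerator and decreases with
      sigma^2 K in the denominator, so \<open>c1\<close> and \<open>c2\<close> can be replaced by
      the actual values.\<close>
    have "(\<beta> / 2) * s * c1 / 2 / (1 + (\<beta> / 2)\<^sup>2 * s * c2 / 3) * real n = ((\<beta> / 2) * s * (c1 * real n) / 2) / (1 + (\<beta> / 2)\<^sup>2 * s * c2 / 3)"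
      by simp
    also have "\<dots> \<le> ((\<beta> / 2) * s * (v * N) / 2) / (1 + (\<beta> / 2)\<^sup>2 * s * (v * K) / 3)"
      using Nb v N s assms(3)
      by (intro frac_le divide_right_mono mult_left_mono add_left_mono add_pos_nonneg) (auto simp: K_def)
    finally have "(\<beta> / 2) * ((\<beta> / 2) * s * c1 / 2 / (1 + (\<beta> / 2)\<^sup>2 * s * c2 / 3) * real n) \<le>
        (\<beta> / 2) * (((\<beta> / 2) * s * (v * N) / 2) / (1 + (\<beta> / 2)\<^sup>2 * s * (v * K) / 3))"
      using assms(3) by (intro mult_left_mono) auto
    then have e_le: "e \<le> (\<beta> / 2) * ((\<beta> / 2) * \<sigma>\<^sup>2 * s * N / 2 / (1 + (\<beta> / 2)\<^sup>2 * \<sigma>\<^sup>2 * s * K / 3))"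
      unfolding e_def c3_def \<sigma>2 by (simp only: mult_ac)
    \<comment> \<open>As sigma = sqrt f times \<open>pw\<close>, multiplying out turns the claim
      into c3 pw^2 N <= c3 n; this follows from N <= n^q and pw^2 n^q = n.\<close>
    have thr: "c * pw \<le> e / (8 * \<beta> * N * \<sigma>)"
    proof -
      have \<sigma>_eq: "\<sigma> = sqrt f * pw" using sqrt_syk_var(1)[OF q1 n1(1)] by (simp add: \<sigma>_def f_def pw_def)
      have "pw\<^sup>2 * N \<le> real n" using sqrt_syk_var(2)[OF q1 n1(1)] mult_left_mono[OF Nb(2), of "pw\<^sup>2"] by (simp add: pw_def)
      then have "c3 * (pw\<^sup>2 * N) \<le> c3 * real n" using c3 by simp
      moreover have "c * pw * (8 * \<beta> * N * \<sigma>) = c3 * (pw\<^sup>2 * N)"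
        unfolding c_def \<sigma>_eq using assms(3) f by (simp add: power2_eq_square field_simps)
      ultimately have "c * pw * (8 * \<beta> * N * \<sigma>) \<le> e" by (simp only: e_def)
      then show ?thesis using assms(3) N \<sigma> by (simp add: pos_le_divide_eq)
    qed
    have err: "16 * N * \<beta>\<^sup>2 * s * \<sigma>\<^sup>2 / e\<^sup>2 \<le> 16 * \<beta>\<^sup>2 * s * f / c3\<^sup>2 / real n"
    proof -
      have "16 * N * \<beta>\<^sup>2 * s * \<sigma>\<^sup>2 / e\<^sup>2 = (16 * \<beta>\<^sup>2 * s) * (v * N) / e\<^sup>2" by (simp add: \<sigma>2)
      also have "\<dots> \<le> (16 * \<beta>\<^sup>2 * s) * (f * real n) / e\<^sup>2"
        using Nb(3) s by (intro divide_right_mono mult_left_mono) auto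
      also have "\<dots> = 16 * \<beta>\<^sup>2 * s * f / c3\<^sup>2 / real n"
        using n0 c3 by (simp add: e_def power2_eq_square field_simps)
      finally show ?thesis .
    qed
    have "1 / real (card S) \<le> 1 / N" using N by (simp add: card_S N_def[symmetric] frac_le)
    also have "\<dots> \<le> f / c1 / real n"
    proof -
      \<comment> \<open>The variance is at most f, so the lower bound on v N also bounds N itself
        below by a multiple of n.\<close>
      have "c1 * real n \<le> f * N" using Nb(1) v_le N by (meson less_imp_le mult_right_mono order_trans)
      then show ?thesis using c12 n0 N by (simp add: field_simps)
    qed
    finally have err2: "1 / real (card S) \<le> f / c1 / real n" .
    have "1 - (16 * N * \<beta>\<^sup>2 * s * \<sigma>\<^sup>2 / e\<^sup>2 + 16 * N * \<beta>\<^sup>2 * s * \<sigma>\<^sup>2 / e\<^sup>2 + 1 / real (card S)) \<le> p n"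
      unfolding p_eq N_def by (rule obs_gap_lower_bound[OF assms(3) e0 e_le[unfolded N_def K_def] thr[unfolded N_def]])
    moreover have "C / real n = 16 * \<beta>\<^sup>2 * s * f / c3\<^sup>2 / real n + 16 * \<beta>\<^sup>2 * s * f / c3\<^sup>2 / real n + f / c1 / real n"
    proof -
      have "C = 16 * \<beta>\<^sup>2 * s * f / c3\<^sup>2 + 16 * \<beta>\<^sup>2 * s * f / c3\<^sup>2 + f / c1" by (simp add: C_def)
      then show ?thesis by (simp only: add_divide_distrib)
    qed
    moreover have "p n \<le> 1" unfolding p_eq by (rule prob_space.prob_le_1[OF P_prob])
    ultimately show ?thesis using err err2 by linarith
  qed
  have even_bounds: "1 - C / real (2 * m) \<le> p (2 * m) \<and> p (2 * m) \<le> 1" if "q \<le> m" for m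
    by (rule bounds) (use that in auto)
  have "(\<lambda>m. p (2 * m)) \<longlonglongrightarrow> 1"
  proof (rule tendsto_sandwich)
    show "\<forall>\<^sub>F m in sequentially. 1 - C / real (2 * m) \<le> p (2 * m)"
      using eventually_ge_at_top[of q] by eventually_elim (use even_bounds in blast)
    show "\<forall>\<^sub>F m in sequentially. p (2 * m) \<le> 1"
      using eventually_ge_at_top[of q] by eventually_elim (use even_bounds in blast)
    show "(\<lambda>m. 1 - C / real (2 * m)) \<longlonglongrightarrow> 1" by real_asymp
  qed simp
  then show ?thesis using c unfolding p_def Let_def by blast
qed

end
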